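(* Let $\Omega$ be a quiver which is a tree and such that $\mathrm{indec}_{\mathrm{FLEI}}(\Omega)$ is a well-founded partially ordered set, and let $V$ be a representation of $\Omega$. For each $\beta\in\mathrm{indec}_{\mathrm{FLEI}}(\Omega)$ there is a subrepresentation $G_\beta\subseteq F_\beta$ such that $G_\beta$ is a direct sum of elements of $\beta$ and such that $F_\beta=F_{<\beta}\oplus G_\beta$.
   Context: A quiver $\Omega=(\Omega_0,\Omega_1)$ is a (possibly infinite) set of vertices and a set of ordered pairs of vertices (arrows) with source and target maps $s,t$; it is a tree if its underlying undirected graph is a tree. A representation $V$ (over a fixed field) assigns to each vertex $i$ a vector space $V(i)$ (of arbitrary dimension) and to each arrow $a$ a linear map $V(a):V(s(a))\to V(t(a))$. $V$ is FLEI if every $V(i)$ is finite-dimensional and $V(a)$ is an isomorphism for all but finitely many arrows $a$. $\mathrm{indec}_{\mathrm{FLEI}}(\Omega)$ is the set of isomorphism classes of indecomposable FLEI representations; $X\in\alpha$ means $X$ belongs to the class $\alpha$. Relation: $\alpha\ge\beta$ iff there are $\alpha=\gamma_1,\gamma_2,\dots,\gamma_n=\beta$ in $\mathrm{indec}_{\mathrm{FLEI}}(\Omega)$ (with $n\ge1$), representatives $W^{\gamma_i}\in\gamma_i$, and morphisms $W^{\gamma_1}\to W^{\gamma_2}\to\cdots\to W^{\gamma_n}$ each of which is nonzero and not an isomorphism. For the fixed representation $V$, define subrepresentations of $V$: $F_\beta=\sum X$, the sum over all subrepresentations $X\subseteq V$ with $X\in\alpha$ for some $\alpha\le\beta$;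 and $F_{<\beta}=\sum_{\alpha<\beta}F_\alpha$. (A possibly infinite sum of subrepresentations assigns to each vertex all finite linear combinations of vectors of the individual subrepresentations at that vertex.) The direct sums are internal, inside $V$. *)

theory Defs
  imports Complex_Main "HOL-Library.Function_Algebras" "Graph_Theory.Digraph_Component"
begin

text \<open>
  Quivers are the (possibly infinite) directed multigraphs of \<^typ>\<open>('i, 'a) pre_digraph\<close>,
  with \<^const>\<open>tail\<close> as source map and \<^const>\<open>head\<close> as target map.
  The library predicate \<^const>\<open>tree\<close> only excludes directed cycles.  Here cycles of the
  underlying undirected multigraph are needed; loops (length 1) and parallel or antiparallel
  arrows (length 2) are cycles.
\<close>

definition undirected_cycle :: "('i, 'a) pre_digraph \<Rightarrow> 'i list \<Rightarrow> 'a list \<Rightarrow> bool" where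
  "undirected_cycle Q vs es \<longleftrightarrow>
     es \<noteq> [] \<and> length vs = length es \<and> distinct vs \<and> distinct es \<and>
     set vs \<subseteq> verts Q \<and> set es \<subseteq> arcs Q \<and>
     (\<forall>j<length es. {tail Q (es ! j), head Q (es ! j)} = {vs ! j, vs ! (Suc j mod length es)})"

definition tree_quiver :: "('i, 'a) pre_digraph \<Rightarrow> bool" where
  "tree_quiver Q \<longleftrightarrow> connected Q \<and> \<not> (\<exists>vs es. undirected_cycle Q vs es)"


text \<open>
  The spaces of a representation are subspaces of one ambient vector space, given by a type
  \<^typ>\<open>'v\<close> with scalar multiplication \<open>s\<close>.  This is no restriction: every family of vector
  spaces embeds into its direct sum.  Only the values at vertices and arrows of the quiver, and
  of the arrow maps on their source spaces, carry meaning.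
\<close>

record ('i, 'a, 'v) qrep =
  Space :: "'i \<Rightarrow> 'v set"
  Map :: "'a \<Rightarrow> 'v \<Rightarrow> 'v"

definition linear_between ::
  "('k::field \<Rightarrow> 'v::ab_group_add \<Rightarrow> 'v) \<Rightarrow> ('k \<Rightarrow> 'w::ab_group_add \<Rightarrow> 'w) \<Rightarrow>
   'v set \<Rightarrow> 'w set \<Rightarrow> ('v \<Rightarrow> 'w) \<Rightarrow> bool" where
  "linear_between s s' A B f \<longleftrightarrow>
     (\<forall>x\<in>A. f x \<in> B) \<and>
     (\<forall>x\<in>A. \<forall>y\<in>A. f (x + y) = f x + f y) \<and>
     (\<forall>c. \<forall>x\<in>A. f (s c x) = s' c (f x))"

definition quiver_rep ::
  "('k::field \<Rightarrow> 'v::ab_group_add \<Rightarrow> 'v) \<Rightarrow> ('i, 'a) pre_digraph \<Rightarrow> ('i, 'a, 'v) qrep \<Rightarrow> bool" where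
  "quiver_rep s Q V \<longleftrightarrow>
     (\<forall>i\<in>verts Q. module.subspace s (Space V i)) \<and>
     (\<forall>a\<in>arcs Q. linear_between s s (Space V (tail Q a)) (Space V (head Q a)) (Map V a))"

definition rep_morphism ::
  "('k::field \<Rightarrow> 'v::ab_group_add \<Rightarrow> 'v) \<Rightarrow> ('k \<Rightarrow> 'w::ab_group_add \<Rightarrow> 'w) \<Rightarrow>
   ('i, 'a) pre_digraph \<Rightarrow> ('i, 'a, 'v) qrep \<Rightarrow> ('i, 'a, 'w) qrep \<Rightarrow> ('i \<Rightarrow> 'v \<Rightarrow> 'w) \<Rightarrow> bool" where
  "rep_morphism s s' Q V W f \<longleftrightarrow>
     (\<forall>i\<in>verts Q. linear_between s s' (Space V i) (Space W i) (f i)) \<and>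
     (\<forall>a\<in>arcs Q. \<forall>x\<in>Space V (tail Q a).
        f (head Q a) (Map V a x) = Map W a (f (tail Q a) x))"

definition zero_morphism ::
  "('i, 'a) pre_digraph \<Rightarrow> ('i, 'a, 'v) qrep \<Rightarrow> ('i \<Rightarrow> 'v \<Rightarrow> 'w::zero) \<Rightarrow> bool" where
  "zero_morphism Q V f \<longleftrightarrow> (\<forall>i\<in>verts Q. \<forall>x\<in>Space V i. f i x = 0)"

definition rep_isomorphism ::
  "('k::field \<Rightarrow> 'v::ab_group_add \<Rightarrow> 'v) \<Rightarrow> ('k \<Rightarrow> 'w::ab_group_add \<Rightarrow> 'w) \<Rightarrow>
   ('i, 'a) pre_digraph \<Rightarrow> ('i, 'a, 'v) qrep \<Rightarrow> ('i, 'a, 'w) qrep \<Rightarrow> ('i \<Rightarrow> 'v \<Rightarrow> 'w) \<Rightarrow> bool" where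
  "rep_isomorphism s s' Q V W f \<longleftrightarrow>
     rep_morphism s s' Q V W f \<and> (\<forall>i\<in>verts Q. bij_betw (f i) (Space V i) (Space W i))"

definition rep_isomorphic ::
  "('k::field \<Rightarrow> 'v::ab_group_add \<Rightarrow> 'v) \<Rightarrow> ('k \<Rightarrow> 'w::ab_group_add \<Rightarrow> 'w) \<Rightarrow>
   ('i, 'a) pre_digraph \<Rightarrow> ('i, 'a, 'v) qrep \<Rightarrow> ('i, 'a, 'w) qrep \<Rightarrow> bool" where
  "rep_isomorphic s s' Q V W \<longleftrightarrow> (\<exists>f. rep_isomorphism s s' Q V W f)"

text \<open>A subrepresentation keeps the arrow maps as functions; restriction is implicit.\<close>

definition subrep ::
  "('k::field \<Rightarrow> 'v::ab_group_add \<Rightarrow> 'v) \<Rightarrow> ('i, 'a) pre_digraph \<Rightarrow>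
   ('i, 'a, 'v) qrep \<Rightarrow> ('i, 'a, 'v) qrep \<Rightarrow> bool" where
  "subrep s Q V X \<longleftrightarrow>
     quiver_rep s Q X \<and> (\<forall>i\<in>verts Q. Space X i \<subseteq> Space V i) \<and> Map X = Map V"

definition zero_rep :: "('i, 'a) pre_digraph \<Rightarrow> ('i, 'a, 'v::zero) qrep \<Rightarrow> bool" where
  "zero_rep Q V \<longleftrightarrow> (\<forall>i\<in>verts Q. Space V i = {0})"

text \<open>The sum, inside \<open>V\<close>, of a possibly infinite set of subrepresentations of \<open>V\<close>.\<close>

definition rep_sum ::
  "('k::field \<Rightarrow> 'v::ab_group_add \<Rightarrow> 'v) \<Rightarrow> ('i, 'a, 'v) qrep \<Rightarrow>
   ('i, 'a, 'v) qrep set \<Rightarrow> ('i, 'a, 'v) qrep" where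
  "rep_sum s V S = \<lparr>Space = (\<lambda>i. module.span s (\<Union>X\<in>S. Space X i)), Map = Map V\<rparr>"

definition direct_sum_two ::
  "('k::field \<Rightarrow> 'v::ab_group_add \<Rightarrow> 'v) \<Rightarrow> ('i, 'a) pre_digraph \<Rightarrow>
   ('i, 'a, 'v) qrep \<Rightarrow> ('i, 'a, 'v) qrep \<Rightarrow> ('i, 'a, 'v) qrep \<Rightarrow> bool" where
  "direct_sum_two s Q V X Y \<longleftrightarrow>
     subrep s Q V X \<and> subrep s Q V Y \<and>
     (\<forall>i\<in>verts Q. Space V i = {x + y | x y. x \<in> Space X i \<and> y \<in> Space Y i} \<and>
                  Space X i \<inter> Space Y i = {0})"

text \<open>
  The summands form a set rather than an indexed family.  For nonzero summands this is the same,
  since the members of an independent family of nonzero subspaces are distinct.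
\<close>

definition direct_sum_of ::
  "('k::field \<Rightarrow> 'v::ab_group_add \<Rightarrow> 'v) \<Rightarrow> ('i, 'a) pre_digraph \<Rightarrow>
   ('i, 'a, 'v) qrep \<Rightarrow> ('i, 'a, 'v) qrep set \<Rightarrow> bool" where
  "direct_sum_of s Q G S \<longleftrightarrow>
     (\<forall>X\<in>S. subrep s Q G X) \<and>
     (\<forall>i\<in>verts Q. Space G i = module.span s (\<Union>X\<in>S. Space X i) \<and>
        (\<forall>X\<in>S. Space X i \<inter> module.span s (\<Union>Y\<in>S - {X}. Space Y i) = {0}))"

definition indecomposable_rep ::
  "('k::field \<Rightarrow> 'v::ab_group_add \<Rightarrow> 'v) \<Rightarrow> ('i, 'a) pre_digraph \<Rightarrow> ('i, 'a, 'v) qrep \<Rightarrow> bool" where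
  "indecomposable_rep s Q V \<longleftrightarrow>
     quiver_rep s Q V \<and> \<not> zero_rep Q V \<and>
     (\<forall>X Y. direct_sum_two s Q V X Y \<longrightarrow> zero_rep Q X \<or> zero_rep Q Y)"

definition flei ::
  "('k::field \<Rightarrow> 'v::ab_group_add \<Rightarrow> 'v) \<Rightarrow> ('i, 'a) pre_digraph \<Rightarrow> ('i, 'a, 'v) qrep \<Rightarrow> bool" where
  "flei s Q V \<longleftrightarrow>
     quiver_rep s Q V \<and>
     (\<forall>i\<in>verts Q. \<exists>B. finite B \<and> Space V i = module.span s B) \<and>
     finite {a \<in> arcs Q. \<not> bij_betw (Map V a) (Space V (tail Q a)) (Space V (head Q a))}"


text \<open>
  Isomorphism classes are formed over one fixed ambient space, the sequences over the field.
  It contains a copy of every finite-dimensional space, so each isomorphism class of FLEI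
  representations (in whatever ambient space) is represented there exactly once.
\<close>

definition seq_scale :: "'k::field \<Rightarrow> (nat \<Rightarrow> 'k) \<Rightarrow> (nat \<Rightarrow> 'k)" where
  "seq_scale c x = (\<lambda>n. c * x n)"

lemma vector_space_seq_scale: "vector_space (seq_scale :: 'k::field \<Rightarrow> _)"
  by unfold_locales (auto simp: seq_scale_def fun_eq_iff algebra_simps)

type_synonym ('i, 'a, 'k) rep_class = "('i, 'a, nat \<Rightarrow> 'k) qrep set"

definition indec_flei :: "('i, 'a) pre_digraph \<Rightarrow> ('i, 'a, 'k::field) rep_class set" where
  "indec_flei Q =
     {W. flei seq_scale Q W \<and> indecomposable_rep seq_scale Q W} //
     {(W, W'). flei seq_scale Q W \<and> indecomposable_rep seq_scale Q W \<and>
               flei seq_scale Q W' \<and> indecomposable_rep seq_scale Q W' \<and>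
               rep_isomorphic seq_scale seq_scale Q W W'}"

definition in_class ::
  "('k::field \<Rightarrow> 'v::ab_group_add \<Rightarrow> 'v) \<Rightarrow> ('i, 'a) pre_digraph \<Rightarrow>
   ('i, 'a, 'v) qrep \<Rightarrow> ('i, 'a, 'k) rep_class \<Rightarrow> bool" where
  "in_class s Q X \<alpha> \<longleftrightarrow> quiver_rep s Q X \<and> (\<exists>W\<in>\<alpha>. rep_isomorphic s seq_scale Q X W)"

definition indec_ge ::
  "('i, 'a) pre_digraph \<Rightarrow> ('i, 'a, 'k::field) rep_class \<Rightarrow> ('i, 'a, 'k) rep_class \<Rightarrow> bool" where
  "indec_ge Q \<alpha> \<beta> \<longleftrightarrow>
     (\<exists>\<gamma>s Ws. \<gamma>s \<noteq> [] \<and> set \<gamma>s \<subseteq> indec_flei Q \<and> hd \<gamma>s = \<alpha> \<and> last \<gamma>s = \<beta> \<and>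
        length Ws = length \<gamma>s \<and> (\<forall>j<length \<gamma>s. Ws ! j \<in> \<gamma>s ! j) \<and>
        (\<forall>j. Suc j < length \<gamma>s \<longrightarrow>
           (\<exists>f. rep_morphism seq_scale seq_scale Q (Ws ! j) (Ws ! Suc j) f \<and>
                \<not> zero_morphism Q (Ws ! j) f \<and>
                \<not> rep_isomorphism seq_scale seq_scale Q (Ws ! j) (Ws ! Suc j) f)))"

text \<open>The pair \<open>(\<alpha>, \<beta>)\<close> belongs to \<open>indec_order Q\<close> iff \<open>\<alpha> \<le> \<beta>\<close>.\<close>

definition indec_order ::
  "('i, 'a) pre_digraph \<Rightarrow> (('i, 'a, 'k::field) rep_class \<times> ('i, 'a, 'k) rep_class) set" where
  "indec_order Q = {(\<alpha>, \<beta>). \<alpha> \<in> indec_flei Q \<and> \<beta> \<in> indec_flei Q \<and> indec_ge Q \<beta> \<alpha>}"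

definition F_le ::
  "('k::field \<Rightarrow> 'v::ab_group_add \<Rightarrow> 'v) \<Rightarrow> ('i, 'a) pre_digraph \<Rightarrow>
   ('i, 'a, 'v) qrep \<Rightarrow> ('i, 'a, 'k) rep_class \<Rightarrow> ('i, 'a, 'v) qrep" where
  "F_le s Q V \<beta> =
     rep_sum s V {X. subrep s Q V X \<and> (\<exists>\<alpha>. (\<alpha>, \<beta>) \<in> indec_order Q \<and> in_class s Q X \<alpha>)}"

definition F_less ::
  "('k::field \<Rightarrow> 'v::ab_group_add \<Rightarrow> 'v) \<Rightarrow> ('i, 'a) pre_digraph \<Rightarrow>
   ('i, 'a, 'v) qrep \<Rightarrow> ('i, 'a, 'k) rep_class \<Rightarrow> ('i, 'a, 'v) qrep" where
  "F_less s Q V \<beta> = rep_sum s V {F_le s Q V \<alpha> | \<alpha>. (\<alpha>, \<beta>) \<in> indec_order Q \<and> \<alpha> \<noteq> \<beta>}"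

end

theory Submission
  imports Defs "HOL-Library.Ramsey"
begin

text \<open>
  Choose, by Zorn's lemma, a maximal set \<open>S\<close> of subrepresentations of \<open>V\<close> in the class \<open>\<beta>\<close> that is
  independent modulo \<open>F\<^sub><\<^sub>\<beta>\<close>, and let \<open>G\<close> be its sum.  What has to be shown is that a further
  subrepresentation \<open>X\<close> in \<open>\<beta>\<close> lies in \<open>F\<^sub><\<^sub>\<beta> + G\<close>.  By maximality some nonzero vector of \<open>X\<close> is a sum of
  vectors of finitely many members \<open>X\<^sub>1, \<dots>, X\<^sub>n\<close> of \<open>S\<close> and finitely many \<open>Y\<^sub>j\<close> in classes below \<open>\<beta>\<close>.
  The sum \<open>E\<close> of \<open>X\<close>, the \<open>X\<^sub>k\<close> and the \<open>Y\<^sub>j\<close> is again FLEI (this is the heart of the matter), so it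
  is a finite direct sum of indecomposable FLEI representations.  Each of them receives a nonzero
  morphism from one of the generators of \<open>E\<close> and therefore has a class \<open>\<le> \<beta>\<close>.  Hence \<open>E\<close> is a sum of \<open>m\<close>
  copies of \<open>\<beta>\<close> and a part \<open>E\<^sub>2\<close> inside \<open>F\<^sub><\<^sub>\<beta>\<close>, and by antisymmetry all \<open>Y\<^sub>j\<close> lie in \<open>E\<^sub>2\<close>.  Modulo \<open>E\<^sub>2\<close>
  the \<open>X\<^sub>k\<close> remain independent and together with \<open>X\<close> they generate \<open>E\<close>, so counting dimensions at a
  vertex gives \<open>m = n\<close> or \<open>m = n + 1\<close>.  In the first case the \<open>X\<^sub>k\<close> and \<open>E\<^sub>2\<close> already exhaust \<open>E\<close>, so
  \<open>X\<close> is contained in \<open>F\<^sub><\<^sub>\<beta> + G\<close>; in the second case \<open>X\<close> meets their sum trivially, contrary to the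
  relation.  This is \<open>dependent_member_absorbed\<close>, which rests on the decomposition \<open>splits_exists\<close>.

  A sum \<open>A + B\<close> of FLEI subrepresentations is FLEI as soon as \<open>A \<inter> B\<close> is, so \<open>E\<close> is FLEI because every
  subrepresentation \<open>K\<close> of an FLEI representation \<open>P\<close> is (\<open>subrep_flei\<close>).  This depends on the
  hypotheses on the order.  Suppose that infinitely many arrows are isomorphisms in \<open>P\<close> but not in
  \<open>K\<close>.  Root the tree; each arrow cuts off an outer part, and any two outer parts are nested or
  disjoint.  By Ramsey's theorem infinitely many of these arrows have pairwise disjoint outer
  parts, or infinitely many are nested.

  Four disjoint outer parts turn the tree, after contraction of all other arrows, into a star with
  four arms.  On a star with four arms there are two nonisomorphic indecomposable representations,
  a plane with four lines of which two coincide, with nonzero morphisms in both directions; this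
  contradicts antisymmetry (\<open>no_four_disjoint_cuts\<close>).  Nested outer parts lie along a ray.  If
  infinitely many arrows of the ray point to the root, the thin representations supported on the
  inner parts of their cuts form an infinite strictly descending sequence of classes, contrary to
  well-foundedness (\<open>no_infinite_inward_chain\<close>).  Otherwise the ray is eventually directed away from
  the root, and along it the dimension of \<open>K\<close> never drops and rises infinitely often, although
  it is bounded by the eventually constant dimension of \<open>P\<close>.
\<close>

section \<open>Subspaces of finite dimension\<close>

definition fin_dim :: "('k::field \<Rightarrow> 'v::ab_group_add \<Rightarrow> 'v) \<Rightarrow> 'v set \<Rightarrow> bool" where
  "fin_dim s A \<longleftrightarrow> (\<exists>B. finite B \<and> A = module.span s B)"

context vector_space begin

lemma fin_dim_imp_subspace: "fin_dim scale A \<Longrightarrow> subspace A"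
  unfolding fin_dim_def by auto

lemma fin_dim_obtain_basis:
  assumes "fin_dim scale A"
  obtains B where "finite B" "independent B" "span B = A" "card B = dim A" "B \<subseteq> A"
proof -
  obtain B0 where B0: "finite B0" "A = span B0" using assms unfolding fin_dim_def by blast
  obtain B where B: "B \<subseteq> A" "independent B" "A \<subseteq> span B" "card B = dim A"
    by (rule basis_exists)
  have "finite B" using independent_span_bound[OF B0(1) B(2)] B(1) B0(2) by auto
  moreover have "span B = A"
    using B(1,3) fin_dim_imp_subspace[OF assms] by (simp add: span_minimal subset_antisym)
  ultimately show thesis using that B by blast
qed

lemma independent_card_le_fin_dim:
  assumes "fin_dim scale A" "independent C" "C \<subseteq> A"
  shows "finite C \<and> card C \<le> dim A"
proof -
  obtain B where "finite B" "independent B" "span B = A" "card B = dim A" "B \<subseteq> A"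
    by (rule fin_dim_obtain_basis[OF assms(1)])
  then show ?thesis using independent_span_bound[of B C] assms by auto
qed

lemma fin_dim_subspace:
  assumes "fin_dim scale A" "subspace C" "C \<subseteq> A"
  shows "fin_dim scale C" "dim C \<le> dim A"
proof -
  obtain B where B: "B \<subseteq> C" "independent B" "C \<subseteq> span B" "card B = dim C"
    by (rule basis_exists)
  have f: "finite B \<and> card B \<le> dim A"
    using independent_card_le_fin_dim[OF assms(1) B(2)] B(1) assms(3) by auto
  moreover have "span B = C" using B(1,3) assms(2) by (simp add: span_minimal subset_antisym)
  ultimately show "fin_dim scale C" unfolding fin_dim_def by blast
  show "dim C \<le> dim A" using f B(4) by simp
qed

lemma fin_dim_psubspace_dim_less:
  assumes "fin_dim scale A" "subspace C" "C \<subset> A"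
  shows "dim C < dim A"
proof -
  obtain B where B: "finite B" "independent B" "span B = C" "card B = dim C" "B \<subseteq> C"
    by (rule fin_dim_obtain_basis[OF fin_dim_subspace(1)[OF assms(1,2)]]) (use assms(3) in blast)+
  obtain x where x: "x \<in> A" "x \<notin> C" using assms(3) by blast
  have i: "independent (insert x B)" using independent_insertI B x by blast
  then have "card (insert x B) \<le> dim A"
    using independent_card_le_fin_dim[OF assms(1) i] B(5) x assms(3) by auto
  moreover have "x \<notin> B" using x B(5) by blast
  ultimately show ?thesis using B(1,4) by simp
qed

lemma fin_dim_zero: "fin_dim scale {0}" "dim {0} = 0"
proof -
  show "fin_dim scale {0}" unfolding fin_dim_def by (rule exI[of _ "{}"]) auto
  show "dim {0} = 0" using dim_span_eq_card_independent[of "{}"] by (simp add: independent_empty)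
qed

lemma fin_dim_eq_zero_iff:
  assumes "fin_dim scale A"
  shows "dim A = 0 \<longleftrightarrow> A = {0}"
proof
  assume "dim A = 0"
  moreover have "{0} \<subseteq> A" using fin_dim_imp_subspace[OF assms] by (simp add: subspace_0)
  ultimately show "A = {0}"
    using fin_dim_psubspace_dim_less[OF assms, of "{0}"] by (metis less_zeroE psubsetI subspace_single_0)
qed (simp add: fin_dim_zero)

lemma independent_Un_basis:
  assumes "finite T" "independent S" "independent T" "span S \<inter> span T = {0}"
  shows "independent (S \<union> T) \<and> S \<inter> T = {}"
  using assms(1,3,4)
proof (induction T rule: finite_induct)
  case empty then show ?case using assms(2) by simp
next
  case (insert x T)
  have iT: "independent T" using insert.prems(1) independent_mono by blast
  have "span S \<inter> span T \<subseteq> {0}" using insert.prems(2) span_mono[of T "insert x T"] by blast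
  then have "span S \<inter> span T = {0}" by (auto simp: span_zero)
  with insert.IH iT have IH: "independent (S \<union> T)" "S \<inter> T = {}" by auto
  have xT: "x \<notin> span T" using insert.prems(1) insert.hyps(2) by (simp add: independent_insert)
  have "x \<notin> span (S \<union> T)"
  proof
    assume "x \<in> span (S \<union> T)"
    then obtain y z where yz: "x = y + z" "y \<in> span S" "z \<in> span T" by (auto simp: span_Un)
    then have "y = x - z" by simp
    moreover have "x - z \<in> span (insert x T)"
      using yz(3) by (meson insertI1 span_base span_diff span_mono subset_insertI subsetD)
    ultimately have "y = 0" using insert.prems(2) yz(2) by blast
    then show False using yz xT by simp
  qed
  moreover have "x \<notin> S"
  proof
    assume "x \<in> S"
    then have "x = 0" using insert.prems(2) by (metis Int_iff insertI1 singletonD span_base)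
    then show False using xT by (simp add: span_zero)
  qed
  ultimately show ?case using IH independent_insertI[of x "S \<union> T"] by auto
qed

lemma fin_dim_span_Un:
  assumes "fin_dim scale A" "fin_dim scale B"
  shows "fin_dim scale (span (A \<union> B))" "dim (span (A \<union> B)) \<le> dim A + dim B"
    "A \<inter> B = {0} \<Longrightarrow> dim (span (A \<union> B)) = dim A + dim B"
proof -
  obtain S where S: "finite S" "independent S" "span S = A" "card S = dim A" "S \<subseteq> A"
    by (rule fin_dim_obtain_basis[OF assms(1)])
  obtain T where T: "finite T" "independent T" "span T = B" "card T = dim B" "T \<subseteq> B"
    by (rule fin_dim_obtain_basis[OF assms(2)])
  have eq: "span (A \<union> B) = span (S \<union> T)"
    unfolding S(3)[symmetric] T(3)[symmetric] by (simp only: span_Un span_span)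
  show "fin_dim scale (span (A \<union> B))" unfolding fin_dim_def eq using S T by blast
  have "dim (span (A \<union> B)) \<le> card (S \<union> T)" unfolding eq
    by (rule dim_le_card) (use S T in auto)
  then show "dim (span (A \<union> B)) \<le> dim A + dim B"
    using card_Un_le[of S T] S(4) T(4) by linarith
  assume z: "A \<inter> B = {0}"
  have i: "independent (S \<union> T)" "S \<inter> T = {}"
    using independent_Un_basis[of T S] S T z by auto
  show "dim (span (A \<union> B)) = dim A + dim B"
    using dim_span_eq_card_independent[OF i(1)] card_Un_disjoint[OF S(1) T(1) i(2)] S(4) T(4)
    unfolding eq by simp
qed

text \<open>
  A basis of the intersection extended to one of \<open>B\<close> shows that the part of it outside the
  intersection generates the sum together with \<open>A\<close>, so a nonzero intersection costs dimension.
\<close>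

lemma fin_dim_sum_direct:
  assumes A: "fin_dim scale A" and B: "fin_dim scale B"
    and eq: "dim A + dim B \<le> dim (span (A \<union> B))"
  shows "A \<inter> B = {0}"
proof -
  have sA: "subspace A" and sB: "subspace B" using A B fin_dim_imp_subspace by auto
  have I: "fin_dim scale (A \<inter> B)"
    using fin_dim_subspace(1)[OF B] sA sB by (simp add: subspace_inter)
  obtain S where S: "finite S" "independent S" "span S = A \<inter> B" "card S = dim (A \<inter> B)" "S \<subseteq> A \<inter> B"
    by (rule fin_dim_obtain_basis[OF I])
  obtain T where T: "S \<subseteq> T" "T \<subseteq> B" "independent T" "B \<subseteq> span T"
    using maximal_independent_subset_extend[of S B] S by blast
  have fT: "finite T" using independent_card_le_fin_dim[OF B T(3,2)] by simp
  have cT: "card T = dim B" using T basis_card_eq_dim by blast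
  have C: "fin_dim scale (span (T - S))" unfolding fin_dim_def using fT by blast
  have dC: "dim (span (T - S)) = card (T - S)"
    by (rule dim_span_eq_card_independent) (use T(3) independent_mono in blast)
  have "A \<union> B \<subseteq> span (A \<union> span (T - S))"
  proof -
    have "T \<subseteq> span (A \<union> span (T - S))"
    proof
      fix t assume "t \<in> T"
      then have "t \<in> A \<union> (T - S)" using S(5) by blast
      then show "t \<in> span (A \<union> span (T - S))" by (meson Un_iff span_base)
    qed
    then have "span T \<subseteq> span (A \<union> span (T - S))" by (simp add: span_minimal)
    then have "B \<subseteq> span (A \<union> span (T - S))" using T(4) by blast
    moreover have "A \<subseteq> span (A \<union> span (T - S))" by (meson Un_upper1 order_trans span_superset)
    ultimately show ?thesis by blast
  qed
  then have sub: "span (A \<union> B) \<subseteq> span (A \<union> span (T - S))" by (simp add: span_minimal)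
  have "dim (span (A \<union> B)) \<le> dim (span (A \<union> span (T - S)))"
    using fin_dim_subspace(2)[OF fin_dim_span_Un(1)[OF A C] _ sub] by simp
  also have "\<dots> \<le> dim A + card (T - S)" using fin_dim_span_Un(2)[OF A C] dC by simp
  finally have "dim B \<le> card (T - S)" using eq by linarith
  then have "card T \<le> card T - card S" "card S \<le> card T"
    using cT S(1) T(1) card_mono[OF fT T(1)] by (simp_all add: card_Diff_subset)
  then have "card S = 0" by linarith
  then show ?thesis using S fin_dim_eq_zero_iff[OF I] by simp
qed

lemma sum_fun_upd_add:
  fixes f :: "'c \<Rightarrow> 'd::comm_monoid_add"
  assumes "finite I" "x \<in> I"
  shows "sum (f(x := f x + d)) I = sum f I + d"
proof -
  have "sum (f(x := f x + d)) (I - {x}) = sum f (I - {x})" by (rule sum.cong) auto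
  then show ?thesis
    unfolding sum.remove[OF assms, of f] sum.remove[OF assms, of "f(x := f x + d)"]
    by (simp add: ac_simps)
qed

lemma span_family_sum:
  assumes "\<And>X. X \<in> S \<Longrightarrow> subspace (A X)" "x \<in> span (\<Union>X\<in>S. A X)"
  obtains T g where "finite T" "T \<subseteq> S" "\<And>X. X \<in> T \<Longrightarrow> g X \<in> A X" "x = sum g T"
proof -
  let ?P = "\<lambda>x. \<exists>T g. finite T \<and> T \<subseteq> S \<and> (\<forall>X\<in>T. g X \<in> A X) \<and> x = sum g T"
  have "?P x"
    using assms(2)
  proof (induction rule: span_induct_alt)
    case base
    show ?case by (rule exI[of _ "{}"]) auto
  next
    case (step c x y)
    obtain X where X: "X \<in> S" "x \<in> A X" using step.hyps by blast
    obtain T g where T: "finite T" "T \<subseteq> S" "\<forall>X\<in>T. g X \<in> A X" "y = sum g T"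
      using step.IH by blast
    define g0 where "g0 Y = (if Y \<in> T then g Y else 0)" for Y
    define h where "h = g0(X := g0 X + c *s x)"
    have "sum g0 (insert X T) = sum g T"
      using T(1) by (intro sum.mono_neutral_cong_right) (auto simp: g0_def)
    moreover have "sum h (insert X T) = sum g0 (insert X T) + c *s x"
      unfolding h_def by (rule sum_fun_upd_add) (use T(1) in auto)
    ultimately have "c *s x + y = sum h (insert X T)" using T(4) by (simp add: add.commute)
    moreover have "\<forall>Y\<in>insert X T. h Y \<in> A Y"
      using T(2,3) X assms(1) unfolding h_def g0_def
      by (auto intro!: subspace_add subspace_scale subspace_0)
    ultimately show ?case using T(1,2) X(1) by (intro exI[of _ "insert X T"] exI[of _ h]) simp
  qed
  then show thesis using that by blast
qed

lemma dim_span_family: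
  assumes "finite T" "\<And>X. X \<in> T \<Longrightarrow> fin_dim scale (A X)"
    and "\<And>g. \<lbrakk>\<And>X. X \<in> T \<Longrightarrow> g X \<in> A X; sum g T = 0\<rbrakk> \<Longrightarrow> \<forall>X\<in>T. g X = 0"
  shows "fin_dim scale (span (\<Union>X\<in>T. A X)) \<and> dim (span (\<Union>X\<in>T. A X)) = (\<Sum>X\<in>T. dim (A X))"
  using assms
proof (induction T rule: finite_induct)
  case empty
  show ?case using fin_dim_zero by simp
next
  case (insert Z T)
  have sub: "subspace (A X)" if "X \<in> insert Z T" for X
    using fin_dim_imp_subspace insert.prems(1)[OF that] .
  have IH: "fin_dim scale (span (\<Union>X\<in>T. A X)) \<and> dim (span (\<Union>X\<in>T. A X)) = (\<Sum>X\<in>T. dim (A X))"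
  proof (rule insert.IH)
    fix g assume g: "\<And>X. X \<in> T \<Longrightarrow> g X \<in> A X" "sum g T = 0"
    have "sum (g(Z := 0)) T = sum g T" using insert.hyps(2) by (intro sum.cong) auto
    then have "sum (g(Z := 0)) (insert Z T) = 0" using g(2) insert.hyps by simp
    moreover have "(g(Z := 0)) X \<in> A X" if "X \<in> insert Z T" for X
      using that g(1) sub[OF that] by (auto simp: subspace_0)
    ultimately have "\<forall>X\<in>insert Z T. (g(Z := 0)) X = 0"
      using insert.prems(2)[of "g(Z := 0)"] by blast
    then show "\<forall>X\<in>T. g X = 0" using insert.hyps(2) by (metis fun_upd_other insertCI)
  qed (use insert.prems(1) in auto)
  have "A Z \<inter> span (\<Union>X\<in>T. A X) \<subseteq> {0}"
  proof
    fix x assume x: "x \<in> A Z \<inter> span (\<Union>X\<in>T. A X)"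
    then obtain T' g where T': "finite T'" "T' \<subseteq> T" "\<And>X. X \<in> T' \<Longrightarrow> g X \<in> A X" "x = sum g T'"
      using span_family_sum[of T A x] sub by blast
    let ?h = "\<lambda>Y. if Y = Z then - x else if Y \<in> T' then g Y else 0"
    have "sum ?h T = sum g T'" using T' insert.hyps by (intro sum.mono_neutral_cong_right) auto
    then have "sum ?h (insert Z T) = 0" using insert.hyps T'(4) by simp
    moreover have "?h X \<in> A X" if "X \<in> insert Z T" for X
      using x T'(3) sub[OF that] that by (auto intro: subspace_neg subspace_0)
    ultimately have "\<forall>X\<in>insert Z T. ?h X = 0" using insert.prems(2)[of ?h] by blast
    then show "x \<in> {0}" by auto
  qed
  then have z: "A Z \<inter> span (\<Union>X\<in>T. A X) = {0}" using sub by (auto simp: subspace_0 span_zero)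
  have eq: "span (\<Union>X\<in>insert Z T. A X) = span (A Z \<union> span (\<Union>X\<in>T. A X))"
    by (simp only: UN_insert span_Un span_span)
  show ?case unfolding eq
    using fin_dim_span_Un(1,3)[of "A Z" "span (\<Union>X\<in>T. A X)"] IH z insert by auto
qed

end

subsection \<open>Linear maps between subspaces\<close>

lemma linear_between_zero:
  assumes "vector_space s" "vector_space s'" "module.subspace s A" "linear_between s s' A B f"
  shows "f 0 = 0"
proof -
  interpret v: vector_space s by fact
  interpret w: vector_space s' by fact
  have "f 0 = f (s 0 0)" by simp
  also have "\<dots> = s' 0 (f 0)" using assms(3,4) v.subspace_0 unfolding linear_between_def by blast
  finally show ?thesis by simp
qed

lemma linear_between_diff:
  assumes "vector_space s" "vector_space s'" "module.subspace s A" "linear_between s s' A B f"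
    "x \<in> A" "y \<in> A"
  shows "f (x - y) = f x - f y"
proof -
  interpret v: vector_space s by fact
  have "f (x - y + y) = f (x - y) + f y"
    using assms(3-6) v.subspace_diff unfolding linear_between_def by blast
  then show ?thesis by (simp add: algebra_simps)
qed

lemma linear_between_inj_on_iff:
  assumes "vector_space s" "vector_space s'" "module.subspace s A" "linear_between s s' A B f"
  shows "inj_on f A \<longleftrightarrow> (\<forall>x\<in>A. f x = 0 \<longrightarrow> x = 0)"
proof -
  interpret v: vector_space s by fact
  note d = linear_between_diff[OF assms] and sub = v.subspace_diff[OF assms(3)]
  show ?thesis
  proof
    assume "inj_on f A"
    then show "\<forall>x\<in>A. f x = 0 \<longrightarrow> x = 0"
      using linear_between_zero[OF assms] v.subspace_0[OF assms(3)] by (metis inj_onD)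
  next
    assume r: "\<forall>x\<in>A. f x = 0 \<longrightarrow> x = 0"
    show "inj_on f A"
    proof (rule inj_onI)
      fix x y assume xy: "x \<in> A" "y \<in> A" "f x = f y"
      then have "f (x - y) = 0" using d by simp
      then have "x - y = 0" using r sub xy by blast
      then show "x = y" by simp
    qed
  qed
qed

text \<open>
  A map that is linear on a subspace only is traded for a linear map of the whole space, to which
  the general theory of linear maps applies.
\<close>

lemma linear_between_extends:
  assumes "vector_space s" "vector_space s'" "module.subspace s A" "linear_between s s' A B f"
  obtains g where "Vector_Spaces.linear s s' g" "\<And>x. x \<in> A \<Longrightarrow> g x = f x"
proof -
  interpret v: vector_space s by fact
  interpret w: vector_space s' by fact
  interpret p: vector_space_pair s s' ..
  obtain C where C: "C \<subseteq> A" "v.independent C" "A \<subseteq> v.span C" "card C = v.dim A"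
    by (rule v.basis_exists)
  obtain g where g: "Vector_Spaces.linear s s' g" "\<forall>x\<in>C. g x = f x"
    using p.linear_independent_extend[OF C(2)] by blast
  have lin: "Vector_Spaces.linear s s' g" by fact
  have "x \<in> A \<and> g x = f x" if "x \<in> v.span C" for x
    using that
  proof (induction rule: v.span_induct_alt)
    case base
    show ?case using assms(3) v.subspace_0 linear_between_zero[OF assms] p.linear_0[OF lin] by auto
  next
    case (step c x y)
    have "x \<in> A" "y \<in> A" "g y = f y" "g x = f x" using step C(1) g(2) by auto
    moreover have "s c x \<in> A" using \<open>x \<in> A\<close> assms(3) v.subspace_scale by blast
    ultimately show ?case
      using assms(4) v.subspace_add[OF assms(3)] p.linear_add[OF lin] p.linear_scale[OF lin]
      unfolding linear_between_def by metis
  qed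
  then show thesis using that g(1) C(3) by blast
qed

lemma linear_between_dim_le:
  assumes "vector_space s" "vector_space s'" "fin_dim s A" "fin_dim s' B"
    "linear_between s s' A B f" "inj_on f A"
  shows "vector_space.dim s A \<le> vector_space.dim s' B"
proof -
  interpret v: vector_space s by fact
  interpret w: vector_space s' by fact
  interpret p: vector_space_pair s s' ..
  have sA: "v.subspace A" using assms(3) v.fin_dim_imp_subspace by blast
  obtain g where g: "Vector_Spaces.linear s s' g" "\<And>x. x \<in> A \<Longrightarrow> g x = f x"
    using linear_between_extends[OF assms(1,2) sA assms(5)] by blast
  obtain C where C: "finite C" "v.independent C" "v.span C = A" "card C = v.dim A" "C \<subseteq> A"
    by (rule v.fin_dim_obtain_basis[OF assms(3)])
  have inj: "inj_on g A" using g(2) assms(6) inj_on_cong by blast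
  have "w.independent (g ` C)"
    using p.linear_independent_injective_image[OF g(1) C(2)] inj C(3) by simp
  moreover have "g ` C \<subseteq> B" using g(2) C(5) assms(5) unfolding linear_between_def by auto
  ultimately have "card (g ` C) \<le> w.dim B" using w.independent_card_le_fin_dim[OF assms(4)] by blast
  then show ?thesis using card_image inj C(4,5) by (metis inj_on_subset)
qed

lemma linear_between_image_subspace:
  assumes "vector_space s" "vector_space s'" "module.subspace s A" "linear_between s s' A B f"
  shows "module.subspace s' (f ` A)"
proof -
  interpret v: vector_space s by fact
  interpret w: vector_space s' by fact
  interpret p: vector_space_pair s s' ..
  obtain g where g: "Vector_Spaces.linear s s' g" "\<And>x. x \<in> A \<Longrightarrow> g x = f x"
    using linear_between_extends[OF assms] by blast
  have "f ` A = g ` A" using g(2) by auto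
  then show ?thesis using p.linear_subspace_image[OF g(1) assms(3)] by simp
qed

lemma linear_between_dim_less:
  assumes "vector_space s" "vector_space s'" "fin_dim s A" "fin_dim s' B"
    "linear_between s s' A B f" "inj_on f A" "\<not> bij_betw f A B"
  shows "vector_space.dim s A < vector_space.dim s' B"
proof -
  interpret v: vector_space s by fact
  interpret w: vector_space s' by fact
  have sA: "v.subspace A" using assms(3) v.fin_dim_imp_subspace by blast
  have si: "w.subspace (f ` A)" using linear_between_image_subspace[OF assms(1,2) sA assms(5)] .
  have im: "f ` A \<subset> B" using assms(5,6,7) unfolding linear_between_def bij_betw_def by blast
  have "linear_between s s' A (f ` A) f" using assms(5) unfolding linear_between_def by auto
  then have "v.dim A \<le> w.dim (f ` A)"
    using linear_between_dim_le[OF assms(1-3) w.fin_dim_subspace(1)[OF assms(4) si] _ assms(6)] im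
    by blast
  also have "\<dots> < w.dim B" using w.fin_dim_psubspace_dim_less[OF assms(4) si im] .
  finally show ?thesis .
qed

lemma linear_between_inv_into:
  assumes "vector_space s" "vector_space s'" "module.subspace s A" "linear_between s s' A B f"
    and bij: "bij_betw f A B"
  shows "linear_between s' s B A (inv_into A f)"
proof -
  interpret v: vector_space s by fact
  let ?g = "inv_into A f"
  have g: "?g y \<in> A" "f (?g y) = y" if "y \<in> B" for y
    using that bij by (auto simp: bij_betw_def inv_into_into f_inv_into_f)
  have gf: "?g (f x) = x" if "x \<in> A" for x using that bij by (simp add: bij_betw_def)
  have "?g (x + y) = ?g x + ?g y" if "x \<in> B" "y \<in> B" for x y
    using gf[of "?g x + ?g y"] g[OF that(1)] g[OF that(2)] assms(4) v.subspace_add[OF assms(3)]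
    unfolding linear_between_def by metis
  moreover have "?g (s' c x) = s c (?g x)" if "x \<in> B" for c x
    using gf[of "s c (?g x)"] g[OF that] assms(4) v.subspace_scale[OF assms(3)]
    unfolding linear_between_def by metis
  ultimately show ?thesis using g unfolding linear_between_def by auto
qed

lemma linear_between_compose:
  assumes "linear_between s s' A B f" "linear_between s' s'' B C g"
  shows "linear_between s s'' A C (\<lambda>x. g (f x))"
  using assms unfolding linear_between_def by auto

lemma fin_dim_bij_image:
  assumes "vector_space s" "vector_space s'" "fin_dim s A" "linear_between s s' A B f" "bij_betw f A B"
  shows "fin_dim s' B"
proof -
  interpret v: vector_space s by fact
  interpret w: vector_space s' by fact
  interpret p: vector_space_pair s s' ..
  have sA: "v.subspace A" using assms(3) v.fin_dim_imp_subspace by blast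
  obtain g where g: "Vector_Spaces.linear s s' g" "\<And>x. x \<in> A \<Longrightarrow> g x = f x"
    using linear_between_extends[OF assms(1,2) sA assms(4)] by blast
  obtain C where C: "finite C" "A = v.span C" using assms(3) unfolding fin_dim_def by blast
  have "B = g ` A" using assms(5) g(2) unfolding bij_betw_def by auto
  then have "B = w.span (g ` C)" using p.linear_span_image[OF g(1)] C(2) by simp
  then show ?thesis unfolding fin_dim_def using C(1) by blast
qed

text \<open>
  Number a basis by natural numbers and send each basis vector to the corresponding unit sequence.
\<close>

lemma fin_dim_embeds_in_sequences:
  fixes s :: "'k::field \<Rightarrow> 'v::ab_group_add \<Rightarrow> 'v"
  assumes "vector_space s" "fin_dim s A"
  obtains B and f :: "'v \<Rightarrow> nat \<Rightarrow> 'k" where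
    "module.subspace seq_scale B" "linear_between s seq_scale A B f" "bij_betw f A B"
proof -
  interpret v: vector_space s by fact
  interpret w: vector_space "seq_scale :: 'k \<Rightarrow> _" by (rule vector_space_seq_scale)
  interpret p: vector_space_pair s "seq_scale :: 'k \<Rightarrow> _" ..
  obtain C where C: "finite C" "v.independent C" "v.span C = A" "card C = v.dim A" "C \<subseteq> A"
    by (rule v.fin_dim_obtain_basis[OF assms(2)])
  obtain e :: "'v \<Rightarrow> nat" where e: "inj_on e C" using finite_imp_inj_to_nat_seg[OF C(1)] by metis
  define u :: "'v \<Rightarrow> nat \<Rightarrow> 'k" where "u b = (\<lambda>n. if n = e b then 1 else 0)" for b
  obtain g where g: "Vector_Spaces.linear s seq_scale g" "\<forall>b\<in>C. g b = u b"
    using p.linear_independent_extend[OF C(2)] by blast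
  have "inj_on g A"
  proof -
    have "x = 0" if x: "x \<in> A" "g x = 0" for x
    proof -
      obtain c where c: "x = (\<Sum>b\<in>C. s (c b) b)" using x(1) C(1,3) v.span_finite by auto
      have gx: "g x = (\<Sum>b\<in>C. seq_scale (c b) (u b))" unfolding c p.linear_sum[OF g(1)]
        using g(2) p.linear_scale[OF g(1)] by (intro sum.cong) auto
      have "c b = 0" if b: "b \<in> C" for b
      proof -
        have "g x (e b) = (\<Sum>b'\<in>C. seq_scale (c b') (u b') (e b))"
          unfolding gx using C(1) by (induction C rule: finite_induct) auto
        also have "\<dots> = (\<Sum>b'\<in>C. if b' = b then c b else 0)"
          using e b by (intro sum.cong) (auto simp: seq_scale_def u_def inj_on_def)
        also have "\<dots> = c b" using C(1) b by simp
        finally show ?thesis using x(2) by simp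
      qed
      then show ?thesis unfolding c by simp
    qed
    then show ?thesis
      using p.linear_inj_on_iff_eq_0[OF g(1)] C(3) by (metis v.subspace_span)
  qed
  moreover have "w.subspace (g ` A)" using p.linear_subspace_image[OF g(1)] C(3) v.subspace_span by metis
  moreover have "linear_between s seq_scale A (g ` A) g"
    unfolding linear_between_def using p.linear_add[OF g(1)] p.linear_scale[OF g(1)] by auto
  ultimately show thesis using that[of "g ` A" g] by (simp add: bij_betw_def)
qed

section \<open>Morphisms, isomorphism invariance and classes\<close>

abbreviation arrow_iso :: "('i, 'a) pre_digraph \<Rightarrow> ('i, 'a, 'v) qrep \<Rightarrow> 'a \<Rightarrow> bool" where
  "arrow_iso Q V a \<equiv> bij_betw (Map V a) (Space V (tail Q a)) (Space V (head Q a))"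

lemma rep_morphism_compose:
  assumes "wf_digraph Q" "rep_morphism s s' Q V W f" "rep_morphism s' s'' Q W X g"
  shows "rep_morphism s s'' Q V X (\<lambda>i x. g i (f i x))"
proof -
  interpret wf_digraph Q by fact
  have "linear_between s s'' (Space V i) (Space X i) (\<lambda>x. g i (f i x))" if "i \<in> verts Q" for i
    using assms(2,3) that unfolding rep_morphism_def by (blast intro: linear_between_compose)
  moreover have "g (head Q a) (f (head Q a) (Map V a x)) = Map X a (g (tail Q a) (f (tail Q a) x))"
    if "a \<in> arcs Q" "x \<in> Space V (tail Q a)" for a x
  proof -
    have "f (tail Q a) x \<in> Space W (tail Q a)"
      using assms(2) that tail_in_verts unfolding rep_morphism_def linear_between_def by blast
    then show ?thesis using assms(2,3) that unfolding rep_morphism_def by simp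
  qed
  ultimately show ?thesis unfolding rep_morphism_def by blast
qed

lemma rep_isomorphism_compose:
  assumes "wf_digraph Q" "rep_isomorphism s s' Q V W f" "rep_isomorphism s' s'' Q W X g"
  shows "rep_isomorphism s s'' Q V X (\<lambda>i x. g i (f i x))"
proof -
  have "bij_betw (\<lambda>x. g i (f i x)) (Space V i) (Space X i)" if "i \<in> verts Q" for i
    using bij_betw_trans[of "f i" "Space V i" "Space W i" "g i" "Space X i"] assms(2,3) that
    unfolding rep_isomorphism_def comp_def by simp
  moreover have "rep_morphism s s'' Q V X (\<lambda>i x. g i (f i x))"
    using assms(2,3) rep_morphism_compose[OF assms(1)] unfolding rep_isomorphism_def by blast
  ultimately show ?thesis unfolding rep_isomorphism_def by simp
qed

lemma rep_isomorphism_inverse: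
  assumes wf: "wf_digraph Q" and vs: "vector_space s" "vector_space s'"
    and V: "quiver_rep s Q V" and f: "rep_isomorphism s s' Q V W f"
  shows "rep_isomorphism s' s Q W V (\<lambda>i. inv_into (Space V i) (f i))"
proof -
  interpret wf_digraph Q by fact
  have bij: "bij_betw (f i) (Space V i) (Space W i)" if "i \<in> verts Q" for i
    using f that unfolding rep_isomorphism_def by blast
  let ?g = "\<lambda>i. inv_into (Space V i) (f i)"
  have lin: "linear_between s' s (Space W i) (Space V i) (?g i)" if "i \<in> verts Q" for i
    using linear_between_inv_into[OF vs _ _ bij[OF that]] that V f
    unfolding quiver_rep_def rep_isomorphism_def rep_morphism_def by blast
  have "?g (head Q a) (Map W a y) = Map V a (?g (tail Q a) y)"
    if a: "a \<in> arcs Q" and y: "y \<in> Space W (tail Q a)" for a y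
  proof -
    have x: "?g (tail Q a) y \<in> Space V (tail Q a)" "f (tail Q a) (?g (tail Q a) y) = y"
      using bij[of "tail Q a"] a y by (auto simp: bij_betw_def inv_into_into f_inv_into_f)
    have "Map W a y = f (head Q a) (Map V a (?g (tail Q a) y))"
      using f x a unfolding rep_isomorphism_def rep_morphism_def by metis
    moreover have "Map V a (?g (tail Q a) y) \<in> Space V (head Q a)"
      using V a x(1) unfolding quiver_rep_def linear_between_def by blast
    ultimately show ?thesis using bij[of "head Q a"] a by (simp add: bij_betw_def)
  qed
  then show ?thesis unfolding rep_isomorphism_def rep_morphism_def
    using lin bij bij_betw_inv_into by blast
qed

lemma rep_isomorphic_sym:
  assumes "wf_digraph Q" "vector_space s" "vector_space s'" "quiver_rep s Q V"
    "rep_isomorphic s s' Q V W"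
  shows "rep_isomorphic s' s Q W V"
  using assms rep_isomorphism_inverse unfolding rep_isomorphic_def by blast

lemma rep_isomorphic_trans:
  assumes "wf_digraph Q" "rep_isomorphic s s' Q V W" "rep_isomorphic s' s'' Q W X"
  shows "rep_isomorphic s s'' Q V X"
  using assms rep_isomorphism_compose unfolding rep_isomorphic_def by blast

lemma rep_isomorphic_refl: "rep_isomorphic s s Q V V"
  unfolding rep_isomorphic_def rep_isomorphism_def rep_morphism_def linear_between_def
  by (rule exI[of _ "\<lambda>i x. x"]) (auto simp: bij_betw_def inj_on_def)

lemma rep_isomorphism_bij_arrow:
  assumes wf: "wf_digraph Q" and f: "rep_isomorphism s s' Q V W f"
    and a: "a \<in> arcs Q" and bij: "arrow_iso Q V a"
  shows "arrow_iso Q W a"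
proof -
  interpret wf_digraph Q by fact
  let ?t = "tail Q a" and ?h = "head Q a"
  have ft: "bij_betw (f ?t) (Space V ?t) (Space W ?t)" "bij_betw (f ?h) (Space V ?h) (Space W ?h)"
    using f a unfolding rep_isomorphism_def by auto
  let ?g = "inv_into (Space V ?t) (f ?t)"
  have g: "bij_betw ?g (Space W ?t) (Space V ?t)" using ft(1) bij_betw_inv_into by blast
  have "bij_betw (f ?h \<circ> (Map V a \<circ> ?g)) (Space W ?t) (Space W ?h)"
    by (rule bij_betw_trans[OF bij_betw_trans[OF g bij] ft(2)])
  moreover have "(f ?h \<circ> (Map V a \<circ> ?g)) y = Map W a y" if y: "y \<in> Space W ?t" for y
  proof -
    have "?g y \<in> Space V ?t" "f ?t (?g y) = y"
      using ft(1) y by (auto simp: bij_betw_def inv_into_into f_inv_into_f)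
    then show ?thesis using f a unfolding rep_isomorphism_def rep_morphism_def by auto
  qed
  ultimately show ?thesis using bij_betw_cong[of "Space W ?t" "f ?h \<circ> (Map V a \<circ> ?g)" "Map W a"] by simp
qed

lemma flei_isomorphic:
  assumes wf: "wf_digraph Q" and vs: "vector_space s" "vector_space s'"
    and V: "flei s Q V" and W: "quiver_rep s' Q W" and iso: "rep_isomorphic s s' Q V W"
  shows "flei s' Q W"
proof -
  interpret wf_digraph Q by fact
  obtain f where f: "rep_isomorphism s s' Q V W f" using iso unfolding rep_isomorphic_def by blast
  have "fin_dim s' (Space W i)" if i: "i \<in> verts Q" for i
  proof (rule fin_dim_bij_image[OF vs])
    show "fin_dim s (Space V i)" using V i unfolding flei_def fin_dim_def by blast
    show "linear_between s s' (Space V i) (Space W i) (f i)"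
      using f i unfolding rep_isomorphism_def rep_morphism_def by blast
    show "bij_betw (f i) (Space V i) (Space W i)" using f i unfolding rep_isomorphism_def by blast
  qed
  moreover have "{a \<in> arcs Q. \<not> arrow_iso Q W a}
      \<subseteq> {a \<in> arcs Q. \<not> arrow_iso Q V a}"
    using rep_isomorphism_bij_arrow[OF wf f] by blast
  ultimately show ?thesis using V W finite_subset unfolding flei_def fin_dim_def by blast
qed

lemma zero_rep_isomorphic:
  assumes "rep_isomorphism s s' Q V W f" "zero_rep Q W" "vector_space s" "vector_space s'"
    "quiver_rep s Q V"
  shows "zero_rep Q V"
  unfolding zero_rep_def
proof
  fix i assume i: "i \<in> verts Q"
  interpret v: vector_space s by fact
  have sub: "v.subspace (Space V i)" using assms(5) i unfolding quiver_rep_def by blast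
  have lin: "linear_between s s' (Space V i) (Space W i) (f i)"
    and bij: "bij_betw (f i) (Space V i) (Space W i)"
    using assms(1) i unfolding rep_isomorphism_def rep_morphism_def by auto
  have "inj_on (f i) (Space V i)" "f i ` Space V i = {0}"
    using bij assms(2) i unfolding bij_betw_def zero_rep_def by auto
  then show "Space V i = {0}"
    using linear_between_inj_on_iff[OF assms(3,4) sub lin] v.subspace_0[OF sub] by blast
qed

text \<open>
  Along an isomorphism this transports the direct summands of one representation to the other.
\<close>

definition preimage_rep ::
  "('i, 'a, 'v) qrep \<Rightarrow> ('i \<Rightarrow> 'v \<Rightarrow> 'w) \<Rightarrow> ('i, 'a, 'w) qrep \<Rightarrow> ('i, 'a, 'v) qrep" where
  "preimage_rep V f X = \<lparr>Space = (\<lambda>i. {x \<in> Space V i. f i x \<in> Space X i}), Map = Map V\<rparr>"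

lemma subrep_preimage:
  assumes wf: "wf_digraph Q" and vs: "vector_space s" "vector_space s'"
    and V: "quiver_rep s Q V" and f: "rep_morphism s s' Q V W f" and X: "subrep s' Q W X"
  shows "subrep s Q V (preimage_rep V f X)"
proof -
  interpret wf_digraph Q by fact
  interpret v: vector_space s by fact
  interpret w: vector_space s' by fact
  have "v.subspace {x \<in> Space V i. f i x \<in> Space X i}" if i: "i \<in> verts Q" for i
  proof -
    have 1: "v.subspace (Space V i)" "w.subspace (Space X i)"
      using V X i unfolding quiver_rep_def subrep_def by auto
    have 2: "linear_between s s' (Space V i) (Space W i) (f i)"
      using f i unfolding rep_morphism_def by blast
    show ?thesis
      using 1 2 linear_between_zero[OF vs 1(1) 2]
      unfolding v.subspace_def w.subspace_def linear_between_def by simp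
  qed
  moreover have "linear_between s s {x \<in> Space V (tail Q a). f (tail Q a) x \<in> Space X (tail Q a)}
      {x \<in> Space V (head Q a). f (head Q a) x \<in> Space X (head Q a)} (Map V a)"
    if a: "a \<in> arcs Q" for a
  proof -
    have "linear_between s s (Space V (tail Q a)) (Space V (head Q a)) (Map V a)"
      using V a unfolding quiver_rep_def by blast
    moreover have "f (head Q a) (Map V a x) \<in> Space X (head Q a)"
      if "x \<in> Space V (tail Q a)" "f (tail Q a) x \<in> Space X (tail Q a)" for x
    proof -
      have "f (head Q a) (Map V a x) = Map X a (f (tail Q a) x)"
        using f X a that unfolding rep_morphism_def subrep_def by metis
      then show ?thesis using X a that unfolding subrep_def quiver_rep_def linear_between_def by metis
    qed
    ultimately show ?thesis unfolding linear_between_def by auto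
  qed
  ultimately show ?thesis unfolding subrep_def quiver_rep_def preimage_rep_def by auto
qed

lemma indecomposable_isomorphic:
  assumes wf: "wf_digraph Q" and vs: "vector_space s" "vector_space s'"
    and V: "indecomposable_rep s Q V" and W: "quiver_rep s' Q W" and iso: "rep_isomorphic s s' Q V W"
  shows "indecomposable_rep s' Q W"
proof -
  interpret wf_digraph Q by fact
  interpret v: vector_space s by fact
  interpret w: vector_space s' by fact
  obtain f where f: "rep_isomorphism s s' Q V W f" using iso unfolding rep_isomorphic_def by blast
  have fm: "rep_morphism s s' Q V W f" using f unfolding rep_isomorphism_def by blast
  have qV: "quiver_rep s Q V" using V unfolding indecomposable_rep_def by blast
  have bij: "bij_betw (f i) (Space V i) (Space W i)" if "i \<in> verts Q" for i
    using f that unfolding rep_isomorphism_def by blast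
  have lin: "linear_between s s' (Space V i) (Space W i) (f i)" if "i \<in> verts Q" for i
    using fm that unfolding rep_morphism_def by blast
  have sV: "v.subspace (Space V i)" if "i \<in> verts Q" for i
    using qV that unfolding quiver_rep_def by blast
  have "zero_rep Q X \<or> zero_rep Q Y" if d: "direct_sum_two s' Q W X Y" for X Y
  proof -
    let ?X = "preimage_rep V f X" and ?Y = "preimage_rep V f Y"
    have sX: "subrep s' Q W X" and sY: "subrep s' Q W Y" using d unfolding direct_sum_two_def by auto
    have "direct_sum_two s Q V ?X ?Y"
      unfolding direct_sum_two_def
    proof (intro conjI ballI)
      show "subrep s Q V ?X" "subrep s Q V ?Y" using subrep_preimage[OF wf vs qV fm] sX sY by auto
      fix i assume i: "i \<in> verts Q"
      note L = lin[OF i] and B = bij[OF i] and S = sV[OF i]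
      show "Space V i = {x + y |x y. x \<in> Space ?X i \<and> y \<in> Space ?Y i}"
      proof (intro subset_antisym subsetI)
        fix v assume v: "v \<in> Space V i"
        then have "f i v \<in> Space W i" using B bij_betwE by blast
        then obtain x y where xy: "f i v = x + y" "x \<in> Space X i" "y \<in> Space Y i"
          using d i unfolding direct_sum_two_def by blast
        then have "x \<in> Space W i" "y \<in> Space W i" using sX sY i unfolding subrep_def by auto
        then have "x \<in> f i ` Space V i" "y \<in> f i ` Space V i" using B by (auto simp: bij_betw_def)
        then obtain x' y' where x': "x' \<in> Space V i" "f i x' = x" and y': "y' \<in> Space V i" "f i y' = y"
          by blast
        have "f i (x' + y') = f i v" using x' y' xy L unfolding linear_between_def by auto
        then have "x' + y' = v" using B x'(1) y'(1) v v.subspace_add[OF S]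
          by (auto simp: bij_betw_def inj_on_def)
        then show "v \<in> {x + y |x y. x \<in> Space ?X i \<and> y \<in> Space ?Y i}"
          using x' y' xy unfolding preimage_rep_def by auto
      next
        fix v assume "v \<in> {x + y |x y. x \<in> Space ?X i \<and> y \<in> Space ?Y i}"
        then show "v \<in> Space V i" using v.subspace_add[OF S] unfolding preimage_rep_def by auto
      qed
      have z: "f i 0 = 0" using linear_between_zero[OF vs S L] .
      have "0 \<in> Space X i" "0 \<in> Space Y i"
        using sX sY i w.subspace_0 unfolding subrep_def quiver_rep_def by auto
      moreover have "x = 0" if "x \<in> Space V i" "f i x \<in> Space X i" "f i x \<in> Space Y i" for x
      proof -
        have "f i x = 0" using d i that unfolding direct_sum_two_def by blast
        then show ?thesis using linear_between_inj_on_iff[OF vs S L] B that(1) by (simp add: bij_betw_def)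
      qed
      ultimately show "Space ?X i \<inter> Space ?Y i = {0}"
        unfolding preimage_rep_def using z v.subspace_0[OF S] by auto
    qed
    then have "zero_rep Q ?X \<or> zero_rep Q ?Y" using V unfolding indecomposable_rep_def by blast
    moreover have "zero_rep Q Z" if Z: "subrep s' Q W Z" "zero_rep Q (preimage_rep V f Z)" for Z
      unfolding zero_rep_def
    proof
      fix i assume i: "i \<in> verts Q"
      have "z = 0" if z: "z \<in> Space Z i" for z
      proof -
        have "z \<in> Space W i" using z Z(1) i unfolding subrep_def by blast
        then have "z \<in> f i ` Space V i" using bij[OF i] by (simp add: bij_betw_def)
        then obtain x where x: "x \<in> Space V i" "f i x = z" by blast
        then have "x = 0" using Z(2) z i unfolding zero_rep_def preimage_rep_def by auto
        then show ?thesis using x linear_between_zero[OF vs sV[OF i] lin[OF i]] by simp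
      qed
      moreover have "0 \<in> Space Z i" using Z(1) i w.subspace_0 unfolding subrep_def quiver_rep_def by auto
      ultimately show "Space Z i = {0}" by blast
    qed
    ultimately show ?thesis using sX sY by blast
  qed
  moreover have "\<not> zero_rep Q W"
    using zero_rep_isomorphic[OF f _ vs qV] V unfolding indecomposable_rep_def by blast
  ultimately show ?thesis using W unfolding indecomposable_rep_def by blast
qed

subsection \<open>Isomorphism classes\<close>

text \<open>
  The spaces are copied vertex by vertex, without any compatibility between the choices; the arrow
  maps are then transported through the chosen isomorphisms.
\<close>

lemma flei_copy_in_sequences:
  fixes s :: "'k::field \<Rightarrow> 'v::ab_group_add \<Rightarrow> 'v" and X :: "('i, 'a, 'v) qrep"
  assumes wf: "wf_digraph Q" and vs: "vector_space s" and X: "flei s Q X"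
  obtains W :: "('i, 'a, nat \<Rightarrow> 'k) qrep" where "quiver_rep seq_scale Q W" "rep_isomorphic s seq_scale Q X W"
proof -
  interpret wf_digraph Q by fact
  have qX: "quiver_rep s Q X" using X unfolding flei_def by blast
  have "\<exists>B (f :: 'v \<Rightarrow> nat \<Rightarrow> 'k). module.subspace seq_scale B \<and>
      linear_between s seq_scale (Space X i) B f \<and> bij_betw f (Space X i) B" if "i \<in> verts Q" for i
  proof -
    have fd: "fin_dim s (Space X i)" using X that unfolding flei_def fin_dim_def by blast
    obtain B and f :: "'v \<Rightarrow> nat \<Rightarrow> 'k" where
      "module.subspace seq_scale B" "linear_between s seq_scale (Space X i) B f" "bij_betw f (Space X i) B"
      by (rule fin_dim_embeds_in_sequences[OF vs fd])
    then show ?thesis by blast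
  qed
  then obtain B and f :: "'i \<Rightarrow> 'v \<Rightarrow> nat \<Rightarrow> 'k" where
    B: "\<And>i. i \<in> verts Q \<Longrightarrow> module.subspace seq_scale (B i)" and
    lin: "\<And>i. i \<in> verts Q \<Longrightarrow> linear_between s seq_scale (Space X i) (B i) (f i)" and
    bij: "\<And>i. i \<in> verts Q \<Longrightarrow> bij_betw (f i) (Space X i) (B i)"
    by metis
  let ?g = "\<lambda>i. inv_into (Space X i) (f i)"
  define W where "W = \<lparr>Space = B, Map = (\<lambda>a y. f (head Q a) (Map X a (?g (tail Q a) y)))\<rparr>"
  have g: "linear_between seq_scale s (B i) (Space X i) (?g i)" if "i \<in> verts Q" for i
    using linear_between_inv_into[OF vs vector_space_seq_scale _ lin[OF that] bij[OF that]] qX that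
    unfolding quiver_rep_def by blast
  have mX: "linear_between s s (Space X (tail Q a)) (Space X (head Q a)) (Map X a)" if "a \<in> arcs Q" for a
    using qX that unfolding quiver_rep_def by blast
  have "linear_between seq_scale seq_scale (B (tail Q a)) (B (head Q a)) (Map W a)" if a: "a \<in> arcs Q" for a
    using linear_between_compose[OF linear_between_compose[OF g[OF tail_in_verts[OF a]] mX[OF a]] lin[OF head_in_verts[OF a]]]
    unfolding W_def by simp
  then have "quiver_rep seq_scale Q W" using B unfolding quiver_rep_def W_def by simp
  moreover have "rep_isomorphism s seq_scale Q X W f"
    unfolding rep_isomorphism_def rep_morphism_def
    using lin bij by (auto simp: W_def bij_betw_def)
  ultimately show thesis using that unfolding rep_isomorphic_def by blast
qed

lemma indec_flei_member:
  assumes "\<alpha> \<in> indec_flei Q" "W \<in> \<alpha>"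
  shows "flei seq_scale Q W" "indecomposable_rep seq_scale Q W" "quiver_rep seq_scale Q W"
  using assms unfolding indec_flei_def quotient_def indecomposable_rep_def by auto

text \<open>
  FLEI and indecomposability are invariant under isomorphism, so a class contains all
  representations isomorphic to one of its members.
\<close>

lemma indec_flei_member_iso_iff:
  assumes wf: "wf_digraph Q" and a: "\<alpha> \<in> indec_flei Q" "W \<in> \<alpha>"
  shows "W' \<in> \<alpha> \<longleftrightarrow> quiver_rep seq_scale Q W' \<and> rep_isomorphic seq_scale seq_scale Q W W'"
proof -
  note vs = vector_space_seq_scale
  obtain W0 where W0: "flei seq_scale Q W0" "indecomposable_rep seq_scale Q W0"
    and eq: "\<alpha> = {W'. flei seq_scale Q W' \<and> indecomposable_rep seq_scale Q W' \<and>
               rep_isomorphic seq_scale seq_scale Q W0 W'}"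
    using a(1) unfolding indec_flei_def quotient_def by auto
  have q: "quiver_rep seq_scale Q W0" using W0 unfolding flei_def by blast
  have i: "rep_isomorphic seq_scale seq_scale Q W0 W" using a(2) eq by blast
  show ?thesis
  proof
    assume "W' \<in> \<alpha>"
    then have "quiver_rep seq_scale Q W'" "rep_isomorphic seq_scale seq_scale Q W0 W'"
      using eq unfolding flei_def by auto
    then show "quiver_rep seq_scale Q W' \<and> rep_isomorphic seq_scale seq_scale Q W W'"
      using rep_isomorphic_trans[OF wf rep_isomorphic_sym[OF wf vs vs q i]] by blast
  next
    assume W': "quiver_rep seq_scale Q W' \<and> rep_isomorphic seq_scale seq_scale Q W W'"
    then have "rep_isomorphic seq_scale seq_scale Q W0 W'"
      using rep_isomorphic_trans[OF wf i] by blast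
    then show "W' \<in> \<alpha>" unfolding eq
      using W' flei_isomorphic[OF wf vs vs W0(1)] indecomposable_isomorphic[OF wf vs vs W0(2)] by blast
  qed
qed

lemma in_class_flei_indecomposable:
  assumes wf: "wf_digraph Q" and vs: "vector_space s" and a: "\<alpha> \<in> indec_flei Q"
    and X: "in_class s Q X \<alpha>"
  shows "flei s Q X" "indecomposable_rep s Q X"
proof -
  obtain W where W: "W \<in> \<alpha>" "rep_isomorphic s seq_scale Q X W" and q: "quiver_rep s Q X"
    using X unfolding in_class_def by blast
  have i: "rep_isomorphic seq_scale s Q W X"
    using rep_isomorphic_sym[OF wf vs vector_space_seq_scale q W(2)] .
  show "flei s Q X" "indecomposable_rep s Q X"
    using flei_isomorphic[OF wf vector_space_seq_scale vs _ q i]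
      indecomposable_isomorphic[OF wf vector_space_seq_scale vs _ q i]
      indec_flei_member[OF a W(1)] by auto
qed

lemma indecomposable_flei_has_class:
  fixes s :: "'k::field \<Rightarrow> 'v::ab_group_add \<Rightarrow> 'v" and X :: "('i, 'a, 'v) qrep"
  assumes wf: "wf_digraph Q" and vs: "vector_space s" and X: "flei s Q X" "indecomposable_rep s Q X"
  obtains \<alpha> :: "('i, 'a, 'k) rep_class" where "\<alpha> \<in> indec_flei Q" "in_class s Q X \<alpha>"
proof -
  obtain W :: "('i, 'a, nat \<Rightarrow> 'k) qrep" where W: "quiver_rep seq_scale Q W" "rep_isomorphic s seq_scale Q X W"
    by (rule flei_copy_in_sequences[OF wf vs X(1)])
  have fW: "flei seq_scale Q W" "indecomposable_rep seq_scale Q W"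
    using flei_isomorphic[OF wf vs vector_space_seq_scale X(1) W]
      indecomposable_isomorphic[OF wf vs vector_space_seq_scale X(2) W] by auto
  let ?r = "{(W, W'). flei seq_scale Q W \<and> indecomposable_rep seq_scale Q W \<and>
               flei seq_scale Q W' \<and> indecomposable_rep seq_scale Q W' \<and>
               rep_isomorphic seq_scale seq_scale Q W W'}"
  have "?r `` {W} \<in> indec_flei Q" unfolding indec_flei_def using fW by (intro quotientI) blast
  moreover have "W \<in> ?r `` {W}" using fW rep_isomorphic_refl by blast
  then have "in_class s Q X (?r `` {W})"
    unfolding in_class_def using W(2) X(1) unfolding flei_def by blast
  ultimately show thesis using that by blast
qed

lemma in_class_isomorphic:
  assumes wf: "wf_digraph Q" and vs: "vector_space s" "vector_space s'" and a: "\<alpha> \<in> indec_flei Q"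
    and XY: "in_class s Q X \<alpha>" "in_class s' Q Y \<alpha>"
  shows "rep_isomorphic s s' Q X Y"
proof -
  note vq = vector_space_seq_scale
  obtain W where W: "W \<in> \<alpha>" "rep_isomorphic s seq_scale Q X W" using XY(1) unfolding in_class_def by blast
  obtain W' where W': "W' \<in> \<alpha>" "rep_isomorphic s' seq_scale Q Y W'" and q: "quiver_rep s' Q Y"
    using XY(2) unfolding in_class_def by blast
  have 1: "rep_isomorphic seq_scale seq_scale Q W W'"
    using indec_flei_member_iso_iff[OF wf a W(1)] W'(1) by blast
  have 2: "rep_isomorphic seq_scale s' Q W' Y" using rep_isomorphic_sym[OF wf vs(2) vq q W'(2)] .
  show ?thesis using rep_isomorphic_trans[OF wf W(2) rep_isomorphic_trans[OF wf 1 2]] .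
qed

text \<open>
  A nonzero morphism between representations in two classes witnesses the order: if it is no
  isomorphism it is a chain of length two, and otherwise the classes agree.
\<close>

lemma indec_order_if_morphism:
  fixes s :: "'k::field \<Rightarrow> 'v::ab_group_add \<Rightarrow> 'v" and s' :: "'k \<Rightarrow> 'w::ab_group_add \<Rightarrow> 'w"
    and \<alpha> \<beta> :: "('i, 'a, 'k) rep_class"
  assumes wf: "wf_digraph Q" and vs: "vector_space s" "vector_space s'"
    and ab: "\<alpha> \<in> indec_flei Q" "\<beta> \<in> indec_flei Q"
    and X: "in_class s Q X \<alpha>" and Y: "in_class s' Q Y \<beta>"
    and f: "rep_morphism s s' Q X Y f" "\<not> zero_morphism Q X f"
  shows "(\<beta>, \<alpha>) \<in> indec_order Q"
proof -
  note vq = vector_space_seq_scale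
  interpret wf_digraph Q by fact
  obtain W where W: "W \<in> \<alpha>" "rep_isomorphic s seq_scale Q X W" and q: "quiver_rep s Q X"
    using X unfolding in_class_def by blast
  obtain W' where W': "W' \<in> \<beta>" "rep_isomorphic s' seq_scale Q Y W'" and q': "quiver_rep s' Q Y"
    using Y unfolding in_class_def by blast
  obtain u where u: "rep_isomorphism seq_scale s Q W X u"
    using rep_isomorphic_sym[OF wf vs(1) vq q W(2)] unfolding rep_isomorphic_def by blast
  obtain v where v: "rep_isomorphism s' seq_scale Q Y W' v"
    using W'(2) unfolding rep_isomorphic_def by blast
  define h where "h = (\<lambda>i x. v i (f i (u i x)))"
  have h: "rep_morphism seq_scale seq_scale Q W W' h"
    unfolding h_def
    using rep_morphism_compose[OF wf rep_morphism_compose[OF wf _ f(1)]] u v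
    unfolding rep_isomorphism_def by blast
  have nz: "\<not> zero_morphism Q W h"
  proof -
    obtain i x where ix: "i \<in> verts Q" "x \<in> Space X i" "f i x \<noteq> 0"
      using f(2) unfolding zero_morphism_def by blast
    obtain w where w: "w \<in> Space W i" "u i w = x"
      using u ix unfolding rep_isomorphism_def bij_betw_def by (metis imageE)
    have fx: "f i x \<in> Space Y i" using f(1) ix unfolding rep_morphism_def linear_between_def by blast
    have "linear_between s' seq_scale (Space Y i) (Space W' i) (v i)" "inj_on (v i) (Space Y i)"
      using v ix unfolding rep_isomorphism_def rep_morphism_def bij_betw_def by auto
    then have "v i (f i x) \<noteq> 0"
      using linear_between_inj_on_iff[OF vs(2) vq] q' ix fx unfolding quiver_rep_def by blast
    then show ?thesis using w ix unfolding h_def zero_morphism_def by blast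
  qed
  have "indec_ge Q \<alpha> \<beta>"
  proof (cases "rep_isomorphism seq_scale seq_scale Q W W' h")
    case True
    then have "W' \<in> \<alpha>"
      using indec_flei_member_iso_iff[OF wf ab(1) W(1)] indec_flei_member(3)[OF ab(2) W'(1)]
      unfolding rep_isomorphic_def by blast
    then have "\<alpha> = \<beta>"
      using indec_flei_member_iso_iff[OF wf ab(1)] indec_flei_member_iso_iff[OF wf ab(2) W'(1)] by blast
    then show ?thesis unfolding indec_ge_def
      using ab W(1) by (intro exI[of _ "[\<alpha>]"] exI[of _ "[W]"]) auto
  next
    case False
    have less2: "j < Suc (Suc 0) \<longleftrightarrow> j = 0 \<or> j = Suc 0" for j by auto
    show ?thesis unfolding indec_ge_def
      using ab W(1) W'(1) h nz False
      by (intro exI[of _ "[\<alpha>, \<beta>]"] exI[of _ "[W, W']"]) (auto simp: less2)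
  qed
  then show ?thesis using ab unfolding indec_order_def by blast
qed

section \<open>Subrepresentations, sums and direct summands\<close>

lemma subrep_trans: "subrep s Q V X \<Longrightarrow> subrep s Q X Y \<Longrightarrow> subrep s Q V Y"
  unfolding subrep_def by auto

lemma subrep_refl: "quiver_rep s Q V \<Longrightarrow> subrep s Q V V"
  unfolding subrep_def by auto

lemma rep_morphism_inclusion: "subrep s Q V X \<Longrightarrow> rep_morphism s s Q X V (\<lambda>i x. x)"
  unfolding subrep_def rep_morphism_def linear_between_def by auto

lemma rep_morphism_restrict:
  "subrep s Q V X \<Longrightarrow> rep_morphism s s' Q V W f \<Longrightarrow> wf_digraph Q \<Longrightarrow> rep_morphism s s' Q X W f"
  using rep_morphism_compose[OF _ rep_morphism_inclusion] by blast

lemma direct_sum_two_commute: "direct_sum_two s Q V X Y \<Longrightarrow> direct_sum_two s Q V Y X"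
  unfolding direct_sum_two_def by (auto simp: add.commute Int_commute) (metis add.commute)+

locale quiver_ambient = vector_space s + wf_digraph Q
  for s :: "'k::field \<Rightarrow> 'v::ab_group_add \<Rightarrow> 'v" and Q :: "('i, 'a) pre_digraph"
begin

lemma wfQ: "wf_digraph Q" by unfold_locales

lemma vs: "vector_space s" by unfold_locales

lemma quiver_rep_subspace: "quiver_rep s Q V \<Longrightarrow> i \<in> verts Q \<Longrightarrow> subspace (Space V i)"
  unfolding quiver_rep_def by blast

lemma quiver_rep_linear:
  "quiver_rep s Q V \<Longrightarrow> a \<in> arcs Q \<Longrightarrow>
    linear_between s s (Space V (tail Q a)) (Space V (head Q a)) (Map V a)"
  unfolding quiver_rep_def by blast

lemma subrepI:
  assumes V: "quiver_rep s Q V"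
    and "\<And>i. i \<in> verts Q \<Longrightarrow> subspace (Space X i) \<and> Space X i \<subseteq> Space V i"
    and "\<And>a x. a \<in> arcs Q \<Longrightarrow> x \<in> Space X (tail Q a) \<Longrightarrow> Map V a x \<in> Space X (head Q a)"
    and "Map X = Map V"
  shows "subrep s Q V X"
proof -
  have "linear_between s s (Space X (tail Q a)) (Space X (head Q a)) (Map X a)" if a: "a \<in> arcs Q" for a
  proof -
    have "Space X (tail Q a) \<subseteq> Space V (tail Q a)" using assms(2) a by simp
    then show ?thesis
      using quiver_rep_linear[OF V a] assms(3)[OF a] assms(4) unfolding linear_between_def
      by (simp add: subset_iff)
  qed
  then show ?thesis using assms(2,4) unfolding subrep_def quiver_rep_def by blast
qed

lemma subrepD:
  assumes "subrep s Q V X"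
  shows "quiver_rep s Q X" "Map X = Map V"
    "\<And>i. i \<in> verts Q \<Longrightarrow> subspace (Space X i)"
    "\<And>i. i \<in> verts Q \<Longrightarrow> Space X i \<subseteq> Space V i"
    "\<And>a x. a \<in> arcs Q \<Longrightarrow> x \<in> Space X (tail Q a) \<Longrightarrow> Map V a x \<in> Space X (head Q a)"
  using assms unfolding subrep_def quiver_rep_def linear_between_def by auto

lemma subrep_between:
  assumes "subrep s Q V X" "subrep s Q V Y" "\<And>i. i \<in> verts Q \<Longrightarrow> Space X i \<subseteq> Space Y i"
  shows "subrep s Q Y X"
  using assms unfolding subrep_def by auto

lemma rep_sum_Space [simp]: "Space (rep_sum s V S) i = span (\<Union>X\<in>S. Space X i)"
  and rep_sum_Map [simp]: "Map (rep_sum s V S) = Map V"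
  unfolding rep_sum_def by simp_all

lemma subrep_rep_sum:
  assumes V: "quiver_rep s Q V" and S: "\<And>X. X \<in> S \<Longrightarrow> subrep s Q V X"
  shows "subrep s Q V (rep_sum s V S)"
proof (rule subrepI[OF V])
  fix i assume i: "i \<in> verts Q"
  have "(\<Union>X\<in>S. Space X i) \<subseteq> Space V i" using subrepD(4)[OF S i] by blast
  then show "subspace (Space (rep_sum s V S) i) \<and> Space (rep_sum s V S) i \<subseteq> Space V i"
    using span_minimal quiver_rep_subspace[OF V i] by simp
next
  fix a x assume a: "a \<in> arcs Q" and x: "x \<in> Space (rep_sum s V S) (tail Q a)"
  have sub: "subspace (Space V (tail Q a))" using quiver_rep_subspace[OF V] a by simp
  have "x \<in> Space V (tail Q a) \<and> Map V a x \<in> span (\<Union>X\<in>S. Space X (head Q a))"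
    using x unfolding rep_sum_Space
  proof (induction rule: span_induct_alt)
    case base
    then show ?case
      using linear_between_zero[OF vs vs sub quiver_rep_linear[OF V a]] subspace_0[OF sub] span_zero by simp
  next
    case (step c x y)
    obtain X where X: "X \<in> S" "x \<in> Space X (tail Q a)" using step.hyps by blast
    have xV: "x \<in> Space V (tail Q a)" using subrepD(4)[OF S[OF X(1)] tail_in_verts[OF a]] X(2) by blast
    have "Map V a x \<in> Space X (head Q a)" using subrepD(5)[OF S[OF X(1)] a X(2)] .
    then have mx: "Map V a x \<in> span (\<Union>X\<in>S. Space X (head Q a))" by (intro span_base UN_I[OF X(1)])
    have cx: "s c x \<in> Space V (tail Q a)" using subspace_scale[OF sub xV] .
    have "Map V a (s c x + y) = s c (Map V a x) + Map V a y"
      using quiver_rep_linear[OF V a] cx xV step.IH unfolding linear_between_def by simp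
    then show ?case using mx step.IH cx subspace_add[OF sub] span_add span_scale by auto
  qed
  then show "Map V a x \<in> Space (rep_sum s V S) (head Q a)" by simp
qed simp

lemma subrep_rep_sum_member:
  assumes V: "quiver_rep s Q V" and S: "\<And>X. X \<in> S \<Longrightarrow> subrep s Q V X" and X: "X \<in> S"
  shows "subrep s Q (rep_sum s V S) X"
proof (rule subrep_between[OF S[OF X] subrep_rep_sum[OF V S]])
  show "Space X i \<subseteq> Space (rep_sum s V S) i" if "i \<in> verts Q" for i using X span_superset by fastforce
qed

lemma flei_fin_dim: "flei s Q V \<Longrightarrow> i \<in> verts Q \<Longrightarrow> fin_dim s (Space V i)"
  unfolding flei_def fin_dim_def by blast

lemma flei_quiver_rep: "flei s Q V \<Longrightarrow> quiver_rep s Q V"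
  unfolding flei_def by blast

lemma direct_sum_twoD:
  assumes "direct_sum_two s Q V X Y"
  shows "subrep s Q V X" "subrep s Q V Y"
    "\<And>i v. i \<in> verts Q \<Longrightarrow> v \<in> Space V i \<Longrightarrow> \<exists>x\<in>Space X i. \<exists>y\<in>Space Y i. v = x + y"
    "\<And>i x y. i \<in> verts Q \<Longrightarrow> x \<in> Space X i \<Longrightarrow> y \<in> Space Y i \<Longrightarrow> x + y \<in> Space V i"
    "\<And>i x. i \<in> verts Q \<Longrightarrow> x \<in> Space X i \<Longrightarrow> x \<in> Space Y i \<Longrightarrow> x = 0"
  using assms unfolding direct_sum_two_def by (simp_all, blast+)

lemma direct_sum_two_span:
  assumes "direct_sum_two s Q V X Y" "i \<in> verts Q"
  shows "Space V i = span (Space X i \<union> Space Y i)" "Space X i \<inter> Space Y i = {0}"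
proof -
  note d = direct_sum_twoD[OF assms(1)]
  have "span (Space X i) = Space X i" "span (Space Y i) = Space Y i"
    using subrepD(3)[OF d(1) assms(2)] subrepD(3)[OF d(2) assms(2)] by (simp_all only: span_eq_iff)
  then show "Space V i = span (Space X i \<union> Space Y i)" "Space X i \<inter> Space Y i = {0}"
    using assms unfolding direct_sum_two_def by (simp_all only: span_Un)
qed

text \<open>
  Arrow maps preserve both summands, so by uniqueness of the two components they commute with taking
  the first one.
\<close>

lemma direct_sum_two_projection:
  assumes V: "quiver_rep s Q V" and d: "direct_sum_two s Q V X Y"
  obtains p where "rep_morphism s s Q V X p"
    "\<And>i x. i \<in> verts Q \<Longrightarrow> x \<in> Space X i \<Longrightarrow> p i x = x"
    "\<And>i y. i \<in> verts Q \<Longrightarrow> y \<in> Space Y i \<Longrightarrow> p i y = 0"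
    "\<And>i v. i \<in> verts Q \<Longrightarrow> v \<in> Space V i \<Longrightarrow> v - p i v \<in> Space Y i"
proof -
  note D = direct_sum_twoD[OF d]
  define p where "p i v = (SOME x. x \<in> Space X i \<and> v - x \<in> Space Y i)" for i v
  have sX: "subspace (Space X i)" and sY: "subspace (Space Y i)" if "i \<in> verts Q" for i
    using subrepD(3)[OF D(1)] subrepD(3)[OF D(2)] that by auto
  have p: "p i v \<in> Space X i" "v - p i v \<in> Space Y i" if iv: "i \<in> verts Q" "v \<in> Space V i" for i v
  proof -
    obtain x y where xy: "x \<in> Space X i" "y \<in> Space Y i" "v = x + y" using D(3)[OF iv] by blast
    then have "x \<in> Space X i \<and> v - x \<in> Space Y i" by simp
    then have "p i v \<in> Space X i \<and> v - p i v \<in> Space Y i" unfolding p_def by (rule someI)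
    then show "p i v \<in> Space X i" "v - p i v \<in> Space Y i" by auto
  qed
  have uniq: "p i v = x" if "i \<in> verts Q" "v \<in> Space V i" "x \<in> Space X i" "v - x \<in> Space Y i" for i v x
  proof -
    have "p i v - x \<in> Space X i" using subspace_diff[OF sX[OF that(1)] p(1)[OF that(1,2)] that(3)] .
    moreover have "(v - x) - (v - p i v) \<in> Space Y i"
      using subspace_diff[OF sY[OF that(1)] that(4) p(2)[OF that(1,2)]] .
    then have "p i v - x \<in> Space Y i" by simp
    ultimately show ?thesis using D(5)[OF that(1)] by fastforce
  qed
  have inV: "x \<in> Space V i" if "i \<in> verts Q" "x \<in> Space X i" for i x
    using subrepD(4)[OF D(1) that(1)] that(2) by blast
  have inV': "x \<in> Space V i" if "i \<in> verts Q" "x \<in> Space Y i" for i x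
    using subrepD(4)[OF D(2) that(1)] that(2) by blast
  have "rep_morphism s s Q V X p"
    unfolding rep_morphism_def linear_between_def
  proof (intro conjI ballI allI)
    fix i x assume i: "i \<in> verts Q" and x: "x \<in> Space V i"
    show "p i x \<in> Space X i" using p(1)[OF i x] .
    fix c
    have "s c x - s c (p i x) \<in> Space Y i"
      using subspace_scale[OF sY[OF i] p(2)[OF i x]] by (simp add: scale_right_diff_distrib)
    then show "p i (s c x) = s c (p i x)"
      using uniq[OF i] subspace_scale[OF quiver_rep_subspace[OF V i] x] subspace_scale[OF sX[OF i] p(1)[OF i x]]
      by blast
  next
    fix i x y assume i: "i \<in> verts Q" and xy: "x \<in> Space V i" "y \<in> Space V i"
    have "(x + y) - (p i x + p i y) \<in> Space Y i"
      using subspace_add[OF sY[OF i] p(2)[OF i xy(1)] p(2)[OF i xy(2)]] by (simp add: algebra_simps)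
    then show "p i (x + y) = p i x + p i y"
      using uniq[OF i] subspace_add[OF quiver_rep_subspace[OF V i] xy]
        subspace_add[OF sX[OF i] p(1)[OF i xy(1)] p(1)[OF i xy(2)]] by blast
  next
    fix a x assume a: "a \<in> arcs Q" and x: "x \<in> Space V (tail Q a)"
    let ?t = "tail Q a" and ?h = "head Q a"
    have th: "?t \<in> verts Q" "?h \<in> verts Q" using a by auto
    note L = quiver_rep_linear[OF V a]
    have "Map V a (p ?t x) \<in> Space X ?h" using subrepD(5)[OF D(1) a p(1)[OF th(1) x]] .
    moreover have "Map V a (x - p ?t x) \<in> Space Y ?h" using subrepD(5)[OF D(2) a p(2)[OF th(1) x]] .
    moreover have "Map V a (x - p ?t x) = Map V a x - Map V a (p ?t x)"
      using linear_between_diff[OF vs vs quiver_rep_subspace[OF V th(1)] L x inV[OF th(1) p(1)[OF th(1) x]]] .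
    moreover have "Map V a x \<in> Space V ?h" using L x unfolding linear_between_def by blast
    ultimately have "p ?h (Map V a x) = Map V a (p ?t x)" using uniq[OF th(2)] by simp
    then show "p ?h (Map V a x) = Map X a (p ?t x)" using subrepD(2)[OF D(1)] by simp
  qed
  moreover have "p i x = x" if "i \<in> verts Q" "x \<in> Space X i" for i x
    using uniq[OF that(1) inV[OF that] that(2)] subspace_0[OF sY[OF that(1)]] by simp
  moreover have "p i y = 0" if "i \<in> verts Q" "y \<in> Space Y i" for i y
    using uniq[OF that(1) inV'[OF that] subspace_0[OF sX[OF that(1)]]] that(2) by simp
  ultimately show thesis using that p(2) by blast
qed

text \<open>
  A preimage in \<open>V\<close> of a vector of \<open>X\<close> may be replaced by its component in \<open>X\<close>.
\<close>

lemma direct_summand_bij: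
  assumes V: "quiver_rep s Q V" and d: "direct_sum_two s Q V X Y" and a: "a \<in> arcs Q"
    and bij: "arrow_iso Q V a"
  shows "arrow_iso Q X a"
proof -
  note D = direct_sum_twoD[OF d]
  have th: "tail Q a \<in> verts Q" "head Q a \<in> verts Q" using a by auto
  obtain p where p: "rep_morphism s s Q V X p"
    "\<And>i x. i \<in> verts Q \<Longrightarrow> x \<in> Space X i \<Longrightarrow> p i x = x" using direct_sum_two_projection[OF V d] by metis
  have "inj_on (Map V a) (Space X (tail Q a))"
    using bij subrepD(4)[OF D(1) th(1)] unfolding bij_betw_def by (blast intro: inj_on_subset)
  moreover have "Map V a ` Space X (tail Q a) = Space X (head Q a)"
  proof (intro subset_antisym subsetI)
    fix y assume y: "y \<in> Space X (head Q a)"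
    then have "y \<in> Map V a ` Space V (tail Q a)"
      using bij subrepD(4)[OF D(1) th(2)] unfolding bij_betw_def by blast
    then obtain v where v: "v \<in> Space V (tail Q a)" "y = Map V a v" by blast
    have "y = p (head Q a) y" using p(2) th(2) y by simp
    also have "\<dots> = Map X a (p (tail Q a) v)" using p(1) a v unfolding rep_morphism_def by blast
    finally have "y = Map V a (p (tail Q a) v)" using subrepD(2)[OF D(1)] by simp
    moreover have "p (tail Q a) v \<in> Space X (tail Q a)"
      using p(1) th(1) v(1) unfolding rep_morphism_def linear_between_def by blast
    ultimately show "y \<in> Map V a ` Space X (tail Q a)" by blast
  qed (use subrepD(5)[OF D(1) a] in blast)
  ultimately show ?thesis using subrepD(2)[OF D(1)] unfolding bij_betw_def by simp
qed

lemma flei_direct_summand: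
  assumes V: "flei s Q V" and d: "direct_sum_two s Q V X Y"
  shows "flei s Q X"
proof -
  note q = flei_quiver_rep[OF V] and D = direct_sum_twoD[OF d]
  have "fin_dim s (Space X i)" if "i \<in> verts Q" for i
    using fin_dim_subspace(1)[OF flei_fin_dim[OF V that] subrepD(3)[OF D(1) that] subrepD(4)[OF D(1) that]] .
  moreover have "{a \<in> arcs Q. \<not> arrow_iso Q X a}
      \<subseteq> {a \<in> arcs Q. \<not> arrow_iso Q V a}"
    using direct_summand_bij[OF q d] by blast
  ultimately show ?thesis using V subrepD(1)[OF D(1)] finite_subset unfolding flei_def fin_dim_def by blast
qed

end

section \<open>Cuts of a rooted tree\<close>

text \<open>
  Adjacency in the underlying undirected graph after deletion of the arrows in \<open>F\<close>.
\<close>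

definition linked :: "('i, 'a) pre_digraph \<Rightarrow> 'a set \<Rightarrow> ('i \<times> 'i) set" where
  "linked Q F = {(u, v). \<exists>a\<in>arcs Q - F. (u = tail Q a \<and> v = head Q a) \<or> (u = head Q a \<and> v = tail Q a)}"

lemma linked_rtrancl_sym: "(u, v) \<in> (linked Q F)\<^sup>* \<Longrightarrow> (v, u) \<in> (linked Q F)\<^sup>*"
proof -
  have "sym (linked Q F)" unfolding linked_def sym_def by auto
  then show "(u, v) \<in> (linked Q F)\<^sup>* \<Longrightarrow> (v, u) \<in> (linked Q F)\<^sup>*" by (meson sym_rtrancl symD)
qed

lemma linked_rtrancl_mono: "F \<subseteq> F' \<Longrightarrow> (u, v) \<in> (linked Q F')\<^sup>* \<Longrightarrow> (u, v) \<in> (linked Q F)\<^sup>*"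
  by (rule subsetD[OF rtrancl_mono]) (auto simp: linked_def)

lemma tree_quiver_linked:
  assumes "tree_quiver Q" "u \<in> verts Q" "v \<in> verts Q"
  shows "(u, v) \<in> (linked Q {})\<^sup>*"
proof -
  have "(u, v) \<in> rtrancl_on (verts Q) (parcs (mk_symmetric Q))"
    using assms unfolding tree_quiver_def connected_def strongly_connected_def reachable_def by simp
  then have "(u, v) \<in> (parcs (mk_symmetric Q))\<^sup>*"
    by (rule rtrancl_on_rtranclI)
  moreover have "parcs (mk_symmetric Q) \<subseteq> linked Q {}"
    unfolding parcs_mk_symmetric linked_def by auto
  ultimately show ?thesis using rtrancl_mono by blast
qed

text \<open>A repetition could be cut out of the walk.\<close>

lemma shortest_relpow_inj:
  assumes min: "\<And>m. m < n \<Longrightarrow> (f 0, f n) \<notin> R ^^ m" and step: "\<forall>i<n. (f i, f (Suc i)) \<in> R"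
  shows "inj_on f {..n}"
proof -
  have False if ij: "i < j" "j \<le> n" "f i = f j" for i j
  proof -
    have "(f 0, f i) \<in> R ^^ i"
      unfolding relpow_fun_conv using step ij by (intro exI[of _ f]) auto
    moreover have "(f j, f n) \<in> R ^^ (n - j)"
      unfolding relpow_fun_conv using step ij by (intro exI[of _ "\<lambda>k. f (j + k)"]) auto
    ultimately have "(f 0, f n) \<in> R ^^ (i + (n - j))"
      using ij(3) by (auto simp: relpow_add)
    moreover have "i + (n - j) < n" using ij by linarith
    ultimately show False using min by blast
  qed
  then show ?thesis by (intro inj_onI) (metis atMost_iff linorder_neqE_nat)
qed

text \<open>
  A shortest walk between the ends of \<open>e\<close> that avoids \<open>e\<close> would close up with \<open>e\<close> to a cycle.
\<close>

lemma tree_quiver_no_bypass: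
  assumes wf: "wf_digraph Q" and tree: "tree_quiver Q" and e: "e \<in> arcs Q"
  shows "(tail Q e, head Q e) \<notin> (linked Q {e})\<^sup>*"
proof
  interpret wf_digraph Q by fact
  assume "(tail Q e, head Q e) \<in> (linked Q {e})\<^sup>*"
  then obtain n0 where "(tail Q e, head Q e) \<in> linked Q {e} ^^ n0" using rtrancl_imp_relpow by blast
  then obtain n where n: "(tail Q e, head Q e) \<in> linked Q {e} ^^ n"
    and min: "\<And>m. m < n \<Longrightarrow> (tail Q e, head Q e) \<notin> linked Q {e} ^^ m"
    using exists_least_iff[of "\<lambda>n. (tail Q e, head Q e) \<in> linked Q {e} ^^ n"] by blast
  obtain f where f: "f 0 = tail Q e" "f n = head Q e" "\<forall>i<n. (f i, f (Suc i)) \<in> linked Q {e}"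
    using n unfolding relpow_fun_conv by blast
  have inj: "inj_on f {..n}" using shortest_relpow_inj[of n f "linked Q {e}"] min f by simp
  have "\<exists>a. i < n \<longrightarrow> a \<in> arcs Q \<and> a \<noteq> e \<and> {tail Q a, head Q a} = {f i, f (Suc i)}" for i
  proof (cases "i < n")
    case True
    then have "(f i, f (Suc i)) \<in> linked Q {e}" using f(3) by blast
    then obtain a where "a \<in> arcs Q" "a \<noteq> e"
      "(f i = tail Q a \<and> f (Suc i) = head Q a) \<or> (f i = head Q a \<and> f (Suc i) = tail Q a)"
      unfolding linked_def by auto
    then show ?thesis by (intro exI[of _ a]) auto
  qed simp
  then obtain b where b: "\<And>i. i < n \<Longrightarrow> b i \<in> arcs Q \<and> b i \<noteq> e \<and> {tail Q (b i), head Q (b i)} = {f i, f (Suc i)}"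
    by metis
  define vs where "vs = map f [0..<Suc n]"
  define es where "es = map b [0..<n] @ [e]"
  have fv: "f i \<in> verts Q" if "i \<le> n" for i
  proof (cases "i < n")
    case True
    then have "f i \<in> {tail Q (b i), head Q (b i)}" "b i \<in> arcs Q" using b by auto
    then show ?thesis by auto
  qed (use that f(2) e in auto)
  have "undirected_cycle Q vs es"
    unfolding undirected_cycle_def
  proof (intro conjI)
    show "es \<noteq> []" "length vs = length es" unfolding es_def vs_def by auto
    show "distinct vs" unfolding vs_def distinct_map using inj by (auto simp: inj_on_def simp del: upt_Suc)
    have "inj_on b {0..<n}"
    proof (rule inj_onI)
      fix i j assume ij: "i \<in> {0..<n}" "j \<in> {0..<n}" "b i = b j"
      then have "{f i, f (Suc i)} = {f j, f (Suc j)}" using b by (metis atLeastLessThan_iff)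
      then have "f i = f j \<or> f i = f (Suc j) \<and> f (Suc i) = f j" by (auto simp: doubleton_eq_iff)
      then have "i = j \<or> i = Suc j \<and> Suc i = j"
        using ij inj_onD[OF inj] by auto
      then show "i = j" by auto
    qed
    moreover have "e \<notin> b ` {0..<n}"
    proof
      assume "e \<in> b ` {0..<n}"
      then obtain i where "i < n" "e = b i" by auto
      then show False using b by blast
    qed
    ultimately show "distinct es" unfolding es_def by (simp add: distinct_map)
    show "set vs \<subseteq> verts Q" unfolding vs_def using fv by auto
    show "set es \<subseteq> arcs Q" unfolding es_def using b e by auto
    show "\<forall>j<length es. {tail Q (es ! j), head Q (es ! j)} = {vs ! j, vs ! (Suc j mod length es)}"
    proof (intro allI impI)
      fix j assume j: "j < length es"
      show "{tail Q (es ! j), head Q (es ! j)} = {vs ! j, vs ! (Suc j mod length es)}"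
      proof (cases "j < n")
        case True
        then have "es ! j = b j" "vs ! j = f j" "vs ! (Suc j mod length es) = f (Suc j)"
          unfolding es_def vs_def by (auto simp: nth_append simp del: upt_Suc)
        then show ?thesis using b[OF True] by simp
      next
        case False
        then have "j = n" using j unfolding es_def by simp
        then have "es ! j = e" "vs ! j = f n" "vs ! (Suc j mod length es) = f 0"
          unfolding es_def vs_def by (auto simp: nth_append simp del: upt_Suc)
        then show ?thesis using f(1,2) by auto
      qed
    qed
  qed
  then show False using tree unfolding tree_quiver_def by blast
qed

locale rooted_tree = wf_digraph Q
  for Q :: "('i, 'a) pre_digraph" +
  fixes r :: 'i
  assumes tree: "tree_quiver Q" and root: "r \<in> verts Q"
begin

text \<open>
  Deleting an arrow leaves two components; the outer one is the one without the root.
\<close>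

definition outer :: "'a \<Rightarrow> 'i set" where
  "outer e = {v \<in> verts Q. (r, v) \<notin> (linked Q {e})\<^sup>*}"

definition outer_end :: "'a \<Rightarrow> 'i" where
  "outer_end e = (if tail Q e \<in> outer e then tail Q e else head Q e)"

definition inner_end :: "'a \<Rightarrow> 'i" where
  "inner_end e = (if tail Q e \<in> outer e then head Q e else tail Q e)"

lemma root_not_outer: "r \<notin> outer e"
  unfolding outer_def by simp

lemma outer_subset_verts: "outer e \<subseteq> verts Q"
  unfolding outer_def by blast

text \<open>
  Both ends on the inner side would give a walk around \<open>e\<close>; conversely, a walk from the root reaches
  one of the ends before it can use \<open>e\<close>.
\<close>

lemma one_end_outer:
  assumes e: "e \<in> arcs Q"
  shows "tail Q e \<in> outer e \<longleftrightarrow> head Q e \<notin> outer e"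
proof -
  have "\<not> (tail Q e \<notin> outer e \<and> head Q e \<notin> outer e)"
  proof
    assume "tail Q e \<notin> outer e \<and> head Q e \<notin> outer e"
    then have "(r, tail Q e) \<in> (linked Q {e})\<^sup>*" "(r, head Q e) \<in> (linked Q {e})\<^sup>*"
      using e unfolding outer_def by auto
    then have "(tail Q e, head Q e) \<in> (linked Q {e})\<^sup>*"
      using linked_rtrancl_sym rtrancl_trans by metis
    then show False using tree_quiver_no_bypass[OF wf_digraph_axioms tree e] by blast
  qed
  moreover have "(r, v) \<in> (linked Q {})\<^sup>* \<Longrightarrow> (r, v) \<in> (linked Q {e})\<^sup>* \<or>
      (r, tail Q e) \<in> (linked Q {e})\<^sup>* \<or> (r, head Q e) \<in> (linked Q {e})\<^sup>*" for v
  proof (induction rule: rtrancl_induct)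
    case (step u w)
    then obtain a where a: "a \<in> arcs Q" "(u = tail Q a \<and> w = head Q a) \<or> (u = head Q a \<and> w = tail Q a)"
      unfolding linked_def by auto
    show ?case
    proof (cases "a = e")
      case True
      then show ?thesis using step.IH a by blast
    next
      case False
      then have "(u, w) \<in> linked Q {e}" using a unfolding linked_def by blast
      then show ?thesis using step.IH by (meson rtrancl.rtrancl_into_rtrancl)
    qed
  qed simp
  then have "\<not> (tail Q e \<in> outer e \<and> head Q e \<in> outer e)"
    using tree_quiver_linked[OF tree root] e unfolding outer_def by blast
  ultimately show ?thesis by blast
qed

lemma outer_end_outer: "e \<in> arcs Q \<Longrightarrow> outer_end e \<in> outer e"
  and inner_end_not_outer: "e \<in> arcs Q \<Longrightarrow> inner_end e \<notin> outer e"
  using one_end_outer unfolding outer_end_def inner_end_def by auto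

lemma outer_end_verts: "e \<in> arcs Q \<Longrightarrow> outer_end e \<in> verts Q"
  and inner_end_verts: "e \<in> arcs Q \<Longrightarrow> inner_end e \<in> verts Q"
  unfolding outer_end_def inner_end_def by auto

text \<open>
  Any other arrow survives the deletion of \<open>e\<close>, so its ends stay in the same component.
\<close>

lemma outer_arc_iff:
  assumes "a \<in> arcs Q" "a \<noteq> e"
  shows "tail Q a \<in> outer e \<longleftrightarrow> head Q a \<in> outer e"
proof -
  have "(tail Q a, head Q a) \<in> linked Q {e}" "(head Q a, tail Q a) \<in> linked Q {e}"
    using assms unfolding linked_def by blast+
  then have "(r, tail Q a) \<in> (linked Q {e})\<^sup>* \<longleftrightarrow> (r, head Q a) \<in> (linked Q {e})\<^sup>*"
    by (meson rtrancl.rtrancl_into_rtrancl)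
  then show ?thesis using assms unfolding outer_def by auto
qed

lemma outer_ends_iff:
  assumes "a \<in> arcs Q" "a \<noteq> e"
  shows "outer_end a \<in> outer e \<longleftrightarrow> inner_end a \<in> outer e"
  using outer_arc_iff[OF assms] unfolding outer_end_def inner_end_def by auto

text \<open>
  Both sides of a cut are connected: a walk that leaves a side \<open>C\<close> has to come back through the
  end point \<open>c\<close> of the cut arc on that side, so the excursion can be contracted to \<open>c\<close>.
\<close>

lemma side_linked:
  assumes C: "\<And>a. a \<in> arcs Q \<Longrightarrow> a \<noteq> e \<Longrightarrow> tail Q a \<in> C \<longleftrightarrow> head Q a \<in> C"
    and c: "\<And>v. v \<in> {tail Q e, head Q e} \<Longrightarrow> v \<in> C \<Longrightarrow> v = c"
    and u: "u \<in> C" and uw: "(u, w) \<in> (linked Q F)\<^sup>*"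
  shows "(u, if w \<in> C then w else c) \<in> (linked Q (F \<union> {a. a = e \<or> tail Q a \<notin> C}))\<^sup>*"
  using uw
proof (induction rule: rtrancl_induct)
  case base
  then show ?case using u by simp
next
  case (step v w)
  let ?L = "linked Q (F \<union> {a. a = e \<or> tail Q a \<notin> C})"
  obtain a where a: "a \<in> arcs Q" "a \<notin> F" "(v = tail Q a \<and> w = head Q a) \<or> (v = head Q a \<and> w = tail Q a)"
    using step.hyps unfolding linked_def by auto
  show ?case
  proof (cases "a = e")
    case True
    then have "v \<in> C \<Longrightarrow> v = c" "w \<in> C \<Longrightarrow> w = c" using a(3) c by auto
    then show ?thesis using step.IH by (auto split: if_splits)
  next
    case False
    then have same: "v \<in> C \<longleftrightarrow> w \<in> C" "v \<in> C \<longleftrightarrow> tail Q a \<in> C" using C[OF a(1)] a(3) by auto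
    show ?thesis
    proof (cases "v \<in> C")
      case True
      then have "(v, w) \<in> ?L" using a False same unfolding linked_def by blast
      then show ?thesis using step.IH same True by (auto intro: rtrancl_into_rtrancl)
    qed (use step.IH same in simp)
  qed
qed

lemma inner_side_linked:
  assumes e: "e \<in> arcs Q" and u: "u \<notin> outer e" and w: "w \<notin> outer e" and uw: "(u, w) \<in> (linked Q F)\<^sup>*"
  shows "(u, w) \<in> (linked Q (F \<union> {a. a = e \<or> tail Q a \<in> outer e}))\<^sup>*"
proof -
  have "v = inner_end e" if "v \<in> {tail Q e, head Q e}" "v \<in> - outer e" for v
    using that one_end_outer[OF e] unfolding inner_end_def by auto
  then show ?thesis
    using side_linked[of e "- outer e" "inner_end e" u w F] outer_arc_iff u w uw by simp
qed

lemma outer_side_linked: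
  assumes e: "e \<in> arcs Q" and u: "u \<in> outer e" and w: "w \<in> outer e"
  shows "(u, w) \<in> (linked Q {a. a = e \<or> tail Q a \<notin> outer e})\<^sup>*"
proof -
  have "v = outer_end e" if "v \<in> {tail Q e, head Q e}" "v \<in> outer e" for v
    using that one_end_outer[OF e] unfolding outer_end_def by auto
  moreover have "(u, w) \<in> (linked Q {})\<^sup>*"
    using tree_quiver_linked[OF tree] u w outer_subset_verts by blast
  ultimately show ?thesis
    using side_linked[of e "outer e" "outer_end e" u w "{}"] outer_arc_iff u w by simp
qed

lemma outer_linked_iff:
  assumes "(u, w) \<in> (linked Q F)\<^sup>*" "e \<in> F"
  shows "u \<in> outer e \<longleftrightarrow> w \<in> outer e"
  using assms(1)
proof (induction rule: rtrancl_induct)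
  case (step v w)
  then obtain a where "a \<in> arcs Q" "a \<notin> F" "(v = tail Q a \<and> w = head Q a) \<or> (v = head Q a \<and> w = tail Q a)"
    unfolding linked_def by auto
  then show ?case using outer_arc_iff[of a e] assms(2) step.IH by auto
qed simp

text \<open>
  If \<open>f\<close> lies in the outer part of \<open>e\<close>, then the inner side of \<open>e\<close> stays connected to the root without
  \<open>f\<close>; otherwise the outer part of \<open>e\<close> is connected without \<open>f\<close> and so lies on one side of \<open>f\<close>.
\<close>

lemma outer_laminar:
  assumes e: "e \<in> arcs Q" and f: "f \<in> arcs Q"
  shows "outer e \<subseteq> outer f \<or> outer f \<subseteq> outer e \<or> outer e \<inter> outer f = {}"
proof (cases "e = f")
  case False
  show ?thesis
  proof (cases "tail Q f \<in> outer e")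
    case True
    have "w \<in> outer e" if w: "w \<in> outer f" for w
    proof (rule ccontr)
      assume "w \<notin> outer e"
      moreover have "(r, w) \<in> (linked Q {})\<^sup>*"
        using tree_quiver_linked[OF tree root] w outer_subset_verts by blast
      ultimately have "(r, w) \<in> (linked Q ({} \<union> {a. a = e \<or> tail Q a \<in> outer e}))\<^sup>*"
        using inner_side_linked[OF e root_not_outer] by blast
      then have "r \<in> outer f" using outer_linked_iff[of r w _ f] True w by blast
      then show False using root_not_outer by blast
    qed
    then show ?thesis by blast
  next
    case False
    have "u \<in> outer f \<longleftrightarrow> w \<in> outer f" if "u \<in> outer e" "w \<in> outer e" for u w
      using outer_linked_iff[OF outer_side_linked[OF e that], of f] False by blast
    then show ?thesis by blast
  qed
qed simp

text \<open>
  A walk from the root to \<open>v\<close> has to use the arrow of every cut that separates them.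
\<close>

lemma finite_cuts_around:
  assumes "v \<in> verts Q"
  shows "finite {f \<in> arcs Q. v \<in> outer f}"
  using tree_quiver_linked[OF tree root assms]
proof (induction rule: rtrancl_induct)
  case base
  then show ?case using root_not_outer by simp
next
  case (step v w)
  then obtain a where a: "a \<in> arcs Q" "(v = tail Q a \<and> w = head Q a) \<or> (v = head Q a \<and> w = tail Q a)"
    unfolding linked_def by auto
  have "{f \<in> arcs Q. w \<in> outer f} \<subseteq> insert a {f \<in> arcs Q. v \<in> outer f}"
    using outer_arc_iff[OF a(1)] a(2) by auto
  then show ?case using step.IH finite_subset by blast
qed

text \<open>Every vertex but the root is the outer end of the last arc of a shortest walk from the root.\<close>

lemma vertex_is_outer_end:
  assumes v: "v \<in> verts Q" "v \<noteq> r"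
  obtains f where "f \<in> arcs Q" "v = outer_end f"
proof -
  obtain n0 where "(r, v) \<in> linked Q {} ^^ n0"
    using tree_quiver_linked[OF tree root v(1)] rtrancl_imp_relpow by blast
  then obtain n where n: "(r, v) \<in> linked Q {} ^^ n"
    and min: "\<And>m. m < n \<Longrightarrow> (r, v) \<notin> linked Q {} ^^ m"
    using exists_least_iff[of "\<lambda>n. (r, v) \<in> linked Q {} ^^ n"] by blast
  obtain f where f: "f 0 = r" "f n = v" "\<forall>i<n. (f i, f (Suc i)) \<in> linked Q {}"
    using n unfolding relpow_fun_conv by blast
  have inj: "inj_on f {..n}" using shortest_relpow_inj[of n f "linked Q {}"] min f by simp
  obtain k where k: "n = Suc k" using f v(2) by (cases n) auto
  obtain a where a: "a \<in> arcs Q" "(f k = tail Q a \<and> v = head Q a) \<or> (f k = head Q a \<and> v = tail Q a)"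
    using f(2,3) k unfolding linked_def by auto
  have "(f i, f (Suc i)) \<in> linked Q {a}" if i: "i < k" for i
  proof -
    have "(f i, f (Suc i)) \<in> linked Q {}" using f(3) i k by simp
    moreover have "f i \<noteq> v" "f (Suc i) \<noteq> v"
      using inj_onD[OF inj, of i n] inj_onD[OF inj, of "Suc i" n] f(2) i k by auto
    ultimately show ?thesis using a(2) unfolding linked_def by auto
  qed
  then have "(r, f k) \<in> linked Q {a} ^^ k"
    unfolding relpow_fun_conv using f(1) by (intro exI[of _ f]) auto
  then have "f k \<notin> outer a" unfolding outer_def using relpow_imp_rtrancl by auto
  then have "v = outer_end a" using a one_end_outer[OF a(1)] unfolding outer_end_def by auto
  then show thesis using that a(1) by blast
qed

text \<open>Induction along the path that enters a cut and leads to one of its vertices.\<close>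

lemma outer_path_induct:
  assumes e: "e \<in> arcs Q" and v: "v \<in> outer e" and base: "P (outer_end e)"
    and step: "\<And>h. \<lbrakk>h \<in> arcs Q; h \<noteq> e; v \<in> outer h; outer h \<subseteq> outer e; P (inner_end h)\<rbrakk> \<Longrightarrow> P (outer_end h)"
  shows "P v"
  using v step
proof (induction "card {h \<in> arcs Q. v \<in> outer h}" arbitrary: v rule: less_induct)
  case less
  show ?case
  proof (cases "v = outer_end e")
    case False
    have vQ: "v \<in> verts Q" using less.prems(1) outer_subset_verts by blast
    have "v \<noteq> r" using less.prems(1) root_not_outer by blast
    then obtain f where f: "f \<in> arcs Q" "v = outer_end f" using vertex_is_outer_end[OF vQ] by blast
    have fe: "f \<noteq> e" using f False by blast
    have vf: "v \<in> outer f" using f outer_end_outer by simp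
    have ie: "inner_end f \<in> outer e" using outer_ends_iff[OF f(1) fe] less.prems(1) f(2) by simp
    have "\<not> outer e \<subseteq> outer f" using ie inner_end_not_outer[OF f(1)] by blast
    then have sub: "outer f \<subseteq> outer e" using outer_laminar[OF e f(1)] vf less.prems(1) by blast
    have eq: "{h \<in> arcs Q. inner_end f \<in> outer h} = {h \<in> arcs Q. v \<in> outer h} - {f}"
    proof (rule set_eqI)
      show "h \<in> {h \<in> arcs Q. inner_end f \<in> outer h} \<longleftrightarrow> h \<in> {h \<in> arcs Q. v \<in> outer h} - {f}" for h
        using outer_ends_iff[OF f(1), of h] inner_end_not_outer[OF f(1)] f(2) by (cases "h = f") auto
    qed
    have "card {h \<in> arcs Q. inner_end f \<in> outer h} < card {h \<in> arcs Q. v \<in> outer h}"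
      unfolding eq using finite_cuts_around[OF vQ] f(1) vf by (intro card_Diff1_less) auto
    moreover have "P (outer_end h)"
      if "h \<in> arcs Q" "h \<noteq> e" "inner_end f \<in> outer h" "outer h \<subseteq> outer e" "P (inner_end h)" for h
      using less.prems(2)[of h] that eq by blast
    ultimately have "P (inner_end f)" using less.hyps ie by blast
    then show ?thesis using less.prems(2)[OF f(1) fe vf sub] f(2) by simp
  qed (use base in simp)
qed

end

section \<open>Test representations attached to cuts\<close>

definition coords :: "nat \<Rightarrow> (nat \<Rightarrow> 'k::field) set" where
  "coords n = {x. \<forall>m\<ge>n. x m = 0}"

definition unit_vec :: "nat \<Rightarrow> nat \<Rightarrow> 'k::field" where
  "unit_vec m = (\<lambda>n. if n = m then 1 else 0)"

lemma subspace_coords: "module.subspace seq_scale (coords n :: (nat \<Rightarrow> 'k::field) set)"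
proof -
  interpret vector_space "seq_scale :: 'k \<Rightarrow> _" by (rule vector_space_seq_scale)
  show ?thesis unfolding subspace_def coords_def by (auto simp: seq_scale_def)
qed

lemma unit_vec_coords: "m < n \<Longrightarrow> unit_vec m \<in> coords n"
  unfolding unit_vec_def coords_def by auto

lemma unit_vec_nonzero: "unit_vec m \<noteq> 0"
  unfolding unit_vec_def by (auto dest: fun_cong[of _ _ m])

lemma fin_dim_coords: "fin_dim seq_scale (coords n :: (nat \<Rightarrow> 'k::field) set)"
proof -
  interpret vector_space "seq_scale :: 'k \<Rightarrow> _" by (rule vector_space_seq_scale)
  have "coords n \<subseteq> span (unit_vec ` {..<n})"
  proof
    fix x :: "nat \<Rightarrow> 'k" assume x: "x \<in> coords n"
    have "x = (\<Sum>m<n. seq_scale (x m) (unit_vec m))"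
    proof
      fix j
      have "(\<Sum>m<n. seq_scale (x m) (unit_vec m)) j = (\<Sum>m<n. seq_scale (x m) (unit_vec m) j)"
        by (induction n) auto
      also have "\<dots> = (\<Sum>m<n. if m = j then x j else 0)"
        by (intro sum.cong) (auto simp: seq_scale_def unit_vec_def)
      also have "\<dots> = x j" using x unfolding coords_def by auto
      finally show "x j = (\<Sum>m<n. seq_scale (x m) (unit_vec m)) j" ..
    qed
    also have "\<dots> \<in> span (unit_vec ` {..<n})"
      by (intro span_sum span_scale span_base) auto
    finally show "x \<in> span (unit_vec ` {..<n})" .
  qed
  moreover have "span (unit_vec ` {..<n}) \<subseteq> coords n"
    by (rule span_minimal) (auto simp: unit_vec_coords subspace_coords)
  ultimately show ?thesis unfolding fin_dim_def by blast
qed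

lemma coords_one_summand:
  assumes "module.subspace seq_scale X" "module.subspace seq_scale Y"
    and "X \<subseteq> coords 1" "Y \<subseteq> (coords 1 :: (nat \<Rightarrow> 'k::field) set)" "X \<inter> Y = {0}"
  shows "X = {0} \<or> Y = {0}"
proof (rule ccontr)
  interpret vector_space "seq_scale :: 'k \<Rightarrow> _" by (rule vector_space_seq_scale)
  assume n: "\<not> (X = {0} \<or> Y = {0})"
  have "0 \<in> X" "0 \<in> Y" using assms(5) by blast+
  then obtain x y where x: "x \<in> X" "x \<noteq> 0" and y: "y \<in> Y" "y \<noteq> 0" using n by blast
  have z: "x m = 0" "y m = 0" if "m \<noteq> 0" for m
    using x y assms(3,4) that unfolding coords_def by auto
  have x0: "x 0 \<noteq> 0"
  proof
    assume "x 0 = 0"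
    then have "x m = 0" for m using z(1)[of m] by (cases "m = 0") auto
    then have "x = 0" by (simp add: fun_eq_iff)
    then show False using x(2) by blast
  qed
  define c where "c = y 0 / x 0"
  have "y m = c * x m" for m using z[of m] x0 by (cases "m = 0") (auto simp: c_def)
  then have "y = seq_scale c x" by (simp add: fun_eq_iff seq_scale_def)
  then have "y \<in> X" using subspace_scale[OF assms(1) x(1)] by simp
  then show False using y assms(5) by blast
qed

lemma zero_space_linked:
  assumes vs: "vector_space s" and X: "quiver_rep s Q X"
    and bij: "\<And>a. a \<in> arcs Q \<Longrightarrow> a \<notin> F \<Longrightarrow> arrow_iso Q X a"
    and wf: "wf_digraph Q"
    and uw: "(u, w) \<in> (linked Q F)\<^sup>*" and z: "Space X u = {0}"
  shows "Space X w = {0}"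
  using uw
proof (induction rule: rtrancl_induct)
  case (step v w)
  interpret wf_digraph Q by fact
  obtain a where a: "a \<in> arcs Q" "a \<notin> F" "(v = tail Q a \<and> w = head Q a) \<or> (v = head Q a \<and> w = tail Q a)"
    using step.hyps unfolding linked_def by auto
  have sub: "module.subspace s (Space X (tail Q a))" "module.subspace s (Space X (head Q a))"
    and lin: "linear_between s s (Space X (tail Q a)) (Space X (head Q a)) (Map X a)"
    using X a(1) unfolding quiver_rep_def by auto
  have z: "Map X a 0 = 0" using linear_between_zero[OF vs vs sub(1) lin] .
  have inj: "inj_on (Map X a) (Space X (tail Q a))"
    and im: "Map X a ` Space X (tail Q a) = Space X (head Q a)"
    using bij[OF a(1,2)] unfolding bij_betw_def by auto
  interpret vector_space s by fact
  show ?case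
    using a(3)
  proof
    assume "v = tail Q a \<and> w = head Q a"
    then show ?thesis using im z step.IH by auto
  next
    assume vw: "v = head Q a \<and> w = tail Q a"
    have "\<forall>x\<in>Space X (tail Q a). Map X a x = 0" using im vw step.IH by auto
    then have "\<forall>x\<in>Space X (tail Q a). x = 0"
      using linear_between_inj_on_iff[OF vs vs sub(1) lin] inj by blast
    then show ?thesis using subspace_0[OF sub(1)] vw by auto
  qed
qed (use z in simp)

context rooted_tree begin

subsection \<open>Thin representations\<close>

text \<open>
  The identity serves as arrow map everywhere because only cuts whose arrow points to the root are
  considered: that arrow then starts in the zero space.
\<close>

definition inner_thin :: "'a \<Rightarrow> ('i, 'a, nat \<Rightarrow> 'k::field) qrep" where
  "inner_thin f = \<lparr>Space = (\<lambda>i. if i \<in> outer f then {0} else coords 1), Map = (\<lambda>a x. x)\<rparr>"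

text \<open>
  The inner side is connected by identity maps between lines, so it belongs entirely to one of the
  two summands of a decomposition.
\<close>

lemma inner_thin_rep:
  assumes f: "f \<in> arcs Q" and inward: "tail Q f \<in> outer f"
  shows "quiver_rep seq_scale Q (inner_thin f :: ('i, 'a, nat \<Rightarrow> 'k::field) qrep)" (is ?q)
    and "flei seq_scale Q (inner_thin f :: ('i, 'a, nat \<Rightarrow> 'k) qrep)" (is ?f)
    and "indecomposable_rep seq_scale Q (inner_thin f :: ('i, 'a, nat \<Rightarrow> 'k) qrep)" (is ?i)
proof -
  interpret sq: quiver_ambient "seq_scale :: 'k \<Rightarrow> _" Q
    by (intro quiver_ambient.intro vector_space_seq_scale wf_digraph_axioms)
  let ?T = "inner_thin f :: ('i, 'a, nat \<Rightarrow> 'k) qrep"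
  have same: "Space ?T (tail Q a) = Space ?T (head Q a)" if "a \<in> arcs Q" "a \<noteq> f" for a
    using outer_arc_iff[OF that] unfolding inner_thin_def by simp
  have sub: "sq.subspace (Space ?T i)" for i
    unfolding inner_thin_def by (simp add: subspace_coords)
  have "Space ?T (tail Q a) \<subseteq> Space ?T (head Q a)" if "a \<in> arcs Q" for a
    using same[OF that] inward sq.subspace_0[OF subspace_coords] unfolding inner_thin_def by (cases "a = f") auto
  moreover have id: "Map ?T a x = x" for a x unfolding inner_thin_def by simp
  ultimately show q: ?q
    unfolding quiver_rep_def linear_between_def id using sub by blast
  have fd: "fin_dim seq_scale (Space ?T i)" for i
    unfolding inner_thin_def using fin_dim_coords sq.fin_dim_zero by auto
  have bij: "arrow_iso Q ?T a" if "a \<in> arcs Q" "a \<noteq> f" for a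
    using same[OF that] by (simp add: inner_thin_def bij_betw_def inj_on_def)
  then have "{a \<in> arcs Q. \<not> arrow_iso Q ?T a} \<subseteq> {f}"
    by blast
  then show ?f using q fd finite_subset unfolding flei_def fin_dim_def by blast
  have r: "Space ?T r = coords 1" unfolding inner_thin_def using root_not_outer by simp
  have zero: "zero_rep Q X" if d: "direct_sum_two seq_scale Q ?T X Y" and z: "Space X r = {0}" for X Y
    unfolding zero_rep_def
  proof
    fix v assume v: "v \<in> verts Q"
    note D = sq.direct_sum_twoD[OF d]
    show "Space X v = {0}"
    proof (cases "v \<in> outer f")
      case True
      then show ?thesis
        using sq.subrepD(4)[OF D(1) v] sq.subspace_0[OF sq.subrepD(3)[OF D(1) v]] unfolding inner_thin_def by auto
    next
      case False
      have "(r, v) \<in> (linked Q ({} \<union> {a. a = f \<or> tail Q a \<in> outer f}))\<^sup>*"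
        using inner_side_linked[OF f root_not_outer False tree_quiver_linked[OF tree root v]] .
      then have rv: "(r, v) \<in> (linked Q {f})\<^sup>*" by (rule linked_rtrancl_mono[rotated]) auto
      show ?thesis
        by (rule zero_space_linked[OF sq.vs sq.subrepD(1)[OF D(1)] _ sq.wfQ rv z])
          (use sq.direct_summand_bij[OF q d] bij in blast)
    qed
  qed
  have "zero_rep Q X \<or> zero_rep Q Y" if d: "direct_sum_two seq_scale Q ?T X Y" for X Y
  proof -
    note D = sq.direct_sum_twoD[OF d]
    have "Space X r = {0} \<or> Space Y r = {0}"
      using coords_one_summand[OF sq.subrepD(3)[OF D(1) root] sq.subrepD(3)[OF D(2) root]]
        sq.subrepD(4)[OF D(1) root] sq.subrepD(4)[OF D(2) root] r sq.direct_sum_two_span(2)[OF d root] by simp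
    then show ?thesis using zero[OF d] zero[OF direct_sum_two_commute[OF d]] by blast
  qed
  moreover have "\<not> zero_rep Q ?T"
    using r root unit_vec_coords[of 0 1] unit_vec_nonzero unfolding zero_rep_def by force
  ultimately show ?i using q unfolding indecomposable_rep_def by blast
qed

text \<open>
  Nested cuts whose arcs point towards the root give a strictly descending sequence of classes:
  the thin representation of a cut embeds into that of a cut with smaller outer part.
\<close>

lemma no_infinite_inward_chain:
  assumes wfo: "wf ((indec_order Q :: (('i, 'a, 'k::field) rep_class \<times> _) set) - Id)"
    and I: "I \<subseteq> arcs Q" "I \<noteq> {}" and inward: "\<And>f. f \<in> I \<Longrightarrow> tail Q f \<in> outer f"
    and deeper: "\<And>f. f \<in> I \<Longrightarrow> \<exists>f'\<in>I. outer f' \<subset> outer f"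
  shows False
proof -
  interpret sq: quiver_ambient "seq_scale :: 'k \<Rightarrow> _" Q
    by (intro quiver_ambient.intro vector_space_seq_scale wf_digraph_axioms)
  define \<C> where "\<C> = {\<alpha> \<in> indec_flei Q. \<exists>f\<in>I. in_class seq_scale Q (inner_thin f :: ('i, 'a, nat \<Rightarrow> 'k) qrep) \<alpha>}"
  have class_ex: "\<exists>\<alpha>\<in>\<C>. in_class seq_scale Q (inner_thin f :: ('i, 'a, nat \<Rightarrow> 'k) qrep) \<alpha>" if f: "f \<in> I" for f
  proof -
    have fQ: "f \<in> arcs Q" using f I(1) by blast
    note t = inner_thin_rep(2,3)[OF fQ inward[OF f], where ?'k = 'k]
    obtain \<alpha> :: "('i, 'a, 'k) rep_class" where "\<alpha> \<in> indec_flei Q" "in_class seq_scale Q (inner_thin f) \<alpha>"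
      by (rule indecomposable_flei_has_class[OF sq.wfQ sq.vs t])
    then show ?thesis unfolding \<C>_def using f by blast
  qed
  then obtain \<alpha>0 where "\<alpha>0 \<in> \<C>" using I(2) by blast
  then obtain \<alpha> where a: "\<alpha> \<in> \<C>" and min: "\<And>\<beta>. (\<beta>, \<alpha>) \<in> indec_order Q - Id \<Longrightarrow> \<beta> \<notin> \<C>"
    using wfE_min[OF wfo] by metis
  obtain f where f: "f \<in> I" "in_class seq_scale Q (inner_thin f :: ('i, 'a, nat \<Rightarrow> 'k) qrep) \<alpha>"
    using a unfolding \<C>_def by blast
  obtain f' where f': "f' \<in> I" "outer f' \<subset> outer f" using deeper[OF f(1)] by blast
  obtain \<beta> where b: "\<beta> \<in> \<C>" "in_class seq_scale Q (inner_thin f' :: ('i, 'a, nat \<Rightarrow> 'k) qrep) \<beta>"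
    using class_ex[OF f'(1)] by blast
  have ab: "\<alpha> \<in> indec_flei Q" "\<beta> \<in> indec_flei Q" using a b unfolding \<C>_def by auto
  let ?T = "inner_thin f :: ('i, 'a, nat \<Rightarrow> 'k) qrep" and ?T' = "inner_thin f' :: ('i, 'a, nat \<Rightarrow> 'k) qrep"
  have z: "0 \<in> (coords 1 :: (nat \<Rightarrow> 'k) set)" using sq.subspace_0[OF subspace_coords] .
  have "rep_morphism seq_scale seq_scale Q ?T ?T' (\<lambda>i x. x)"
    unfolding rep_morphism_def linear_between_def using f'(2) z by (auto simp: inner_thin_def)
  moreover have "\<not> zero_morphism Q ?T (\<lambda>i x. x)"
    unfolding zero_morphism_def inner_thin_def
    using root root_not_outer unit_vec_coords[of 0 1] unit_vec_nonzero by force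
  ultimately have "(\<beta>, \<alpha>) \<in> indec_order Q"
    using indec_order_if_morphism[OF sq.wfQ sq.vs sq.vs ab f(2) b(2)] by blast
  moreover have "\<beta> \<noteq> \<alpha>"
  proof
    assume "\<beta> = \<alpha>"
    then obtain g where g: "rep_isomorphism seq_scale seq_scale Q ?T ?T' g"
      using in_class_isomorphic[OF sq.wfQ sq.vs sq.vs ab(1) f(2)] b(2) unfolding rep_isomorphic_def by blast
    obtain v where v: "v \<in> outer f" "v \<notin> outer f'" using f'(2) by blast
    then have "v \<in> verts Q" using outer_subset_verts by blast
    then have "bij_betw (g v) {0} (coords 1 :: (nat \<Rightarrow> 'k) set)"
      using g v unfolding rep_isomorphism_def inner_thin_def by auto
    then have "coords 1 = {g v 0}" unfolding bij_betw_def by auto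
    moreover have "unit_vec 0 \<in> (coords 1 :: (nat \<Rightarrow> 'k) set)" "unit_vec 0 \<noteq> (0 :: nat \<Rightarrow> 'k)"
      by (simp_all add: unit_vec_coords unit_vec_nonzero)
    ultimately show False using z by auto
  qed
  ultimately show False using min b(1) by blast
qed

end

subsection \<open>Representations of a four-armed star\<close>

definition det2 :: "(nat \<Rightarrow> 'k::field) \<Rightarrow> (nat \<Rightarrow> 'k) \<Rightarrow> 'k" where
  "det2 u w = u 0 * w 1 - u 1 * w 0"

lemma det2_zero_multiple:
  assumes "det2 u w = 0" "u \<noteq> 0" "u \<in> coords 2" "w \<in> coords 2"
  obtains c where "w = seq_scale c u"
proof -
  have z: "u m = 0" "w m = 0" if "m \<noteq> 0" "m \<noteq> 1" for m
    using assms(3,4) that unfolding coords_def by auto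
  have "\<exists>c. w 0 = c * u 0 \<and> w 1 = c * u 1"
  proof (cases "u 0 = 0")
    case True
    have "u 1 \<noteq> 0"
    proof
      assume "u 1 = 0"
      then have "u m = 0" for m using z(1)[of m] True by (cases "m = 0"; cases "m = 1") auto
      then show False using assms(2) by (auto simp: fun_eq_iff)
    qed
    then show ?thesis using assms(1) True by (intro exI[of _ "w 1 / u 1"]) (auto simp: det2_def)
  next
    case False
    then show ?thesis using assms(1) by (intro exI[of _ "w 0 / u 0"]) (auto simp: det2_def field_simps)
  qed
  then obtain c where c: "w 0 = c * u 0" "w 1 = c * u 1" by blast
  have "w m = c * u m" for m using z[of m] c by (cases "m = 0"; cases "m = 1") auto
  then show thesis using that[of c] by (simp add: fun_eq_iff seq_scale_def)
qed

lemma coords_two_subset: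
  assumes "module.subspace seq_scale X" "unit_vec 0 \<in> X" "unit_vec 1 \<in> X"
  shows "(coords 2 :: (nat \<Rightarrow> 'k::field) set) \<subseteq> X"
proof
  interpret vector_space "seq_scale :: 'k \<Rightarrow> _" by (rule vector_space_seq_scale)
  fix x :: "nat \<Rightarrow> 'k" assume x: "x \<in> coords 2"
  have z: "x m = 0" if "m \<noteq> 0" "m \<noteq> 1" for m using x that unfolding coords_def by auto
  have "x m = (seq_scale (x 0) (unit_vec 0) + seq_scale (x 1) (unit_vec 1)) m" for m
    using z[of m] by (cases "m = 0"; cases "m = 1") (simp_all add: seq_scale_def unit_vec_def)
  then have "x = seq_scale (x 0) (unit_vec 0) + seq_scale (x 1) (unit_vec 1)" by (rule ext)
  also have "\<dots> \<in> X" using assms by (intro subspace_add subspace_scale)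
  finally show "x \<in> X" .
qed

lemma unit_vec_simps [simp]:
  "unit_vec n n = 1" "unit_vec (Suc 0) 0 = 0" "unit_vec 0 (Suc 0) = 0"
  unfolding unit_vec_def by auto

context rooted_tree begin

text \<open>
  A plane at the centre and a line on each arm.  An arrow into the centre embeds the line of its arm
  with image spanned by \<open>v a\<close>; an arrow out of the centre is the functional \<open>det2 (v a)\<close>, whose kernel is
  the same line.  In this way the orientation of the arms becomes irrelevant.
\<close>

definition star_rep :: "'a set \<Rightarrow> ('a \<Rightarrow> nat \<Rightarrow> 'k::field) \<Rightarrow> ('i, 'a, nat \<Rightarrow> 'k) qrep" where
  "star_rep E v = \<lparr>Space = (\<lambda>i. if i \<in> \<Union> (outer ` E) then coords 1 else coords 2),
     Map = (\<lambda>a x. if a \<in> E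
        then (if tail Q a \<in> outer a then seq_scale (x 0) (v a) else seq_scale (det2 (v a) x) (unit_vec 0))
        else x)\<rparr>"

end

text \<open>
  The type argument only pins down the field over which the representations of the star are formed.
\<close>

locale star_cuts = rooted_tree Q r for Q :: "('i, 'a) pre_digraph" and r +
  fixes E :: "'a set" and field_type :: "'k::field itself"
  assumes finE: "finite E" and E: "E \<subseteq> arcs Q"
    and disj: "\<And>e e'. e \<in> E \<Longrightarrow> e' \<in> E \<Longrightarrow> e \<noteq> e' \<Longrightarrow> outer e \<inter> outer e' = {}"
begin

sublocale sq: quiver_ambient "seq_scale :: 'k \<Rightarrow> (nat \<Rightarrow> 'k) \<Rightarrow> nat \<Rightarrow> 'k" Q
  by (intro quiver_ambient.intro vector_space_seq_scale wf_digraph_axioms)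

abbreviation "arms \<equiv> \<Union> (outer ` E)"

lemma arms_arc_iff:
  assumes "a \<in> arcs Q" "a \<notin> E"
  shows "tail Q a \<in> arms \<longleftrightarrow> head Q a \<in> arms"
proof -
  have "tail Q a \<in> outer e \<longleftrightarrow> head Q a \<in> outer e" if "e \<in> E" for e
    using outer_arc_iff[OF assms(1), of e] assms(2) that by blast
  then show ?thesis by simp
qed

lemma outer_end_arms: "e \<in> E \<Longrightarrow> outer_end e \<in> arms"
  using outer_end_outer E by blast

lemma inner_end_arms:
  assumes e: "e \<in> E"
  shows "inner_end e \<notin> arms"
proof
  assume "inner_end e \<in> arms"
  then obtain e' where e': "e' \<in> E" "inner_end e \<in> outer e'" by blast
  have eQ: "e \<in> arcs Q" using e E by blast
  have ne: "e \<noteq> e'" using e' inner_end_not_outer[OF eQ] by blast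
  then have "outer_end e \<in> outer e'" using outer_ends_iff[OF eQ ne] e'(2) by simp
  then show False using disj[OF e e'(1) ne] outer_end_outer[OF eQ] by blast
qed

text \<open>
  The arms are cut off one after the other; each time the part containing the root stays connected.
\<close>

lemma root_linked_center:
  assumes v: "v \<in> verts Q" "v \<notin> arms"
  shows "(r, v) \<in> (linked Q E)\<^sup>*"
proof -
  have "finite F \<Longrightarrow> F \<subseteq> E \<Longrightarrow> (r, v) \<in> (linked Q F)\<^sup>*" for F
  proof (induction F rule: finite_induct)
    case empty
    then show ?case using tree_quiver_linked[OF tree root v(1)] by simp
  next
    case (insert e F)
    have "e \<in> arcs Q" "v \<notin> outer e" using insert.prems E v(2) by auto
    then have "(r, v) \<in> (linked Q (F \<union> {a. a = e \<or> tail Q a \<in> outer e}))\<^sup>*"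
      using inner_side_linked[OF _ root_not_outer] insert.IH insert.prems by blast
    then show ?case by (rule linked_rtrancl_mono[rotated]) auto
  qed
  then show ?thesis using finE by blast
qed

lemma arm_linked:
  assumes e: "e \<in> E" and v: "v \<in> outer e"
  shows "(outer_end e, v) \<in> (linked Q E)\<^sup>*"
proof -
  have eQ: "e \<in> arcs Q" using e E by blast
  have "a = e \<or> tail Q a \<notin> outer e" if a: "a \<in> E" for a
  proof (cases "a = e")
    case False
    have aQ: "a \<in> arcs Q" using a E by blast
    have "outer_end a \<notin> outer e" using disj[OF a e False] outer_end_outer[OF aQ] by blast
    then show ?thesis using outer_ends_iff[OF aQ False] unfolding outer_end_def inner_end_def
      by (auto split: if_splits)
  qed simp
  then have "E \<subseteq> {a. a = e \<or> tail Q a \<notin> outer e}" by blast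
  then show ?thesis using outer_side_linked[OF eQ outer_end_outer[OF eQ] v] by (rule linked_rtrancl_mono)
qed

lemma star_Space:
  fixes v :: "'a \<Rightarrow> nat \<Rightarrow> 'k"
  shows "Space (star_rep E v) i = (if i \<in> arms then coords 1 else coords 2)"
  unfolding star_rep_def by simp

lemma star_Map_id:
  fixes v :: "'a \<Rightarrow> nat \<Rightarrow> 'k"
  shows "a \<notin> E \<Longrightarrow> Map (star_rep E v) a x = x"
  unfolding star_rep_def by simp

lemma star_Space_ends:
  fixes v :: "'a \<Rightarrow> nat \<Rightarrow> 'k"
  assumes "e \<in> E"
  shows "Space (star_rep E v) (outer_end e) = coords 1" "Space (star_rep E v) (inner_end e) = coords 2"
  unfolding star_Space using outer_end_arms[OF assms] inner_end_arms[OF assms] by auto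

lemma star_inward:
  fixes v :: "'a \<Rightarrow> nat \<Rightarrow> 'k"
  assumes "e \<in> E" "tail Q e \<in> outer e"
  shows "Map (star_rep E v) e x = seq_scale (x 0) (v e)"
    "tail Q e = outer_end e" "head Q e = inner_end e"
  unfolding star_rep_def outer_end_def inner_end_def using assms by auto

lemma star_outward:
  fixes v :: "'a \<Rightarrow> nat \<Rightarrow> 'k"
  assumes "e \<in> E" "tail Q e \<notin> outer e"
  shows "Map (star_rep E v) e x = seq_scale (det2 (v e) x) (unit_vec 0)"
    "tail Q e = inner_end e" "head Q e = outer_end e"
  unfolding star_rep_def outer_end_def inner_end_def using assms by auto

context
  fixes v :: "'a \<Rightarrow> nat \<Rightarrow> 'k"
  assumes v: "\<And>e. e \<in> E \<Longrightarrow> v e \<in> coords 2 \<and> v e \<noteq> 0"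
begin

abbreviation "star \<equiv> star_rep E v"

lemma star_quiver_rep: "quiver_rep seq_scale Q star"
  unfolding quiver_rep_def
proof (intro conjI ballI)
  show "sq.subspace (Space star i)" for i unfolding star_Space by (simp add: subspace_coords)
  fix a assume a: "a \<in> arcs Q"
  show "linear_between seq_scale seq_scale (Space star (tail Q a)) (Space star (head Q a)) (Map star a)"
  proof (cases "a \<in> E")
    case False
    then show ?thesis
      using arms_arc_iff[OF a False] unfolding linear_between_def star_Map_id[OF False] star_Space by auto
  next
    case True
    note sp = star_Space_ends[OF True]
    show ?thesis
    proof (cases "tail Q a \<in> outer a")
      case t: True
      show ?thesis
        unfolding star_inward[OF True t] linear_between_def sp
        using v[OF True] sq.subspace_scale[OF subspace_coords]
        by (auto simp: seq_scale_def fun_eq_iff algebra_simps)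
    next
      case t: False
      have "seq_scale c (unit_vec 0) \<in> coords 1" for c :: 'k
        using sq.subspace_scale[OF subspace_coords] unit_vec_coords[of 0 1] by simp
      then show ?thesis
        unfolding star_outward[OF True t] linear_between_def sp
        by (simp add: det2_def) (auto simp: seq_scale_def fun_eq_iff algebra_simps)
    qed
  qed
qed

lemma star_bij:
  assumes "a \<in> arcs Q" "a \<notin> E"
  shows "arrow_iso Q star a"
  using arms_arc_iff[OF assms] star_Map_id[OF assms(2)]
  unfolding star_Space bij_betw_def inj_on_def by auto

lemma star_flei: "flei seq_scale Q star"
proof -
  have "fin_dim seq_scale (Space star i)" for i
    unfolding star_Space by (simp add: fin_dim_coords)
  moreover have "{a \<in> arcs Q. \<not> arrow_iso Q star a} \<subseteq> E"
    using star_bij by blast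
  ultimately show ?thesis
    using star_quiver_rep finE finite_subset unfolding flei_def fin_dim_def by blast
qed

text \<open>
  Away from the arrows of the arms the maps are identities, and a summand is closed under their
  inverses as well.
\<close>

lemma star_summand_constant:
  assumes d: "direct_sum_two seq_scale Q star X Y" and uw: "(u, w) \<in> (linked Q E)\<^sup>*"
  shows "Space X u = Space X w"
  using uw
proof (induction rule: rtrancl_induct)
  case (step y z)
  obtain a where a: "a \<in> arcs Q" "a \<notin> E" "(y = tail Q a \<and> z = head Q a) \<or> (y = head Q a \<and> z = tail Q a)"
    using step.hyps unfolding linked_def by auto
  have "Map X a x = x" for x
    using sq.subrepD(2)[OF sq.direct_sum_twoD(1)[OF d]] star_Map_id[OF a(2)] by simp
  then have "Space X (tail Q a) = Space X (head Q a)"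
    using sq.direct_summand_bij[OF star_quiver_rep d a(1) star_bij[OF a(1,2)]] by (simp add: bij_betw_def)
  then show ?case using step.IH a(3) by auto
qed simp

text \<open>
  Each arm splits off on one side of a decomposition, since its space is one-dimensional; this
  forces the line of the arm in the plane at the centre into one of the two summands.
\<close>

lemma star_line_in_summand:
  assumes d: "direct_sum_two seq_scale Q star X Y" and e: "e \<in> E"
  shows "v e \<in> Space X r \<or> v e \<in> Space Y r"
proof -
  have eQ: "e \<in> arcs Q" using e E by blast
  note D = sq.direct_sum_twoD[OF d] and d' = direct_sum_two_commute[OF d]
  have oi: "outer_end e \<in> verts Q" "inner_end e \<in> verts Q"
    using outer_end_verts[OF eQ] inner_end_verts[OF eQ] by auto
  have ri: "(r, inner_end e) \<in> (linked Q E)\<^sup>*"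
    using root_linked_center[OF oi(2) inner_end_arms[OF e]] .
  have c: "Space X (inner_end e) = Space X r" "Space Y (inner_end e) = Space Y r"
    using star_summand_constant[OF d ri] star_summand_constant[OF d' ri] by auto
  have z: "Space X (outer_end e) = {0} \<or> Space Y (outer_end e) = {0}"
    using coords_one_summand[OF sq.subrepD(3)[OF D(1) oi(1)] sq.subrepD(3)[OF D(2) oi(1)]]
      sq.subrepD(4)[OF D(1) oi(1)] sq.subrepD(4)[OF D(2) oi(1)] star_Space_ends(1)[OF e]
      sq.direct_sum_two_span(2)[OF d oi(1)] by simp
  have key: "v e \<in> Space X' r \<or> v e \<in> Space Y' r"
    if d: "direct_sum_two seq_scale Q star X' Y'" and z: "Space X' (outer_end e) = {0}"
      and c: "Space X' (inner_end e) = Space X' r" "Space Y' (inner_end e) = Space Y' r" for X' Y'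
  proof (cases "tail Q e \<in> outer e")
    case True
    note D = sq.direct_sum_twoD[OF d]
    have "unit_vec 0 \<in> Space star (outer_end e)" using star_Space_ends(1)[OF e] by (simp add: unit_vec_coords)
    then obtain y where "y \<in> Space Y' (outer_end e)" "unit_vec 0 = y" using D(3)[OF oi(1)] z by auto
    then have "Map star e (unit_vec 0) \<in> Space Y' (inner_end e)"
      using sq.subrepD(5)[OF D(2) eQ] star_inward(2,3)[OF e True] by simp
    then have "v e \<in> Space Y' (inner_end e)"
      unfolding star_inward(1)[OF e True] by (simp add: seq_scale_def)
    then show ?thesis using c by simp
  next
    case False
    note D = sq.direct_sum_twoD[OF d]
    show ?thesis
    proof (cases "Space X' r = {0}")
      case True
      have "v e \<in> Space star (inner_end e)" using star_Space_ends(2)[OF e] v[OF e] by simp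
      then obtain y where "y \<in> Space Y' (inner_end e)" "v e = y" using D(3)[OF oi(2)] True c(1) by auto
      then show ?thesis using c by simp
    next
      case nz: False
      have sX: "sq.subspace (Space X' r)" using sq.subrepD(3)[OF D(1) root] .
      then obtain x where x: "x \<in> Space X' r" "x \<noteq> 0" using nz sq.subspace_0[OF sX] by blast
      have "Map star e x \<in> Space X' (outer_end e)"
        using sq.subrepD(5)[OF D(1) eQ, of x] star_outward(2,3)[OF e False] x c by simp
      then have "seq_scale (det2 (v e) x) (unit_vec 0) = 0" using z star_outward(1)[OF e False] by simp
      then have det: "det2 (v e) x = 0" using unit_vec_nonzero by auto
      have "x \<in> coords 2"
        using sq.subrepD(4)[OF D(1) oi(2)] star_Space_ends(2)[OF e] x(1) c(1) by auto
      then obtain k where k: "x = seq_scale k (v e)" using det2_zero_multiple[OF det] v[OF e] by metis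
      then have "k \<noteq> 0" using x(2) by (auto simp: seq_scale_def fun_eq_iff)
      then have "v e = seq_scale (inverse k) x" using k by (simp add: seq_scale_def fun_eq_iff)
      then show ?thesis using sq.subspace_scale[OF sX x(1)] by metis
    qed
  qed
  show ?thesis
    using z key[OF d _ c] key[OF d' _ c(2) c(1)] by blast
qed

text \<open>
  On an arm directed inwards the space embeds into the plane.  On an arm directed outwards it is the
  image of the plane, which lies in the other summand.
\<close>

lemma star_zero_if_center_zero:
  assumes d: "direct_sum_two seq_scale Q star X Y" and z: "Space Y r = {0}"
  shows "zero_rep Q Y"
  unfolding zero_rep_def
proof
  fix w assume w: "w \<in> verts Q"
  note D = sq.direct_sum_twoD[OF d] and const = star_summand_constant[OF direct_sum_two_commute[OF d]]
  show "Space Y w = {0}"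
  proof (cases "w \<in> arms")
    case False
    then show ?thesis using const[OF root_linked_center[OF w]] z by simp
  next
    case True
    then obtain e where e: "e \<in> E" "w \<in> outer e" by blast
    have eQ: "e \<in> arcs Q" using e E by blast
    have oi: "outer_end e \<in> verts Q" "inner_end e \<in> verts Q"
      using outer_end_verts[OF eQ] inner_end_verts[OF eQ] by auto
    have zi: "Space Y (inner_end e) = {0}"
      using const[OF root_linked_center[OF oi(2) inner_end_arms[OF e(1)]]] z by simp
    have sY: "sq.subspace (Space Y (outer_end e))" using sq.subrepD(3)[OF D(2) oi(1)] .
    have Y1: "Space Y (outer_end e) \<subseteq> coords 1"
      using sq.subrepD(4)[OF D(2) oi(1)] star_Space_ends(1)[OF e(1)] by simp
    have "y = 0" if y: "y \<in> Space Y (outer_end e)" for y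
    proof (cases "tail Q e \<in> outer e")
      case True
      have "Map star e y \<in> Space Y (inner_end e)"
        using sq.subrepD(5)[OF D(2) eQ] star_inward(2,3)[OF e(1) True] y by simp
      then have "seq_scale (y 0) (v e) = 0" using zi star_inward(1)[OF e(1) True] by simp
      then have "y 0 = 0" using v[OF e(1)] by (auto simp: seq_scale_def fun_eq_iff)
      moreover have "y m = 0" if "m \<noteq> 0" for m using y Y1 that unfolding coords_def by auto
      ultimately have "y m = 0" for m by (cases "m = 0") auto
      then show ?thesis by (simp add: fun_eq_iff)
    next
      case False
      \<comment> \<open>A vector of the plane on which the functional of the arm takes the value \<open>y 0\<close>.\<close>
      obtain x where x: "x \<in> coords 2" "det2 (v e) x = y 0"
      proof (cases "v e 0 = 0")
        case True
        have "v e 1 \<noteq> 0"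
        proof
          assume "v e 1 = 0"
          then have "v e m = 0" for m
            using True v[OF e(1)] unfolding coords_def by (cases "m = 0"; cases "m = 1") auto
          then show False using v[OF e(1)] by (auto simp: fun_eq_iff)
        qed
        then show thesis using True
          by (intro that[of "seq_scale (- y 0 / v e 1) (unit_vec 0)"])
            (auto simp: det2_def seq_scale_def coords_def unit_vec_def)
      next
        case False
        then show thesis
          by (intro that[of "seq_scale (y 0 / v e 0) (unit_vec 1)"])
            (auto simp: det2_def seq_scale_def coords_def unit_vec_def)
      qed
      have "x \<in> Space star (inner_end e)" using x(1) star_Space_ends(2)[OF e(1)] by simp
      then have "x \<in> Space X (inner_end e)" using D(3)[OF oi(2)] zi by fastforce
      then have "Map star e x \<in> Space X (outer_end e)"
        using sq.subrepD(5)[OF D(1) eQ] star_outward(2,3)[OF e(1) False] by simp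
      moreover have "y m = 0" if "m \<noteq> 0" for m using y Y1 that unfolding coords_def by auto
      then have "y m = (seq_scale (y 0) (unit_vec 0)) m" for m
        by (cases "m = 0") (simp_all add: seq_scale_def unit_vec_def)
      then have "y = Map star e x" unfolding star_outward(1)[OF e(1) False] x(2) by (rule ext)
      ultimately show ?thesis using D(5)[OF oi(1)] y by simp
    qed
    then have "Space Y (outer_end e) = {0}" using sq.subspace_0[OF sY] by blast
    then show ?thesis using const[OF arm_linked[OF e]] by simp
  qed
qed

text \<open>
  Of three different lines in the plane two lie in the same summand, which therefore contains the
  whole plane.
\<close>

lemma star_indecomposable:
  assumes b: "b1 \<in> E" "b2 \<in> E" "b3 \<in> E"
    and vb: "v b1 = unit_vec 0" "v b2 = unit_vec 1" "v b3 = unit_vec 0 + unit_vec 1"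
  shows "indecomposable_rep seq_scale Q star"
proof -
  have Br: "Space star r = coords 2" unfolding star_Space using root_not_outer by auto
  have two: "zero_rep Q Y'"
    if d: "direct_sum_two seq_scale Q star X' Y'"
      and "unit_vec 0 \<in> Space X' r" "unit_vec 1 \<in> Space X' r" for X' Y'
  proof (rule star_zero_if_center_zero[OF d])
    note D = sq.direct_sum_twoD[OF d]
    have "coords 2 \<subseteq> Space X' r" using coords_two_subset[OF sq.subrepD(3)[OF D(1) root]] that by blast
    then have "Space Y' r \<subseteq> Space X' r" using sq.subrepD(4)[OF D(2) root] Br by blast
    then show "Space Y' r = {0}" using sq.direct_sum_two_span(2)[OF d root] by blast
  qed
  have "zero_rep Q X \<or> zero_rep Q Y" if d: "direct_sum_two seq_scale Q star X Y" for X Y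
  proof -
    note D = sq.direct_sum_twoD[OF d] and d' = direct_sum_two_commute[OF d]
    have l: "unit_vec 0 \<in> Space X r \<or> unit_vec 0 \<in> Space Y r" "unit_vec 1 \<in> Space X r \<or> unit_vec 1 \<in> Space Y r"
      "unit_vec 0 + unit_vec 1 \<in> Space X r \<or> unit_vec 0 + unit_vec 1 \<in> Space Y r"
      using star_line_in_summand[OF d b(1)] star_line_in_summand[OF d b(2)] star_line_in_summand[OF d b(3)]
      unfolding vb by auto
    have diff: "unit_vec 0 \<in> S" if "sq.subspace S" "unit_vec 0 + unit_vec 1 \<in> S" "unit_vec 1 \<in> S" for S
      using sq.subspace_diff[OF that] by simp
    have diff': "unit_vec 1 \<in> S" if "sq.subspace S" "unit_vec 0 + unit_vec 1 \<in> S" "unit_vec 0 \<in> S" for S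
      using sq.subspace_diff[OF that] by simp
    have sX: "sq.subspace (Space X r)" and sY: "sq.subspace (Space Y r)"
      using sq.subrepD(3)[OF D(1) root] sq.subrepD(3)[OF D(2) root] by auto
    have "(unit_vec 0 \<in> Space X r \<and> unit_vec 1 \<in> Space X r) \<or> (unit_vec 0 \<in> Space Y r \<and> unit_vec 1 \<in> Space Y r)"
      using l diff[OF sX] diff[OF sY] diff'[OF sX] diff'[OF sY] by blast
    then show ?thesis using two[OF d] two[OF d'] by blast
  qed
  moreover have "\<not> zero_rep Q star"
  proof
    assume "zero_rep Q star"
    then have "unit_vec 0 \<in> {0 :: nat \<Rightarrow> 'k}"
      using Br root unit_vec_coords[of 0 2] unfolding zero_rep_def by auto
    then show False using unit_vec_nonzero by blast
  qed
  ultimately show ?thesis using star_quiver_rep unfolding indecomposable_rep_def by blast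
qed

end

text \<open>
  On the plane at the centre the morphism is the nilpotent map that sends the second basis vector to
  the first; this forces multiplication by 0, 1 or -1 on each arm.
\<close>

lemma star_nilpotent_morphism:
  assumes v: "\<And>e. e \<in> E \<Longrightarrow> v e \<in> coords 2 \<and> v e \<noteq> 0" and v': "\<And>e. e \<in> E \<Longrightarrow> v' e \<in> coords 2 \<and> v' e \<noteq> 0"
    and compat: "\<And>e. e \<in> E \<Longrightarrow> v e = unit_vec 0 \<and> v' e 1 = 1 \<or> v e 1 = 1 \<and> v' e = (unit_vec 0 :: nat \<Rightarrow> 'k)"
  obtains f where "rep_morphism seq_scale seq_scale Q (star_rep E v) (star_rep E v') f"
    "\<not> zero_morphism Q (star_rep E v) f"
proof -
  define c :: "'a \<Rightarrow> 'k" where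
    "c e = (if tail Q e \<in> outer e then (if v e = unit_vec 0 then 0 else 1)
            else (if v e = unit_vec 0 then - 1 else 0))" for e
  define arm where "arm i = (THE e. e \<in> E \<and> i \<in> outer e)" for i
  define f where "f i x = (if i \<in> arms then seq_scale (c (arm i)) x else seq_scale (x 1) (unit_vec 0))" for i x
  have arm: "arm i = e" if "e \<in> E" "i \<in> outer e" for i e
    unfolding arm_def using that disj by (intro the_equality) blast+
  let ?V = "star_rep E v" and ?W = "star_rep E v'"
  note sp = star_Space
  have f_arm: "f i x = seq_scale (c e) x" if "e \<in> E" "i \<in> outer e" for i e x
    using arm[OF that] that unfolding f_def by auto
  have f_center: "f i x = seq_scale (x 1) (unit_vec 0)" if "i \<notin> arms" for i x
    using that unfolding f_def by simp
  have "rep_morphism seq_scale seq_scale Q ?V ?W f"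
    unfolding rep_morphism_def
  proof (intro conjI ballI)
    fix i assume "i \<in> verts Q"
    show "linear_between seq_scale seq_scale (Space ?V i) (Space ?W i) (f i)"
    proof (cases "i \<in> arms")
      case True
      then show ?thesis unfolding linear_between_def f_def sp
        using sq.subspace_scale[OF subspace_coords]
        by (simp add: sq.scale_right_distrib sq.scale_left_commute)
    next
      case False
      have "seq_scale k (unit_vec 0) \<in> coords 2" for k :: 'k
        using sq.subspace_scale[OF subspace_coords] unit_vec_coords[of 0 2] by simp
      then show ?thesis using False unfolding linear_between_def f_def sp
        by (simp add: sq.scale_left_distrib) (simp add: seq_scale_def mult.assoc)
    qed
  next
    fix a x assume a: "a \<in> arcs Q" and x: "x \<in> Space ?V (tail Q a)"
    show "f (head Q a) (Map ?V a x) = Map ?W a (f (tail Q a) x)"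
    proof (cases "a \<in> E")
      case False
      have "f (head Q a) x = f (tail Q a) x"
      proof (cases "tail Q a \<in> arms")
        case True
        then obtain e where e: "e \<in> E" "tail Q a \<in> outer e" by blast
        then have "head Q a \<in> outer e" using outer_arc_iff[OF a, of e] False by blast
        then show ?thesis using f_arm[OF e] f_arm[OF e(1)] by simp
      next
        case nt: False
        then show ?thesis using f_center arms_arc_iff[OF a False] by simp
      qed
      then show ?thesis using star_Map_id[OF False] by simp
    next
      case True
      note fo = f_arm[OF True outer_end_outer[OF a]] and fi = f_center[OF inner_end_arms[OF True]]
      show ?thesis
      proof (cases "tail Q a \<in> outer a")
        case t: True
        show ?thesis unfolding star_inward[OF True t] fo fi
          using compat[OF True] t by (auto simp: c_def seq_scale_def)
      next
        case t: False
        show ?thesis unfolding star_outward[OF True t] fo fi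
          using compat[OF True] t by (auto simp: c_def seq_scale_def det2_def)
      qed
    qed
  qed
  moreover have "\<not> zero_morphism Q ?V f"
  proof
    assume z: "zero_morphism Q ?V f"
    have "r \<notin> arms" using root_not_outer by blast
    then have "unit_vec 1 \<in> Space ?V r" "f r (unit_vec 1) = unit_vec 0"
      unfolding sp f_center[OF \<open>r \<notin> arms\<close>] by (simp_all add: unit_vec_coords seq_scale_def)
    then show False using z root unit_vec_nonzero[of 0] unfolding zero_morphism_def by metis
  qed
  ultimately show thesis using that by blast
qed

text \<open>
  An isomorphism maps the image, or the kernel, that an arm singles out in one plane to the
  corresponding line of the other; \<open>det2\<close> tests whether a vector lies on that line.
\<close>

lemma star_iso_preserves_lines:
  assumes f: "rep_isomorphism seq_scale seq_scale Q (star_rep E v) (star_rep E v') f"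
    and e: "e \<in> E" and ve: "v e \<in> coords 2"
  shows "det2 (v' e) (f r (v e)) = (0 :: 'k)"
proof -
  let ?V = "star_rep E v" and ?W = "star_rep E v'"
  have eQ: "e \<in> arcs Q" using e E by blast
  have oi: "outer_end e \<in> verts Q" "inner_end e \<in> verts Q"
    using outer_end_verts[OF eQ] inner_end_verts[OF eQ] by auto
  have com: "f (head Q a) (Map ?V a x) = Map ?W a (f (tail Q a) x)"
    if "a \<in> arcs Q" "x \<in> Space ?V (tail Q a)" for a x
    using f that unfolding rep_isomorphism_def rep_morphism_def by blast
  \<comment> \<open>The isomorphism is the same map at all vertices of the centre.\<close>
  have const: "w \<notin> arms \<and> f w (v e) = f r (v e)" if "(r, w) \<in> (linked Q E)\<^sup>*" for w
    using that
  proof (induction rule: rtrancl_induct)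
    case base
    then show ?case using root_not_outer by blast
  next
    case (step y z)
    obtain a where a: "a \<in> arcs Q" "a \<notin> E" "(y = tail Q a \<and> z = head Q a) \<or> (y = head Q a \<and> z = tail Q a)"
      using step.hyps unfolding linked_def by auto
    have z: "z \<notin> arms" "tail Q a \<notin> arms" using arms_arc_iff[OF a(1,2)] a(3) step.IH by metis+
    have "f (head Q a) (v e) = f (tail Q a) (v e)"
      using com[OF a(1), of "v e"] z(2) ve star_Map_id[OF a(2)] star_Space by simp
    then show ?case using a(3) step.IH z(1) by auto
  qed
  have c: "f (inner_end e) (v e) = f r (v e)"
    using const[OF root_linked_center[OF oi(2) inner_end_arms[OF e]]] by blast
  show ?thesis
  proof (cases "tail Q e \<in> outer e")
    case True
    note m = star_inward[OF e True]
    have "unit_vec 0 \<in> Space ?V (tail Q e)"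
      unfolding m star_Space_ends[OF e] by (simp add: unit_vec_coords)
    then have "f (inner_end e) (v e) = seq_scale (f (outer_end e) (unit_vec 0) 0) (v' e)"
      using com[OF eQ, of "unit_vec 0"] unfolding m by (simp add: seq_scale_def)
    then show ?thesis using c by (simp add: det2_def seq_scale_def)
  next
    case False
    note m = star_outward[OF e False]
    have "linear_between seq_scale seq_scale (coords 1) (Space ?W (outer_end e)) (f (outer_end e))"
      using f oi(1) star_Space_ends(1)[OF e] unfolding rep_isomorphism_def rep_morphism_def by metis
    then have z: "f (outer_end e) 0 = 0"
      using linear_between_zero[OF sq.vs sq.vs subspace_coords] by blast
    have "v e \<in> Space ?V (tail Q e)" unfolding m star_Space_ends[OF e] by (rule ve)
    then have "f (outer_end e) (seq_scale (det2 (v e) (v e)) (unit_vec 0)) =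
        seq_scale (det2 (v' e) (f (inner_end e) (v e))) (unit_vec 0)"
      using com[OF eQ] unfolding m by simp
    moreover have "det2 (v e) (v e) = 0" by (simp add: det2_def)
    ultimately have "seq_scale (det2 (v' e) (f (inner_end e) (v e))) (unit_vec 0) = 0" using z by simp
    then show ?thesis using c unit_vec_nonzero by auto
  qed
qed

end

text \<open>
  Four cuts with disjoint outer parts contradict antisymmetry: contracting everything else gives a
  star with four arms, on which two different regular representations map to each other.
\<close>

lemma (in rooted_tree) no_four_disjoint_cuts:
  assumes anti: "antisym (indec_order Q :: (('i, 'a, 'k::field) rep_class \<times> _) set)"
    and a: "{a1, a2, a3, a4} \<subseteq> arcs Q" "distinct [a1, a2, a3, a4]"
    and disj: "\<And>e e'. e \<in> {a1, a2, a3, a4} \<Longrightarrow> e' \<in> {a1, a2, a3, a4} \<Longrightarrow> e \<noteq> e' \<Longrightarrow> outer e \<inter> outer e' = {}"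
  shows False
proof -
  let ?E = "{a1, a2, a3, a4}"
  interpret star_cuts Q r ?E "TYPE('k)"
    by unfold_locales (use a disj in auto)
  let ?e0 = "unit_vec 0 :: nat \<Rightarrow> 'k" and ?e1 = "unit_vec 1 :: nat \<Rightarrow> 'k"
  define v where "v = (\<lambda>e. if e = a3 then ?e1 else if e = a4 then ?e0 + ?e1 else ?e0)"
  define v' where "v' = (\<lambda>e. if e = a1 then ?e1 else if e = a2 then ?e0 + ?e1 else ?e0)"
  have c2: "?e0 \<in> coords 2" "?e1 \<in> coords 2" by (auto simp: unit_vec_coords)
  then have c2': "?e0 + ?e1 \<in> coords 2" using sq.subspace_add[OF subspace_coords] by blast
  have nz: "?e0 + ?e1 \<noteq> 0" by (auto simp: fun_eq_iff unit_vec_def intro!: exI[of _ 0])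
  have v: "v e \<in> coords 2 \<and> v e \<noteq> 0" "v' e \<in> coords 2 \<and> v' e \<noteq> 0" for e
    unfolding v_def v'_def using c2 c2' nz unit_vec_nonzero by auto
  have val: "v a1 = ?e0" "v a2 = ?e0" "v a3 = ?e1" "v a4 = ?e0 + ?e1"
    "v' a1 = ?e1" "v' a2 = ?e0 + ?e1" "v' a3 = ?e0" "v' a4 = ?e0"
    using a(2) unfolding v_def v'_def by auto
  have compat: "v e = ?e0 \<and> v' e 1 = 1 \<or> v e 1 = 1 \<and> v' e = ?e0" if "e \<in> ?E" for e
    using that val by auto
  then have compat': "v' e = ?e0 \<and> v e 1 = 1 \<or> v' e 1 = 1 \<and> v e = ?e0" if "e \<in> ?E" for e
    using that by blast
  let ?V = "star_rep ?E v" and ?W = "star_rep ?E v'"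
  have iV: "indecomposable_rep seq_scale Q ?V"
    by (rule star_indecomposable[of v a1 a3 a4]) (use v val in auto)
  have iW: "indecomposable_rep seq_scale Q ?W"
    by (rule star_indecomposable[of v' a3 a1 a2]) (use v val in auto)
  have fV: "flei seq_scale Q ?V" "flei seq_scale Q ?W"
    using star_flei v by auto
  obtain \<alpha> :: "('i, 'a, 'k) rep_class" where \<alpha>: "\<alpha> \<in> indec_flei Q" "in_class seq_scale Q ?V \<alpha>"
    by (rule indecomposable_flei_has_class[OF sq.wfQ sq.vs fV(1) iV])
  obtain \<beta> :: "('i, 'a, 'k) rep_class" where \<beta>: "\<beta> \<in> indec_flei Q" "in_class seq_scale Q ?W \<beta>"
    by (rule indecomposable_flei_has_class[OF sq.wfQ sq.vs fV(2) iW])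
  obtain f where f: "rep_morphism seq_scale seq_scale Q ?V ?W f" "\<not> zero_morphism Q ?V f"
    by (rule star_nilpotent_morphism[OF v compat])
  obtain g where g: "rep_morphism seq_scale seq_scale Q ?W ?V g" "\<not> zero_morphism Q ?W g"
    by (rule star_nilpotent_morphism[OF v(2,1) compat'])
  have "(\<beta>, \<alpha>) \<in> indec_order Q" "(\<alpha>, \<beta>) \<in> indec_order Q"
    using indec_order_if_morphism[OF sq.wfQ sq.vs sq.vs \<alpha>(1) \<beta>(1) \<alpha>(2) \<beta>(2) f]
      indec_order_if_morphism[OF sq.wfQ sq.vs sq.vs \<beta>(1) \<alpha>(1) \<beta>(2) \<alpha>(2) g] by auto
  then have eq: "\<beta> = \<alpha>" using antisymD[OF anti] by blast
  obtain h where h: "rep_isomorphism seq_scale seq_scale Q ?V ?W h"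
    using in_class_isomorphic[OF sq.wfQ sq.vs sq.vs \<alpha>] \<beta>(2) unfolding eq rep_isomorphic_def by blast
  let ?m = "h r ?e0"
  have "det2 ?e1 ?m = 0" "det2 (?e0 + ?e1) ?m = 0"
    using star_iso_preserves_lines[OF h, of a1] star_iso_preserves_lines[OF h, of a2] v c2 val by auto
  then have m01: "?m 0 = 0" "?m 1 = 0" by (auto simp: det2_def)
  have sp: "Space ?V r = coords 2" "Space ?W r = coords 2"
    unfolding star_Space using root_not_outer by auto
  have hr: "linear_between seq_scale seq_scale (coords 2) (coords 2) (h r)" "inj_on (h r) (coords 2)"
    using h root sp unfolding rep_isomorphism_def rep_morphism_def bij_betw_def by metis+
  have "?m \<in> coords 2" using hr(1) c2 unfolding linear_between_def by blast
  then have "?m j = 0" for j using m01 unfolding coords_def by (cases "j = 0"; cases "j = 1") auto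
  then have "?m = 0" by (simp add: fun_eq_iff)
  then show False
    using linear_between_inj_on_iff[OF sq.vs sq.vs subspace_coords hr(1)] hr(2) c2(1) unit_vec_nonzero by blast
qed

section \<open>Closure properties of FLEI representations\<close>

locale ordered_tree = quiver_ambient s Q + rooted_tree Q r
  for s :: "'k::field \<Rightarrow> 'v::ab_group_add \<Rightarrow> 'v" and Q :: "('i, 'a) pre_digraph" and r +
  assumes po: "partial_order_on (indec_flei Q :: ('i, 'a, 'k) rep_class set) (indec_order Q)"
    and wfo: "wf ((indec_order Q :: (('i, 'a, 'k) rep_class \<times> ('i, 'a, 'k) rep_class) set) - Id)"
begin

abbreviation below :: "('i, 'a, 'k) rep_class \<Rightarrow> ('i, 'a, 'k) rep_class \<Rightarrow> bool"  (infix \<open>\<sqsubseteq>\<close> 50) where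
  "\<alpha> \<sqsubseteq> \<beta> \<equiv> (\<alpha>, \<beta>) \<in> indec_order Q"

lemma anti: "antisym (indec_order Q :: (('i, 'a, 'k) rep_class \<times> ('i, 'a, 'k) rep_class) set)"
  using po unfolding partial_order_on_def by blast

lemma below_refl: "\<alpha> \<in> indec_flei Q \<Longrightarrow> \<alpha> \<sqsubseteq> \<alpha>"
  using po unfolding partial_order_on_def preorder_on_def refl_on_def by blast

lemma below_trans: "\<alpha> \<sqsubseteq> \<beta> \<Longrightarrow> \<beta> \<sqsubseteq> \<gamma> \<Longrightarrow> \<alpha> \<sqsubseteq> \<gamma>"
  using po unfolding partial_order_on_def preorder_on_def by (meson transD)

lemma below_antisym: "\<alpha> \<sqsubseteq> \<beta> \<Longrightarrow> \<beta> \<sqsubseteq> \<alpha> \<Longrightarrow> \<alpha> = \<beta>"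
  using anti by (meson antisymD)

lemma below_indec: "\<alpha> \<sqsubseteq> \<beta> \<Longrightarrow> \<alpha> \<in> indec_flei Q" "\<alpha> \<sqsubseteq> \<beta> \<Longrightarrow> \<beta> \<in> indec_flei Q"
  unfolding indec_order_def by auto

text \<open>
  Colour the pairs of arrows by whether their outer parts are disjoint.  An infinite set of pairwise
  disjoint outer parts would contain four of them, so Ramsey's theorem yields the other colour.
\<close>

lemma infinite_nested_cuts:
  assumes J: "infinite J" "J \<subseteq> arcs Q"
  obtains Y where "Y \<subseteq> J" "infinite Y"
    "\<And>x y. x \<in> Y \<Longrightarrow> y \<in> Y \<Longrightarrow> outer x \<subseteq> outer y \<or> outer y \<subseteq> outer x"
proof -
  define col where "col Z = (if \<exists>x\<in>Z. \<exists>y\<in>Z. outer x \<inter> outer y = {} then 0 else (1 :: nat))" for Z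
  have "\<forall>x\<in>J. \<forall>y\<in>J. x \<noteq> y \<longrightarrow> col {x, y} < 2" unfolding col_def by simp
  from Ramsey2[OF J(1) this] obtain Y t where
    Y: "Y \<subseteq> J" "infinite Y" "t < 2" "\<forall>x\<in>Y. \<forall>y\<in>Y. x \<noteq> y \<longrightarrow> col {x, y} = t" by blast
  have ne: "outer x \<noteq> {}" if "x \<in> Y" for x using outer_end_outer Y(1) J(2) that by blast
  have disj: "col {x, y} = 0 \<longleftrightarrow> outer x \<inter> outer y = {}" if "x \<in> Y" "y \<in> Y" for x y
    using ne[OF that(1)] ne[OF that(2)] unfolding col_def by auto
  have "t \<noteq> 0"
  proof
    assume t: "t = 0"
    obtain A where A: "A \<subseteq> Y" "card A = 4" "finite A"
      using infinite_arbitrarily_large[OF Y(2)] by blast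
    obtain xs where xs: "set xs = A" "distinct xs" using finite_distinct_list[OF A(3)] by blast
    then have "length xs = 4" using A(2) distinct_card by metis
    then obtain a1 a2 a3 a4 where x4: "xs = [a1, a2, a3, a4]"
      by (auto simp: numeral_eq_Suc length_Suc_conv)
    show False
    proof (rule no_four_disjoint_cuts[OF anti])
      show "{a1, a2, a3, a4} \<subseteq> arcs Q" using xs(1) A(1) Y(1) J(2) unfolding x4 by auto
      show "distinct [a1, a2, a3, a4]" using xs(2) unfolding x4 .
      fix e e' assume "e \<in> {a1, a2, a3, a4}" "e' \<in> {a1, a2, a3, a4}" "e \<noteq> e'"
      then show "outer e \<inter> outer e' = {}" using Y(4) disj[of e e'] A(1) t xs(1) unfolding x4 by auto
    qed
  qed
  then have "outer x \<inter> outer y \<noteq> {}" if "x \<in> Y" "y \<in> Y" for x y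
    using that ne Y(4) disj[OF that] by (cases "x = y") auto
  then have "outer x \<subseteq> outer y \<or> outer y \<subseteq> outer x" if "x \<in> Y" "y \<in> Y" for x y
    using outer_laminar[of x y] Y(1) J(2) that by blast
  then show thesis using that Y(1,2) by blast
qed

lemma finite_cuts_containing:
  assumes "e \<in> arcs Q"
  shows "finite {h \<in> arcs Q. outer e \<subseteq> outer h}"
proof (rule finite_subset)
  show "{h \<in> arcs Q. outer e \<subseteq> outer h} \<subseteq> {h \<in> arcs Q. outer_end e \<in> outer h}"
    using outer_end_outer[OF assms] by blast
qed (rule finite_cuts_around[OF outer_end_verts[OF assms]])

text \<open>
  Along the ray through infinitely many nested cuts where \<open>K\<close> fails to be isomorphic, the arrows
  finally point away from the root and are isomorphisms in \<open>P\<close>.  The dimension of \<open>K\<close> then grows beyond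
  the dimension of \<open>P\<close>, which stays constant.
\<close>

lemma subrep_flei:
  assumes P: "flei s Q P" and K: "subrep s Q P K"
  shows "flei s Q K"
proof -
  define J where "J = {a \<in> arcs Q. arrow_iso Q P a \<and> \<not> arrow_iso Q K a}"
  define bad where "bad = {a \<in> arcs Q. \<not> arrow_iso Q P a}"
  have fbad: "finite bad" using P unfolding flei_def bad_def by blast
  have fdK: "fin_dim s (Space K i)" "dim (Space K i) \<le> dim (Space P i)" if "i \<in> verts Q" for i
    using fin_dim_subspace[OF flei_fin_dim[OF P that] subrepD(3)[OF K that] subrepD(4)[OF K that]] by auto
  have "finite J"
  proof (rule ccontr)
    assume "infinite J"
    then obtain Y where Y: "Y \<subseteq> J" "infinite Y"
      and nested: "\<And>x y. x \<in> Y \<Longrightarrow> y \<in> Y \<Longrightarrow> outer x \<subseteq> outer y \<or> outer y \<subseteq> outer x"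
      using infinite_nested_cuts[of J] unfolding J_def by blast
    have YQ: "y \<in> arcs Q" if "y \<in> Y" for y using Y(1) that unfolding J_def by blast
    define ray where "ray = {h \<in> arcs Q. \<exists>e\<in>Y. outer e \<subseteq> outer h}"
    have ray_nested: "outer h \<subseteq> outer h' \<or> outer h' \<subseteq> outer h" if hh: "h \<in> ray" "h' \<in> ray" for h h'
    proof -
      obtain e e' where e: "e \<in> Y" "outer e \<subseteq> outer h" "e' \<in> Y" "outer e' \<subseteq> outer h'"
        using hh unfolding ray_def by blast
      have "outer h \<inter> outer h' \<noteq> {}"
        using nested[OF e(1,3)] e outer_end_outer[OF YQ[OF e(1)]] outer_end_outer[OF YQ[OF e(3)]] by blast
      then show ?thesis using outer_laminar hh unfolding ray_def by blast
    qed
    define I where "I = {h \<in> ray. tail Q h \<in> outer h}"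
    have "finite I"
    proof (rule ccontr)
      assume inf: "infinite I"
      have IQ: "I \<subseteq> arcs Q" unfolding I_def ray_def by blast
      show False
      proof (rule no_infinite_inward_chain[OF wfo IQ])
        show "I \<noteq> {}" using inf by auto
        show "tail Q f \<in> outer f" if "f \<in> I" for f using that unfolding I_def by blast
        fix f assume f: "f \<in> I"
        have "infinite (I - {h \<in> arcs Q. outer f \<subseteq> outer h})"
          using inf finite_cuts_containing[of f] f IQ by (simp add: Diff_infinite_finite subset_iff)
        then have "I - {h \<in> arcs Q. outer f \<subseteq> outer h} \<noteq> {}" by (metis finite.emptyI)
        then obtain f' where f': "f' \<in> I" "\<not> outer f \<subseteq> outer f'" using IQ by blast
        then have "outer f' \<subset> outer f" using ray_nested[of f f'] f unfolding I_def by blast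
        then show "\<exists>f'\<in>I. outer f' \<subset> outer f" using f'(1) by blast
      qed
    qed
    \<comment> \<open>Far enough along the ray all arcs point away from the root and are isomorphisms in \<open>P\<close>.\<close>
    have "\<exists>e0\<in>Y. \<forall>h\<in>ray. outer h \<subseteq> outer e0 \<longrightarrow> h \<notin> I \<union> bad"
    proof -
      let ?D = "(I \<union> bad) \<inter> ray"
      have "\<forall>b\<in>?D. \<exists>e\<in>Y. outer e \<subseteq> outer b" unfolding ray_def by blast
      then obtain E where E: "\<And>b. b \<in> ?D \<Longrightarrow> E b \<in> Y \<and> outer (E b) \<subseteq> outer b" by metis
      let ?C = "\<Union>b\<in>?D. {h \<in> arcs Q. outer (E b) \<subseteq> outer h}"
      have "finite ?C" using \<open>finite I\<close> fbad finite_cuts_containing E YQ by auto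
      then have "infinite (Y - ?C)" using Y(2) by (rule Diff_infinite_finite)
      then have "Y - ?C \<noteq> {}" by (metis finite.emptyI)
      then obtain e0 where e0: "e0 \<in> Y" "e0 \<notin> ?C" by blast
      have "h \<notin> I \<union> bad" if h: "h \<in> ray" "outer h \<subseteq> outer e0" for h
      proof
        assume "h \<in> I \<union> bad"
        then have hD: "h \<in> ?D" using h(1) by blast
        then have "outer (E h) \<subseteq> outer e0" using E[OF hD] h(2) by blast
        then show False using e0 hD YQ[OF e0(1)] by blast
      qed
      then show ?thesis using e0(1) by blast
    qed
    then obtain e0 where e0: "e0 \<in> Y" and far: "\<And>h. h \<in> ray \<Longrightarrow> outer h \<subseteq> outer e0 \<Longrightarrow> h \<notin> I \<union> bad"
      by blast
    have out: "tail Q h = inner_end h" "head Q h = outer_end h" "arrow_iso Q P h"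
      if "h \<in> ray" "outer h \<subseteq> outer e0" for h
      using far[OF that] that(1) unfolding I_def bad_def ray_def inner_end_def outer_end_def by auto
    have arrow: "dim (Space P (inner_end h)) = dim (Space P (outer_end h))"
        "dim (Space K (inner_end h)) \<le> dim (Space K (outer_end h))"
        "\<not> arrow_iso Q K h \<Longrightarrow> dim (Space K (inner_end h)) < dim (Space K (outer_end h))"
      if h: "h \<in> ray" "outer h \<subseteq> outer e0" for h
    proof -
      have hQ: "h \<in> arcs Q" using h(1) unfolding ray_def by blast
      note th = out(1,2)[OF h] and v = inner_end_verts[OF hQ] outer_end_verts[OF hQ]
      note fd = flei_fin_dim[OF P v(1)] flei_fin_dim[OF P v(2)]
      have LP: "linear_between s s (Space P (inner_end h)) (Space P (outer_end h)) (Map P h)"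
        using quiver_rep_linear[OF flei_quiver_rep[OF P] hQ] th by simp
      have LK: "linear_between s s (Space K (inner_end h)) (Space K (outer_end h)) (Map K h)"
        using quiver_rep_linear[OF subrepD(1)[OF K] hQ] th by simp
      have bij: "bij_betw (Map P h) (Space P (inner_end h)) (Space P (outer_end h))"
        using out(3)[OF h] th by simp
      have inj: "inj_on (Map K h) (Space K (inner_end h))"
        using bij subrepD(2)[OF K] subrepD(4)[OF K v(1)] unfolding bij_betw_def by (metis inj_on_subset)
      have "linear_between s s (Space P (outer_end h)) (Space P (inner_end h)) (inv_into (Space P (inner_end h)) (Map P h))"
        using linear_between_inv_into[OF vs vs quiver_rep_subspace[OF flei_quiver_rep[OF P] v(1)] LP bij] .
      moreover have "inj_on (inv_into (Space P (inner_end h)) (Map P h)) (Space P (outer_end h))"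
        using bij_betw_inv_into[OF bij] by (rule bij_betw_imp_inj_on)
      ultimately show "dim (Space P (inner_end h)) = dim (Space P (outer_end h))"
        using linear_between_dim_le[OF vs vs fd LP bij_betw_imp_inj_on[OF bij]]
          linear_between_dim_le[OF vs vs fd(2,1)] by (meson le_antisym)
      show "dim (Space K (inner_end h)) \<le> dim (Space K (outer_end h))"
        using linear_between_dim_le[OF vs vs fdK(1)[OF v(1)] fdK(1)[OF v(2)] LK inj] .
      show "dim (Space K (inner_end h)) < dim (Space K (outer_end h))" if "\<not> arrow_iso Q K h"
        using linear_between_dim_less[OF vs vs fdK(1)[OF v(1)] fdK(1)[OF v(2)] LK inj] that th by simp
    qed
    have grow: "\<exists>e\<in>Y. outer e \<subseteq> outer e0 \<and> n \<le> dim (Space K (outer_end e)) \<and>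
        dim (Space P (outer_end e)) = dim (Space P (outer_end e0))" for n
    proof (induction n)
      case 0
      then show ?case using e0 by blast
    next
      case (Suc n)
      then obtain e where e: "e \<in> Y" "outer e \<subseteq> outer e0" "n \<le> dim (Space K (outer_end e))"
        "dim (Space P (outer_end e)) = dim (Space P (outer_end e0))" by blast
      have eQ: "e \<in> arcs Q" using YQ e(1) .
      have "infinite (Y - {h \<in> arcs Q. outer e \<subseteq> outer h})"
        using Y(2) finite_cuts_containing[OF eQ] by (rule Diff_infinite_finite[rotated])
      then have "Y - {h \<in> arcs Q. outer e \<subseteq> outer h} \<noteq> {}" by (metis finite.emptyI)
      then obtain e' where e': "e' \<in> Y" "\<not> outer e \<subseteq> outer e'" using YQ by blast
      have e'Q: "e' \<in> arcs Q" using YQ e'(1) .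
      have sub: "outer e' \<subseteq> outer e" using nested[OF e(1) e'(1)] e'(2) by blast
      have e'ray: "e' \<in> ray" "outer e' \<subseteq> outer e0" using e'(1) e'Q sub e(2) unfolding ray_def by auto
      have ne: "e' \<noteq> e" using e'(2) by blast
      have ie: "inner_end e' \<in> outer e"
        using outer_ends_iff[OF e'Q ne] outer_end_outer[OF e'Q] sub by blast
      have "n \<le> dim (Space K (inner_end e')) \<and>
          dim (Space P (inner_end e')) = dim (Space P (outer_end e0))"
      proof (rule outer_path_induct[OF eQ ie])
        show "n \<le> dim (Space K (outer_end e)) \<and> dim (Space P (outer_end e)) = dim (Space P (outer_end e0))"
          using e(3,4) by blast
        fix h assume h: "h \<in> arcs Q" "h \<noteq> e" "inner_end e' \<in> outer h" "outer h \<subseteq> outer e"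
          and IH: "n \<le> dim (Space K (inner_end h)) \<and> dim (Space P (inner_end h)) = dim (Space P (outer_end e0))"
        have he': "e' \<noteq> h" using h(3) inner_end_not_outer[OF e'Q] by blast
        have "outer_end e' \<in> outer h" using outer_ends_iff[OF e'Q he'] h(3) by blast
        moreover have "\<not> outer h \<subseteq> outer e'" using h(3) inner_end_not_outer[OF e'Q] by blast
        ultimately have "outer e' \<subseteq> outer h"
          using outer_laminar[OF e'Q h(1)] outer_end_outer[OF e'Q] by blast
        then have hr: "h \<in> ray" "outer h \<subseteq> outer e0" using h(1,4) e'(1) e(2) unfolding ray_def by auto
        show "n \<le> dim (Space K (outer_end h)) \<and> dim (Space P (outer_end h)) = dim (Space P (outer_end e0))"
          using arrow(1,2)[OF hr] IH by simp
      qed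
      moreover have "\<not> arrow_iso Q K e'" using e'(1) Y(1) unfolding J_def by blast
      ultimately have "Suc n \<le> dim (Space K (outer_end e'))"
        "dim (Space P (outer_end e')) = dim (Space P (outer_end e0))"
        using arrow(1,3)[OF e'ray] by linarith+
      then show ?case using e'(1) e'ray(2) by blast
    qed
    obtain e where "e \<in> Y" "Suc (dim (Space P (outer_end e0))) \<le> dim (Space K (outer_end e))"
      "dim (Space P (outer_end e)) = dim (Space P (outer_end e0))" using grow by blast
    then show False using fdK(2)[OF outer_end_verts[OF YQ]] by fastforce
  qed
  moreover have "{a \<in> arcs Q. \<not> arrow_iso Q K a} \<subseteq> bad \<union> J" unfolding bad_def J_def by blast
  ultimately have "finite {a \<in> arcs Q. \<not> arrow_iso Q K a}" using fbad finite_subset by blast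
  then show ?thesis using subrepD(1)[OF K] fdK(1) unfolding flei_def fin_dim_def by blast
qed

text \<open>
  An arrow that is an isomorphism on \<open>A\<close>, \<open>B\<close> and \<open>A \<inter> B\<close> is injective on \<open>A + B\<close>: if \<open>x \<in> A\<close> and
  \<open>y \<in> B\<close> have opposite images, that image comes from \<open>A \<inter> B\<close>, which forces \<open>x\<close> into \<open>B\<close>.
\<close>

lemma flei_rep_sum_two:
  assumes V: "quiver_rep s Q V" and A: "subrep s Q V A" "flei s Q A" and B: "subrep s Q V B" "flei s Q B"
  shows "flei s Q (rep_sum s V {A, B})"
proof -
  define C where "C = \<lparr>Space = (\<lambda>i. Space A i \<inter> Space B i), Map = Map A\<rparr>"
  let ?S = "rep_sum s V {A, B}"
  have MA: "Map A = Map V" and MB: "Map B = Map V" using subrepD(2) A(1) B(1) by auto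
  have S: "subrep s Q V ?S" by (rule subrep_rep_sum[OF V]) (use A B in auto)
  have C: "subrep s Q A C"
  proof (rule subrepI)
    show "quiver_rep s Q A" using flei_quiver_rep A(2) .
    show "subspace (Space C i) \<and> Space C i \<subseteq> Space A i" if "i \<in> verts Q" for i
      using subspace_inter subrepD(3)[OF A(1) that] subrepD(3)[OF B(1) that] unfolding C_def by simp
    show "Map A a x \<in> Space C (head Q a)" if "a \<in> arcs Q" "x \<in> Space C (tail Q a)" for a x
      using that subrepD(5)[OF A(1)] subrepD(5)[OF B(1)] unfolding C_def MA by auto
  qed (simp add: C_def)
  have fC: "flei s Q C" using subrep_flei[OF A(2) C] .
  have sp: "Space ?S i = {x + y | x y. x \<in> Space A i \<and> y \<in> Space B i}" if i: "i \<in> verts Q" for i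
  proof -
    have "span (Space A i) = Space A i" "span (Space B i) = Space B i"
      using subrepD(3)[OF A(1) i] subrepD(3)[OF B(1) i] by (simp_all only: span_eq_iff)
    then show ?thesis by (simp only: rep_sum_Space UN_insert UN_empty Un_empty_right span_Un)
  qed
  have iso: "arrow_iso Q ?S a" if a: "a \<in> arcs Q" and isos: "arrow_iso Q A a" "arrow_iso Q B a" "arrow_iso Q C a" for a
  proof -
    let ?t = "tail Q a" and ?h = "head Q a"
    have th: "?t \<in> verts Q" "?h \<in> verts Q" using a by auto
    note L = quiver_rep_linear[OF V a] and sV = quiver_rep_subspace[OF V th(1)]
    have im: "Map V a ` Space A ?t = Space A ?h" "Map V a ` Space B ?t = Space B ?h"
      "Map V a ` (Space A ?t \<inter> Space B ?t) = Space A ?h \<inter> Space B ?h"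
      and inj: "inj_on (Map V a) (Space A ?t)"  "inj_on (Map V a) (Space B ?t)"
      using isos MA MB unfolding bij_betw_def C_def by auto
    have inV: "Space A ?t \<subseteq> Space V ?t" "Space B ?t \<subseteq> Space V ?t"
      using subrepD(4)[OF A(1) th(1)] subrepD(4)[OF B(1) th(1)] by auto
    have sB: "subspace (Space B ?t)" "subspace (Space B ?h)"
      using subrepD(3)[OF B(1) th(1)] subrepD(3)[OF B(1) th(2)] by auto
    have add: "Map V a (x + y) = Map V a x + Map V a y" if "x \<in> Space A ?t" "y \<in> Space B ?t" for x y
      using L inV that unfolding linear_between_def by blast
    have LS: "linear_between s s (Space ?S ?t) (Space ?S ?h) (Map ?S a)"
      using quiver_rep_linear[OF subrepD(1)[OF S] a] .
    have z0: "Map V a 0 = 0" using linear_between_zero[OF vs vs sV L] .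
    have "z = 0" if z: "z \<in> Space ?S ?t" "Map ?S a z = 0" for z
    proof -
      obtain x y where xy: "z = x + y" "x \<in> Space A ?t" "y \<in> Space B ?t" using z(1) sp[OF th(1)] by blast
      have "Map V a x + Map V a y = 0" using z(2) add[OF xy(2,3)] xy(1) by simp
      then have e: "Map V a x = - Map V a y" by (simp add: eq_neg_iff_add_eq_0)
      have "- Map V a y \<in> Space B ?h" using im(2) xy(3) subspace_neg[OF sB(2)] by blast
      moreover have "Map V a x \<in> Space A ?h" using im(1) xy(2) by blast
      ultimately have "Map V a x \<in> Space A ?h \<inter> Space B ?h" using e by simp
      then have "Map V a x \<in> Map V a ` (Space A ?t \<inter> Space B ?t)" using im(3) by simp
      then obtain w where w: "w \<in> Space A ?t" "w \<in> Space B ?t" "Map V a x = Map V a w" by blast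
      then have xw: "x = w" using inj_onD[OF inj(1)] xy(2) by blast
      have xyB: "x + y \<in> Space B ?t" using subspace_add[OF sB(1)] w(2) xy(3) xw by simp
      have "Map V a (x + y) = Map V a 0" using z(2) xy(1) z0 by simp
      then show ?thesis using inj_onD[OF inj(2)] xyB subspace_0[OF sB(1)] xy(1) by blast
    qed
    then have "inj_on (Map ?S a) (Space ?S ?t)"
      using linear_between_inj_on_iff[OF vs vs subrepD(3)[OF S th(1)] LS] by blast
    moreover have "Space ?S ?h \<subseteq> Map ?S a ` Space ?S ?t"
    proof
      fix z assume "z \<in> Space ?S ?h"
      then obtain x y where xy: "z = x + y" "x \<in> Space A ?h" "y \<in> Space B ?h" using sp[OF th(2)] by blast
      have "x \<in> Map V a ` Space A ?t" "y \<in> Map V a ` Space B ?t" using xy im(1,2) by simp_all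
      then obtain x' y' where x': "x' \<in> Space A ?t" "x = Map V a x'" "y' \<in> Space B ?t" "y = Map V a y'"
        by blast
      have "z = Map ?S a (x' + y')" using xy(1) x' add by simp
      moreover have "x' + y' \<in> Space ?S ?t" using sp[OF th(1)] x' by blast
      ultimately show "z \<in> Map ?S a ` Space ?S ?t" by blast
    qed
    moreover have "Map ?S a ` Space ?S ?t \<subseteq> Space ?S ?h" using LS unfolding linear_between_def by blast
    ultimately show ?thesis unfolding bij_betw_def by blast
  qed
  have "{a \<in> arcs Q. \<not> arrow_iso Q ?S a} \<subseteq>
      {a \<in> arcs Q. \<not> arrow_iso Q A a} \<union> {a \<in> arcs Q. \<not> arrow_iso Q B a} \<union> {a \<in> arcs Q. \<not> arrow_iso Q C a}"
    using iso by blast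
  then have "finite {a \<in> arcs Q. \<not> arrow_iso Q ?S a}"
    using A(2) B(2) fC unfolding flei_def by (meson finite_UnI finite_subset)
  moreover have "fin_dim s (Space ?S i)" if "i \<in> verts Q" for i
    using fin_dim_span_Un(1)[OF flei_fin_dim[OF A(2) that] flei_fin_dim[OF B(2) that]] by simp
  ultimately show ?thesis using subrepD(1)[OF S] unfolding flei_def fin_dim_def by blast
qed

definition zero_of :: "('i, 'a, 'v) qrep \<Rightarrow> ('i, 'a, 'v) qrep" where
  "zero_of V = \<lparr>Space = (\<lambda>i. {0}), Map = Map V\<rparr>"

lemma zero_of_subrep:
  assumes V: "quiver_rep s Q V"
  shows "subrep s Q V (zero_of V)"
proof (rule subrepI[OF V])
  show "subspace (Space (zero_of V) i) \<and> Space (zero_of V) i \<subseteq> Space V i" if "i \<in> verts Q" for i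
    using subspace_0[OF quiver_rep_subspace[OF V that]] by (simp add: zero_of_def subspace_single_0)
  show "Map V a x \<in> Space (zero_of V) (head Q a)" if "a \<in> arcs Q" "x \<in> Space (zero_of V) (tail Q a)" for a x
    using linear_between_zero[OF vs vs quiver_rep_subspace[OF V tail_in_verts[OF that(1)]] quiver_rep_linear[OF V that(1)]]
      that(2) by (simp add: zero_of_def)
qed (simp add: zero_of_def)

lemma zero_of_flei:
  assumes V: "quiver_rep s Q V"
  shows "flei s Q (zero_of V)"
proof -
  have "Map V a 0 = 0" if "a \<in> arcs Q" for a
    using linear_between_zero[OF vs vs quiver_rep_subspace[OF V tail_in_verts[OF that]] quiver_rep_linear[OF V that]] .
  then have "{a \<in> arcs Q. \<not> arrow_iso Q (zero_of V) a} = {}"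
    by (auto simp: zero_of_def bij_betw_def)
  moreover have "fin_dim s (Space (zero_of V) i)" for i using fin_dim_zero by (simp add: zero_of_def)
  ultimately show ?thesis using subrepD(1)[OF zero_of_subrep[OF V]]
    unfolding flei_def fin_dim_def by (metis finite.emptyI)
qed

lemma flei_rep_sum:
  assumes V: "quiver_rep s Q V" and "finite S" and "\<And>X. X \<in> S \<Longrightarrow> subrep s Q V X \<and> flei s Q X"
  shows "flei s Q (rep_sum s V S)"
  using assms(2,3)
proof (induction S rule: finite_induct)
  case empty
  have "rep_sum s V {} = zero_of V" unfolding rep_sum_def zero_of_def by simp
  then show ?case using zero_of_flei[OF V] by simp
next
  case (insert X S)
  have "span (Space X i \<union> (\<Union>Y\<in>S. Space Y i)) = span (Space X i \<union> span (\<Union>Y\<in>S. Space Y i))" for i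
    by (simp only: span_Un span_span)
  then have "rep_sum s V (insert X S) = rep_sum s V {X, rep_sum s V S}"
    unfolding rep_sum_def by simp
  moreover have "subrep s Q V (rep_sum s V S)" by (rule subrep_rep_sum[OF V]) (use insert.prems in blast)
  ultimately show ?case using flei_rep_sum_two[OF V] insert by auto
qed

end

section \<open>Splitting an FLEI representation along the filtration\<close>

context ordered_tree begin

text \<open>
  Every vertex is connected to the root, or to an end of an arrow in \<open>F\<close>, through isomorphisms.  So a
  representation whose arrows outside \<open>F\<close> are isomorphisms is controlled by finitely many vertices.
\<close>

lemma zero_rep_if_zero_at_ends:
  assumes X: "quiver_rep s Q X"
    and bij: "\<And>a. a \<in> arcs Q \<Longrightarrow> a \<notin> F \<Longrightarrow> arrow_iso Q X a"
    and F: "F \<subseteq> arcs Q" and zero: "\<And>v. v \<in> insert r (tail Q ` F \<union> head Q ` F) \<Longrightarrow> Space X v = {0}"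
  shows "zero_rep Q X"
  unfolding zero_rep_def
proof
  fix v assume "v \<in> verts Q"
  then have "(r, v) \<in> (linked Q {})\<^sup>*" using tree_quiver_linked[OF tree root] by blast
  then show "Space X v = {0}"
  proof (induction rule: rtrancl_induct)
    case base
    then show ?case using zero by simp
  next
    case (step u w)
    obtain a where a: "a \<in> arcs Q" "(u = tail Q a \<and> w = head Q a) \<or> (u = head Q a \<and> w = tail Q a)"
      using step.hyps unfolding linked_def by auto
    show ?case
    proof (cases "a \<in> F")
      case True
      then show ?thesis using zero[of w] a(2) by auto
    next
      case False
      then have uw: "(u, w) \<in> (linked Q F)\<^sup>*" using a unfolding linked_def by blast
      show ?thesis by (rule zero_space_linked[OF vs X bij wfQ uw step.IH])
    qed
  qed
qed

text \<open>
  What is claimed of an FLEI representation \<open>E\<close> in the filtration step of \<open>\<beta>\<close>: up to a part \<open>E2\<close>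
  that lies in the span \<open>U\<close> of everything smaller, it looks like a direct sum of \<open>m\<close> copies of a
  member of \<open>\<beta>\<close>.  Of these copies only the dimensions are recorded, \<open>d\<close> being those of one copy,
  together with the fact that smaller classes do not map to them.
\<close>

definition splits ::
  "('i, 'a, 'k) rep_class \<Rightarrow> ('i \<Rightarrow> nat) \<Rightarrow> ('i \<Rightarrow> 'v set) \<Rightarrow> ('i, 'a, 'v) qrep \<Rightarrow>
   ('i, 'a, 'v) qrep \<Rightarrow> nat \<Rightarrow> bool" where
  "splits \<beta> d U E E2 m \<longleftrightarrow> subrep s Q E E2 \<and>
     (\<forall>i\<in>verts Q. Space E2 i \<subseteq> U i \<and> dim (Space E i) = m * d i + dim (Space E2 i)) \<and>
     (\<forall>Y \<gamma> f. \<gamma> \<sqsubseteq> \<beta> \<and> \<gamma> \<noteq> \<beta> \<and> in_class s Q Y \<gamma> \<and> rep_morphism s s Q Y E f \<longrightarrow>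
        (\<forall>i\<in>verts Q. f i ` Space Y i \<subseteq> Space E2 i))"

text \<open>
  Induction on the total dimension of \<open>E\<close> at the finitely many vertices that control it; in a
  decomposition into nonzero summands both have smaller total dimension, and the hypothesis on the quotients of \<open>E\<close> passes to
  them by composition with the projection.  An indecomposable \<open>E\<close> has itself a class \<open>\<le> \<beta>\<close>, and if
  this class is \<open>\<beta>\<close> then antisymmetry excludes nonzero morphisms from smaller classes.
\<close>

lemma splits_exists:
  assumes \<beta>: "\<beta> \<in> indec_flei Q"
    and d: "\<And>X i. in_class s Q X \<beta> \<Longrightarrow> i \<in> verts Q \<Longrightarrow> dim (Space X i) = d i"
    and V: "quiver_rep s Q V"
    and U: "\<And>i. i \<in> verts Q \<Longrightarrow> subspace (U i)"
    and UX: "\<And>X \<gamma> i. \<lbrakk>subrep s Q V X; \<gamma> \<sqsubseteq> \<beta>; \<gamma> \<noteq> \<beta>; in_class s Q X \<gamma>; i \<in> verts Q\<rbrakk> \<Longrightarrow> Space X i \<subseteq> U i"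
    and E: "subrep s Q V E" "flei s Q E"
    and quot: "\<And>D f. \<lbrakk>flei s Q D; indecomposable_rep s Q D; rep_morphism s s Q E D f; \<not> zero_morphism Q E f\<rbrakk>
      \<Longrightarrow> \<exists>\<gamma>. \<gamma> \<sqsubseteq> \<beta> \<and> in_class s Q D \<gamma>"
  shows "\<exists>E2 m. splits \<beta> d U E E2 m"
proof -
  define F where "F = {a \<in> arcs Q. \<not> arrow_iso Q E a}"
  define R where "R = insert r (tail Q ` F \<union> head Q ` F)"
  have "finite F" using E(2) unfolding flei_def F_def by blast
  then have finR: "finite R" unfolding R_def by simp
  have FQ: "F \<subseteq> arcs Q" unfolding F_def by blast
  then have RQ: "R \<subseteq> verts Q" unfolding R_def using root by auto
  define size where "size X = (\<Sum>v\<in>R. dim (Space X v))" for X :: "('i, 'a, 'v) qrep"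
  have "\<And>a. a \<in> arcs Q \<Longrightarrow> a \<notin> F \<Longrightarrow> arrow_iso Q E a"
    unfolding F_def by blast
  then show ?thesis using E quot
  proof (induction "size E" arbitrary: E rule: less_induct)
    case less
    note bij = less.prems(1) and E = less.prems(2,3) and quot = less.prems(4)
    have qE: "quiver_rep s Q E" using flei_quiver_rep[OF E(2)] .
    have U0: "{0} \<subseteq> U i" if "i \<in> verts Q" for i using subspace_0[OF U[OF that]] by simp
    have all: "splits \<beta> d U E E 0" if "\<And>i. i \<in> verts Q \<Longrightarrow> Space E i \<subseteq> U i"
      unfolding splits_def using subrep_refl[OF qE] that
      by (auto simp: rep_morphism_def linear_between_def)
    show ?case
    proof (cases "zero_rep Q E")
      case True
      then show ?thesis using all U0 unfolding zero_rep_def by auto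
    next
      case nz: False
      show ?thesis
      proof (cases "indecomposable_rep s Q E")
        case True
        have "rep_morphism s s Q E E (\<lambda>i x. x)" using rep_morphism_inclusion[OF subrep_refl[OF qE]] .
        moreover have "\<not> zero_morphism Q E (\<lambda>i x. x)"
        proof
          assume "zero_morphism Q E (\<lambda>i x. x)"
          then have "Space E i = {0}" if "i \<in> verts Q" for i
            using subspace_0[OF quiver_rep_subspace[OF qE that]] that unfolding zero_morphism_def by blast
          then show False using nz unfolding zero_rep_def by blast
        qed
        ultimately obtain \<gamma> where g: "\<gamma> \<sqsubseteq> \<beta>" "in_class s Q E \<gamma>" using quot[OF E(2) True] by blast
        show ?thesis
        proof (cases "\<gamma> = \<beta>")
          case True
          have "zero_morphism Q Y f"
            if Y: "\<delta> \<sqsubseteq> \<beta>" "\<delta> \<noteq> \<beta>" "in_class s Q Y \<delta>" "rep_morphism s s Q Y E f" for Y \<delta> f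
          proof (rule ccontr)
            assume "\<not> zero_morphism Q Y f"
            then have "\<beta> \<sqsubseteq> \<delta>"
              using indec_order_if_morphism[OF wfQ vs vs below_indec(1)[OF Y(1)] \<beta> Y(3) _ Y(4)] g(2) True by blast
            then show False using below_antisym[OF Y(1)] Y(2) by blast
          qed
          then have "f i ` Space Y i \<subseteq> Space (zero_of E) i"
            if "\<delta> \<sqsubseteq> \<beta>" "\<delta> \<noteq> \<beta>" "in_class s Q Y \<delta>" "rep_morphism s s Q Y E f" "i \<in> verts Q" for Y \<delta> f i
            using that unfolding zero_morphism_def zero_of_def by fastforce
          moreover have "\<forall>i\<in>verts Q. Space (zero_of E) i \<subseteq> U i \<and> dim (Space E i) = 1 * d i + dim (Space (zero_of E) i)"
            using U0 d g(2) True fin_dim_zero(2) by (simp add: zero_of_def)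
          ultimately have "splits \<beta> d U E (zero_of E) 1"
            unfolding splits_def using zero_of_subrep[OF qE] by blast
          then show ?thesis by blast
        next
          case False
          then show ?thesis using all UX[OF E(1) g(1) _ g(2)] by blast
        qed
      next
        case False
        then obtain X Y where XY: "direct_sum_two s Q E X Y" "\<not> zero_rep Q X" "\<not> zero_rep Q Y"
          using qE nz unfolding indecomposable_rep_def by blast
        note YX = direct_sum_two_commute[OF XY(1)] and D = direct_sum_twoD[OF XY(1)]
        have dims: "dim (Space E v) = dim (Space X v) + dim (Space Y v)" if "v \<in> verts Q" for v
          using fin_dim_span_Un(3)[OF flei_fin_dim[OF flei_direct_summand[OF E(2) XY(1)] that]
              flei_fin_dim[OF flei_direct_summand[OF E(2) YX] that]]
            direct_sum_two_span[OF XY(1) that] by simp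
        have summand: "\<exists>E2 m. splits \<beta> d U X' E2 m"
          if XY: "direct_sum_two s Q E X' Y'" "\<not> zero_rep Q Y'"
            and dims: "\<And>v. v \<in> verts Q \<Longrightarrow> dim (Space E v) = dim (Space X' v) + dim (Space Y' v)" for X' Y'
        proof -
          note D = direct_sum_twoD[OF XY(1)] and YX = direct_sum_two_commute[OF XY(1)]
          have fl: "flei s Q X'" "flei s Q Y'" using flei_direct_summand E(2) XY(1) YX by blast+
          have "size E = size X' + size Y'"
            unfolding size_def sum.distrib[symmetric] using dims RQ by (intro sum.cong) auto
          moreover have "size Y' \<noteq> 0"
          proof
            assume "size Y' = 0"
            then have "dim (Space Y' v) = 0" if "v \<in> R" for v
              using finR that unfolding size_def by simp
            then have "Space Y' v = {0}" if "v \<in> R" for v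
              using fin_dim_eq_zero_iff[OF flei_fin_dim[OF fl(2)]] that RQ by blast
            then have "zero_rep Q Y'"
              using zero_rep_if_zero_at_ends[OF subrepD(1)[OF D(2)] direct_summand_bij[OF qE YX _ bij] FQ]
              unfolding R_def by blast
            then show False using XY(2) by blast
          qed
          ultimately have less_size: "size X' < size E" by simp
          obtain p where p: "rep_morphism s s Q E X' p"
            "\<And>i x. i \<in> verts Q \<Longrightarrow> x \<in> Space X' i \<Longrightarrow> p i x = x"
            using direct_sum_two_projection[OF qE XY(1)] by metis
          show ?thesis
          proof (rule less.hyps[OF less_size])
            show "bij_betw (Map X' a) (Space X' (tail Q a)) (Space X' (head Q a))"
              if "a \<in> arcs Q" "a \<notin> F" for a
              using direct_summand_bij[OF qE XY(1) that(1) bij[OF that]] .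
            show "subrep s Q V X'" using subrep_trans[OF E(1) D(1)] .
            show "flei s Q X'" by (rule fl(1))
            fix W f assume W: "flei s Q W" "indecomposable_rep s Q W"
              and f: "rep_morphism s s Q X' W f" "\<not> zero_morphism Q X' f"
            obtain i x where ix: "i \<in> verts Q" "x \<in> Space X' i" "f i x \<noteq> 0"
              using f(2) unfolding zero_morphism_def by blast
            have "x \<in> Space E i" using subrepD(4)[OF D(1) ix(1)] ix(2) by blast
            then have "\<not> zero_morphism Q E (\<lambda>i x. f i (p i x))"
              using ix p(2)[OF ix(1,2)] unfolding zero_morphism_def by metis
            then show "\<exists>\<gamma>. \<gamma> \<sqsubseteq> \<beta> \<and> in_class s Q W \<gamma>"
              using quot[OF W rep_morphism_compose[OF wfQ p(1) f(1)]] by blast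
          qed
        qed
        obtain X2 m where X: "splits \<beta> d U X X2 m" using summand[OF XY(1,3) dims] by blast
        obtain Y2 n where Y: "splits \<beta> d U Y Y2 n" using summand[OF YX XY(2)] dims by fastforce
        have sX: "subrep s Q X X2" and sY: "subrep s Q Y Y2" using X Y unfolding splits_def by auto
        define E2 where "E2 = rep_sum s E {X2, Y2}"
        have sE: "subrep s Q E E2" unfolding E2_def
          by (rule subrep_rep_sum[OF qE]) (use subrep_trans[OF D(1) sX] subrep_trans[OF D(2) sY] in auto)
        have "Space E2 i \<subseteq> U i \<and> dim (Space E i) = (m + n) * d i + dim (Space E2 i)" if i: "i \<in> verts Q" for i
        proof -
          have fd: "fin_dim s (Space X2 i)" "fin_dim s (Space Y2 i)"
            using fin_dim_subspace(1)[OF flei_fin_dim[OF flei_direct_summand[OF E(2) XY(1)] i]]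
              fin_dim_subspace(1)[OF flei_fin_dim[OF flei_direct_summand[OF E(2) YX] i]]
              subrepD(3,4)[OF sX i] subrepD(3,4)[OF sY i] by blast+
          have "Space X2 i \<inter> Space Y2 i \<subseteq> {0}"
            using direct_sum_two_span(2)[OF XY(1) i] subrepD(4)[OF sX i] subrepD(4)[OF sY i] by blast
          then have z: "Space X2 i \<inter> Space Y2 i = {0}"
            using subspace_0 subrepD(3)[OF sX i] subrepD(3)[OF sY i] by blast
          show ?thesis
            using fin_dim_span_Un(3)[OF fd z] dims[OF i] X Y i span_minimal[OF _ U[OF i], of "Space X2 i \<union> Space Y2 i"]
            unfolding splits_def E2_def by (simp add: algebra_simps)
        qed
        moreover have "f i ` Space Z i \<subseteq> Space E2 i"
          if Z: "\<gamma> \<sqsubseteq> \<beta>" "\<gamma> \<noteq> \<beta>" "in_class s Q Z \<gamma>" and f: "rep_morphism s s Q Z E f" and i: "i \<in> verts Q" for Z \<gamma> f i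
        proof
          fix y assume "y \<in> f i ` Space Z i"
          then obtain z where z: "z \<in> Space Z i" "y = f i z" by blast
          obtain p where p: "rep_morphism s s Q E X p"
            "\<And>i v. i \<in> verts Q \<Longrightarrow> v \<in> Space E i \<Longrightarrow> v - p i v \<in> Space Y i"
            "\<And>i x. i \<in> verts Q \<Longrightarrow> x \<in> Space X i \<Longrightarrow> p i x = x"
            using direct_sum_two_projection[OF qE XY(1)] by metis
          obtain q where q: "rep_morphism s s Q E Y q" "\<And>i y. i \<in> verts Q \<Longrightarrow> y \<in> Space Y i \<Longrightarrow> q i y = y"
            "\<And>i x. i \<in> verts Q \<Longrightarrow> x \<in> Space X i \<Longrightarrow> q i x = 0"
            using direct_sum_two_projection[OF qE YX] by metis
          have yE: "y \<in> Space E i" using f i z unfolding rep_morphism_def linear_between_def by blast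
          have pX: "p i y \<in> Space X i" using p(1) i yE unfolding rep_morphism_def linear_between_def by blast
          have "q i (p i y + (y - p i y)) = q i (p i y) + q i (y - p i y)"
            using q(1) i pX p(2)[OF i yE] subrepD(4)[OF D(1) i] subrepD(4)[OF D(2) i]
            unfolding rep_morphism_def linear_between_def by blast
          then have "y = p i y + q i y" using q(2)[OF i p(2)[OF i yE]] q(3)[OF i pX] by simp
          moreover have "p i y \<in> Space X2 i"
            using X Z rep_morphism_compose[OF wfQ f p(1)] i z unfolding splits_def by blast
          moreover have "q i y \<in> Space Y2 i"
            using Y Z rep_morphism_compose[OF wfQ f q(1)] i z unfolding splits_def by blast
          ultimately have "y \<in> span (Space X2 i \<union> Space Y2 i)"
            by (metis Un_iff span_add span_base)
          then show "y \<in> Space E2 i" unfolding E2_def by simp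
        qed
        ultimately have "splits \<beta> d U E E2 (m + n)"
          unfolding splits_def using sE by blast
        then show ?thesis by blast
      qed
    qed
  qed
qed

section \<open>The filtration of a representation\<close>

context
  fixes V :: "('i, 'a, 'v) qrep" and \<beta> :: "('i, 'a, 'k) rep_class"
  assumes V: "quiver_rep s Q V" and \<beta>: "\<beta> \<in> indec_flei Q"
begin

definition lower :: "('i, 'a, 'v) qrep set" where
  "lower = {Y. subrep s Q V Y \<and> (\<exists>\<gamma>. \<gamma> \<sqsubseteq> \<beta> \<and> \<gamma> \<noteq> \<beta> \<and> in_class s Q Y \<gamma>)}"

definition members :: "('i, 'a, 'v) qrep set" where
  "members = {X. subrep s Q V X \<and> in_class s Q X \<beta>}"

lemma F_le_subrep: "subrep s Q V (F_le s Q V \<alpha>)"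
  unfolding F_le_def by (rule subrep_rep_sum[OF V]) blast

lemma F_less_subrep: "subrep s Q V (F_less s Q V \<alpha>)"
  unfolding F_less_def by (rule subrep_rep_sum[OF V]) (use F_le_subrep in blast)

lemma F_le_Space: "Space (F_le s Q V \<beta>) i = span (\<Union>X\<in>lower \<union> members. Space X i)"
proof -
  have "{X. subrep s Q V X \<and> (\<exists>\<alpha>. \<alpha> \<sqsubseteq> \<beta> \<and> in_class s Q X \<alpha>)} = lower \<union> members"
    unfolding lower_def members_def using below_refl[OF \<beta>] by blast
  then show ?thesis unfolding F_le_def by simp
qed

lemma F_less_Space: "Space (F_less s Q V \<beta>) i = span (\<Union>X\<in>lower. Space X i)"
proof (rule subset_antisym)
  have "Space (F_le s Q V \<alpha>) i \<subseteq> span (\<Union>X\<in>lower. Space X i)" if a: "\<alpha> \<sqsubseteq> \<beta>" "\<alpha> \<noteq> \<beta>" for \<alpha>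
  proof -
    have "X \<in> lower" if "subrep s Q V X" "\<gamma> \<sqsubseteq> \<alpha>" "in_class s Q X \<gamma>" for X \<gamma>
      unfolding lower_def using that a below_trans[OF that(2) a(1)] below_antisym[OF a(1)] by blast
    then show ?thesis unfolding F_le_def rep_sum_Space by (intro span_mono) blast
  qed
  then have "(\<Union>X\<in>{F_le s Q V \<alpha> |\<alpha>. \<alpha> \<sqsubseteq> \<beta> \<and> \<alpha> \<noteq> \<beta>}. Space X i) \<subseteq> span (\<Union>X\<in>lower. Space X i)" by blast
  then show "Space (F_less s Q V \<beta>) i \<subseteq> span (\<Union>X\<in>lower. Space X i)"
    unfolding F_less_def rep_sum_Space by (rule span_minimal) simp
  have "Space Y i \<subseteq> Space (F_less s Q V \<beta>) i" if Y: "Y \<in> lower" for Y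
  proof -
    obtain \<gamma> where g: "subrep s Q V Y" "\<gamma> \<sqsubseteq> \<beta>" "\<gamma> \<noteq> \<beta>" "in_class s Q Y \<gamma>"
      using Y unfolding lower_def by blast
    have "Y \<in> {X. subrep s Q V X \<and> (\<exists>\<alpha>. \<alpha> \<sqsubseteq> \<gamma> \<and> in_class s Q X \<alpha>)}"
      using g(1,4) below_refl[OF below_indec(1)[OF g(2)]] by blast
    then have "Space Y i \<subseteq> Space (F_le s Q V \<gamma>) i"
      unfolding F_le_def rep_sum_Space by (meson UN_upper order_trans span_superset)
    also have "\<dots> \<subseteq> Space (F_less s Q V \<beta>) i"
      unfolding F_less_def rep_sum_Space
      by (rule order_trans[OF _ span_superset]) (use g(2,3) in blast)
    finally show ?thesis .
  qed
  then show "span (\<Union>X\<in>lower. Space X i) \<subseteq> Space (F_less s Q V \<beta>) i"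
    unfolding F_less_def rep_sum_Space by (intro span_minimal) auto
qed

text \<open>
  Independence modulo \<open>F\<^sub><\<^sub>\<beta>\<close>, tested on finite subsets so that it passes to unions of chains.
\<close>

definition independent_members :: "('i, 'a, 'v) qrep set \<Rightarrow> bool" where
  "independent_members S \<longleftrightarrow> S \<subseteq> members \<and>
     (\<forall>T i g. finite T \<and> T \<subseteq> S \<and> i \<in> verts Q \<and> (\<forall>X\<in>T. g X \<in> Space X i) \<and>
        sum g T \<in> Space (F_less s Q V \<beta>) i \<longrightarrow> (\<forall>X\<in>T. g X = 0))"

lemma independent_membersD:
  assumes "independent_members S" "finite T" "T \<subseteq> S" "i \<in> verts Q" "\<And>X. X \<in> T \<Longrightarrow> g X \<in> Space X i"
    "sum g T \<in> Space (F_less s Q V \<beta>) i" "X \<in> T"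
  shows "g X = 0"
  using assms unfolding independent_members_def by blast

lemma maximal_independent_members:
  obtains S where "independent_members S" "\<And>X. X \<notin> S \<Longrightarrow> \<not> independent_members (insert X S)"
proof -
  have "\<exists>M\<in>{S. independent_members S}. \<forall>X\<in>{S. independent_members S}. M \<subseteq> X \<longrightarrow> X = M"
  proof (rule subset_Zorn')
    fix C assume C: "subset.chain {S. independent_members S} C"
    then have CI: "\<And>S. S \<in> C \<Longrightarrow> independent_members S" unfolding subset.chain_def by blast
    have "\<exists>S\<in>C. T \<subseteq> S" if "finite T" "T \<subseteq> \<Union> C" "T \<noteq> {}" for T
    proof -
      have "C \<noteq> {}" using that(2,3) by blast
      then show ?thesis using finite_subset_Union_chain[OF that(1,2) _ C] by metis
    qed
    moreover have "\<Union> C \<subseteq> members" using CI unfolding independent_members_def by blast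
    ultimately have "independent_members (\<Union> C)"
      using CI unfolding independent_members_def by (metis (no_types, lifting) empty_iff)
    then show "\<Union> C \<in> {S. independent_members S}" by simp
  qed
  then obtain S where S: "independent_members S" "\<And>X. independent_members X \<Longrightarrow> S \<subseteq> X \<Longrightarrow> X = S" by blast
  then have "\<not> independent_members (insert X S)" if "X \<notin> S" for X using that by blast
  then show thesis using that S(1) by blast
qed

lemma member_dim_eq:
  assumes X: "in_class s Q X \<beta>" and Y: "in_class s Q Y \<beta>" and i: "i \<in> verts Q"
  shows "dim (Space X i) = dim (Space Y i)"
proof -
  have le: "dim (Space A i) \<le> dim (Space B i)" if A: "in_class s Q A \<beta>" and B: "in_class s Q B \<beta>" for A B
  proof -
    obtain f where f: "rep_isomorphism s s Q A B f"
      using in_class_isomorphic[OF wfQ vs vs \<beta> A B] unfolding rep_isomorphic_def by blast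
    have "linear_between s s (Space A i) (Space B i) (f i)" "inj_on (f i) (Space A i)"
      using f i unfolding rep_isomorphism_def rep_morphism_def bij_betw_def by auto
    then show ?thesis
      using linear_between_dim_le[OF vs vs flei_fin_dim[OF _ i] flei_fin_dim[OF _ i]]
        in_class_flei_indecomposable(1)[OF wfQ vs \<beta>] A B by blast
  qed
  show ?thesis using le[OF X Y] le[OF Y X] by simp
qed

text \<open>
  A relation between a further member \<open>X\<close> and the independent ones forces \<open>X\<close> into their sum.
  The relation lives in an FLEI representation \<open>E\<close>; in \<open>E\<close> modulo its part below \<open>\<beta>\<close>, which has the
  dimensions of \<open>m\<close> copies, the \<open>n\<close> independent members take up \<open>n\<close> copies and \<open>X\<close> adds at most one.
  So either they fill everything, or \<open>X\<close> meets them trivially.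
\<close>

lemma dependent_member_absorbed:
  assumes S: "independent_members S" and X: "X \<in> members" "X \<notin> S"
    and dep: "\<not> independent_members (insert X S)" and i0: "i0 \<in> verts Q"
  shows "Space X i0 \<subseteq> span (\<Union>Z\<in>lower \<union> S. Space Z i0)"
proof (rule ccontr)
  assume "\<not> ?thesis"
  then obtain x0 where x0: "x0 \<in> Space X i0" "x0 \<notin> span (\<Union>Z\<in>lower \<union> S. Space Z i0)" by blast
  let ?U = "\<lambda>i. Space (F_less s Q V \<beta>) i"
  have Xs: "subrep s Q V X" and XC: "in_class s Q X \<beta>" using X(1) unfolding members_def by auto
  have Sm: "Z \<in> members" if "Z \<in> S" for Z using S that unfolding independent_members_def by blast
  have fX: "flei s Q X" and iX: "indecomposable_rep s Q X"
    using in_class_flei_indecomposable[OF wfQ vs \<beta> XC] by auto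
  have sU: "subspace (?U i)" if "i \<in> verts Q" for i using subrepD(3)[OF F_less_subrep that] .
  have "insert X S \<subseteq> members" using X(1) Sm by blast
  with dep have "\<exists>T i g. (finite T \<and> T \<subseteq> insert X S \<and> i \<in> verts Q \<and> (\<forall>Z\<in>T. g Z \<in> Space Z i) \<and>
      sum g T \<in> ?U i) \<and> \<not> (\<forall>Z\<in>T. g Z = 0)"
    unfolding independent_members_def by (simp only: simp_thms not_all not_imp)
  then obtain T g i where T: "finite T" "T \<subseteq> insert X S" "i \<in> verts Q" "\<And>Z. Z \<in> T \<Longrightarrow> g Z \<in> Space Z i"
    "sum g T \<in> ?U i" "\<exists>Z\<in>T. g Z \<noteq> 0" by blast
  define T' where "T' = T - {X}"
  have T': "finite T'" "T' \<subseteq> S" "\<And>Z. Z \<in> T' \<Longrightarrow> g Z \<in> Space Z i" using T unfolding T'_def by auto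
  have XT: "X \<in> T" using independent_membersD[OF S T(1) _ T(3,4,5)] T(2,6) by blast
  have sumT: "sum g T = g X + sum g T'" unfolding T'_def using T(1) XT by (simp add: sum.remove)
  have gX: "g X \<noteq> 0"
  proof
    assume 0: "g X = 0"
    then have "g Z = 0" if "Z \<in> T'" for Z
      using independent_membersD[OF S T'(1,2) T(3) T'(3) _ that] sumT T(5) by simp
    then show False using T(6) 0 unfolding T'_def by blast
  qed
  have "sum g T \<in> span (\<Union>Y\<in>lower. Space Y i)" using T(5) F_less_Space by simp
  moreover have "subspace (Space Y i)" if "Y \<in> lower" for Y
    using that subrepD(3)[OF _ T(3)] unfolding lower_def by blast
  ultimately obtain L h where L: "finite L" "L \<subseteq> lower" "\<And>Y. Y \<in> L \<Longrightarrow> h Y \<in> Space Y i" "sum g T = sum h L"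
    using span_family_sum[of lower "\<lambda>Y. Space Y i"] by metis
  define G where "G = insert X (T' \<union> L)"
  define E where "E = rep_sum s V G"
  have Gclass: "\<exists>\<gamma>. \<gamma> \<sqsubseteq> \<beta> \<and> in_class s Q Z \<gamma> \<and> subrep s Q V Z" if "Z \<in> G" for Z
    using that X(1) Sm T'(2) L(2) below_refl[OF \<beta>] unfolding G_def members_def lower_def by blast
  have Gsub: "subrep s Q V Z" and Gflei: "flei s Q Z" if "Z \<in> G" for Z
    using Gclass[OF that] in_class_flei_indecomposable(1)[OF wfQ vs below_indec(1)] by blast+
  have Esub: "subrep s Q V E" unfolding E_def by (rule subrep_rep_sum[OF V Gsub])
  have Efl: "flei s Q E" unfolding E_def
    by (rule flei_rep_sum[OF V]) (use Gsub Gflei T'(1) L(1) in \<open>auto simp: G_def\<close>)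
  have qE: "quiver_rep s Q E" using flei_quiver_rep[OF Efl] .
  have GE: "subrep s Q E Z" if "Z \<in> G" for Z
    unfolding E_def by (rule subrep_rep_sum_member[OF V Gsub that])
  have quot: "\<exists>\<gamma>. \<gamma> \<sqsubseteq> \<beta> \<and> in_class s Q D \<gamma>"
    if D: "flei s Q D" "indecomposable_rep s Q D" and f: "rep_morphism s s Q E D f" "\<not> zero_morphism Q E f" for D f
  proof -
    have "\<exists>Z\<in>G. \<not> zero_morphism Q Z f"
    proof (rule ccontr)
      assume "\<not> ?thesis"
      then have z: "f j x = 0" if "Z \<in> G" "j \<in> verts Q" "x \<in> Space Z j" for Z j x
        using that unfolding zero_morphism_def by blast
      have "f j x = 0" if j: "j \<in> verts Q" and x: "x \<in> Space E j" for j x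
      proof -
        have lin: "linear_between s s (Space E j) (Space D j) (f j)" using f(1) j unfolding rep_morphism_def by blast
        have sE: "subspace (Space E j)" using quiver_rep_subspace[OF qE j] .
        have "x \<in> span (\<Union>Z\<in>G. Space Z j)" using x unfolding E_def by simp
        then have "x \<in> Space E j \<and> f j x = 0"
        proof (induction rule: span_induct_alt)
          case base
          show ?case using subspace_0[OF sE] linear_between_zero[OF vs vs sE lin] by blast
        next
          case (step c y w)
          then obtain Z where Z: "Z \<in> G" "y \<in> Space Z j" by blast
          then have y: "y \<in> Space E j" "f j y = 0" using subrepD(4)[OF GE j] z j by blast+
          have cy: "s c y \<in> Space E j" using subspace_scale[OF sE y(1)] .
          have "f j (s c y) = 0" using lin y unfolding linear_between_def by simp
          then have "f j (s c y + w) = 0" using lin cy step.IH unfolding linear_between_def by simp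
          then show ?case using subspace_add[OF sE cy] step.IH by blast
        qed
        then show ?thesis by blast
      qed
      then show False using f(2) unfolding zero_morphism_def by blast
    qed
    then obtain Z where Z: "Z \<in> G" "\<not> zero_morphism Q Z f" by blast
    obtain \<gamma> where g: "\<gamma> \<sqsubseteq> \<beta>" "in_class s Q Z \<gamma>" using Gclass[OF Z(1)] by blast
    obtain \<delta> :: "('i, 'a, 'k) rep_class" where d: "\<delta> \<in> indec_flei Q" "in_class s Q D \<delta>"
      by (rule indecomposable_flei_has_class[OF wfQ vs D])
    have "\<delta> \<sqsubseteq> \<gamma>"
      using indec_order_if_morphism[OF wfQ vs vs below_indec(1)[OF g(1)] d(1) g(2) d(2)
          rep_morphism_restrict[OF GE[OF Z(1)] f(1) wfQ] Z(2)] .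
    then show ?thesis using d(2) below_trans[OF _ g(1)] by blast
  qed
  have UX: "Space Y j \<subseteq> ?U j"
    if "subrep s Q V Y" "\<gamma> \<sqsubseteq> \<beta>" "\<gamma> \<noteq> \<beta>" "in_class s Q Y \<gamma>" "j \<in> verts Q" for Y \<gamma> j
  proof -
    have "Y \<in> lower" using that unfolding lower_def by blast
    then show ?thesis unfolding F_less_Space by (meson UN_upper order_trans span_superset)
  qed
  define d where "d j = dim (Space X j)" for j
  have "dim (Space Y j) = d j" if "in_class s Q Y \<beta>" "j \<in> verts Q" for Y j
    unfolding d_def using member_dim_eq[OF that(1) XC that(2)] .
  then have "\<exists>E2 m. splits \<beta> d ?U E E2 m"
    by (rule splits_exists[OF \<beta> _ V sU UX Esub Efl quot])
  then obtain E2 m where E12: "splits \<beta> d ?U E E2 m" by blast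
  have sE2: "subrep s Q E E2" and E2U: "\<And>j. j \<in> verts Q \<Longrightarrow> Space E2 j \<subseteq> ?U j"
    and Ed: "\<And>j. j \<in> verts Q \<Longrightarrow> dim (Space E j) = m * d j + dim (Space E2 j)"
    using E12 unfolding splits_def by blast+
  have fd2: "fin_dim s (Space E2 j)" if "j \<in> verts Q" for j
    using fin_dim_subspace(1)[OF flei_fin_dim[OF Efl that] subrepD(3,4)[OF sE2 that]] .
  have LE2: "Space Y j \<subseteq> Space E2 j" if Y: "Y \<in> L" and j: "j \<in> verts Q" for Y j
  proof -
    obtain \<gamma> where g: "\<gamma> \<sqsubseteq> \<beta>" "\<gamma> \<noteq> \<beta>" "in_class s Q Y \<gamma>" using Y L(2) unfolding lower_def by blast
    have "rep_morphism s s Q Y E (\<lambda>i x. x)" by (rule rep_morphism_inclusion[OF GE]) (use Y G_def in blast)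
    then have "(\<lambda>x. x) ` Space Y j \<subseteq> Space E2 j" using E12 g j unfolding splits_def by blast
    then show ?thesis by simp
  qed
  define n where "n = card T'"
  define N where "N j = span (\<Union>Z\<in>T'. Space Z j)" for j
  define W where "W j = span (N j \<union> Space E2 j)" for j
  have T'G: "Z \<in> G" "in_class s Q Z \<beta>" if "Z \<in> T'" for Z
    using that T'(2) Sm unfolding G_def members_def by blast+
  have Nd: "fin_dim s (N j) \<and> dim (N j) = n * d j" if j: "j \<in> verts Q" for j
  proof -
    have "fin_dim s (N j) \<and> dim (N j) = (\<Sum>Z\<in>T'. dim (Space Z j))"
      unfolding N_def
    proof (rule dim_span_family[OF T'(1)])
      show "fin_dim s (Space Z j)" if "Z \<in> T'" for Z using flei_fin_dim[OF Gflei[OF T'G(1)[OF that]] j] .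
      show "\<forall>Z\<in>T'. k Z = 0" if "\<And>Z. Z \<in> T' \<Longrightarrow> k Z \<in> Space Z j" "sum k T' = 0" for k
        using independent_membersD[OF S T'(1,2) j that(1)] that(2) subspace_0[OF sU[OF j]] by simp
    qed
    moreover have "(\<Sum>Z\<in>T'. dim (Space Z j)) = (\<Sum>Z\<in>T'. d j)"
      using member_dim_eq[OF T'G(2) XC j] unfolding d_def by (intro sum.cong) auto
    ultimately show ?thesis unfolding n_def by simp
  qed
  have NE2: "N j \<inter> Space E2 j = {0}" if j: "j \<in> verts Q" for j
  proof -
    have "w = 0" if w: "w \<in> N j" "w \<in> Space E2 j" for w
    proof -
      have sZ: "subspace (Space Z j)" if "Z \<in> T'" for Z using subrepD(3)[OF Gsub[OF T'G(1)[OF that]] j] .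
      obtain T2 k where k: "finite T2" "T2 \<subseteq> T'" "\<And>Z. Z \<in> T2 \<Longrightarrow> k Z \<in> Space Z j" "w = sum k T2"
        using span_family_sum[of T' "\<lambda>Z. Space Z j" w] sZ w(1) unfolding N_def by metis
      have "sum k T2 \<in> ?U j" using E2U[OF j] w(2) k(4) by blast
      then have "k Z = 0" if "Z \<in> T2" for Z
        using independent_membersD[OF S k(1) _ j k(3)] k(2) T'(2) that by blast
      then show ?thesis using k(4) by simp
    qed
    moreover have "0 \<in> N j" "0 \<in> Space E2 j"
      unfolding N_def using span_zero subspace_0[OF subrepD(3)[OF sE2 j]] by auto
    ultimately show ?thesis by blast
  qed
  have Wd: "fin_dim s (W j)" "dim (W j) = n * d j + dim (Space E2 j)" if j: "j \<in> verts Q" for j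
    using fin_dim_span_Un(1,3)[of "N j" "Space E2 j"] Nd[OF j] fd2[OF j] NE2[OF j]
    unfolding W_def by auto
  have NW: "N j \<subseteq> W j" "Space E2 j \<subseteq> W j" for j
    unfolding W_def using span_superset by blast+
  have WE: "W j \<subseteq> Space E j" if j: "j \<in> verts Q" for j
  proof -
    have "(\<Union>Z\<in>T'. Space Z j) \<subseteq> Space E j" using subrepD(4)[OF GE[OF T'G(1)] j] by blast
    then have "N j \<subseteq> Space E j" unfolding N_def using span_minimal quiver_rep_subspace[OF qE j] by blast
    then show ?thesis unfolding W_def
      using span_minimal quiver_rep_subspace[OF qE j] subrepD(4)[OF sE2 j] by (meson Un_least)
  qed
  have EXW: "Space E j = span (Space X j \<union> W j)" if j: "j \<in> verts Q" for j
  proof (rule subset_antisym)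
    have "Space Z j \<subseteq> Space X j \<union> W j" if "Z \<in> G" for Z
    proof -
      have "Space Z j \<subseteq> N j" if "Z \<in> T'" unfolding N_def
        by (rule order_trans[OF _ span_superset]) (use that in blast)
      then show ?thesis using \<open>Z \<in> G\<close> LE2[OF _ j] NW[of j] unfolding G_def by blast
    qed
    then have "(\<Union>Z\<in>G. Space Z j) \<subseteq> Space X j \<union> W j" by blast
    then show "Space E j \<subseteq> span (Space X j \<union> W j)" unfolding E_def rep_sum_Space by (rule span_mono)
    have "Space X j \<union> W j \<subseteq> Space E j" using subrepD(4)[OF GE j] WE[OF j] unfolding G_def by blast
    then show "span (Space X j \<union> W j) \<subseteq> Space E j" using span_minimal quiver_rep_subspace[OF qE j] by blast
  qed
  have nm: "n * d j \<le> m * d j" and mn: "m * d j \<le> n * d j + d j" if j: "j \<in> verts Q" for j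
  proof -
    show "n * d j \<le> m * d j"
      using fin_dim_subspace(2)[OF flei_fin_dim[OF Efl j] _ WE[OF j]] Wd(2)[OF j] Ed[OF j] unfolding W_def by simp
    show "m * d j \<le> n * d j + d j"
      using fin_dim_span_Un(2)[OF flei_fin_dim[OF fX j] Wd(1)[OF j]] Wd(2)[OF j] Ed[OF j] EXW[OF j]
      unfolding d_def by simp
  qed
  obtain j where j: "j \<in> verts Q" "d j \<noteq> 0"
    using iX fin_dim_eq_zero_iff[OF flei_fin_dim[OF fX]] unfolding indecomposable_rep_def zero_rep_def d_def by blast
  have "m = n \<or> m = Suc n"
  proof -
    have "n \<le> m" using nm[OF j(1)] j(2) by simp
    moreover have "m * d j \<le> Suc n * d j" using mn[OF j(1)] by simp
    then have "m \<le> Suc n" using j(2) by (metis mult_le_cancel2 neq0_conv)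
    ultimately show ?thesis by linarith
  qed
  then show False
  proof
    assume "m = n"
    then have "dim (W i0) = dim (Space E i0)" using Wd(2)[OF i0] Ed[OF i0] by simp
    then have "W i0 = Space E i0"
      using fin_dim_psubspace_dim_less[OF flei_fin_dim[OF Efl i0], of "W i0"] WE[OF i0] unfolding W_def by auto
    then have "x0 \<in> W i0" using x0(1) subrepD(4)[OF GE i0, of X] unfolding G_def by blast
    moreover have "N i0 \<subseteq> span (\<Union>Z\<in>lower \<union> S. Space Z i0)"
      unfolding N_def using T'(2) by (intro span_mono) blast
    moreover have "Space E2 i0 \<subseteq> span (\<Union>Z\<in>lower \<union> S. Space Z i0)"
      using E2U[OF i0] span_mono[of "\<Union>Z\<in>lower. Space Z i0" "\<Union>Z\<in>lower \<union> S. Space Z i0"]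
      unfolding F_less_Space by blast
    ultimately show False using x0(2) span_minimal[of "N i0 \<union> Space E2 i0"] unfolding W_def by blast
  next
    assume "m = Suc n"
    then have "Space X i \<inter> W i = {0}"
      using fin_dim_sum_direct[OF flei_fin_dim[OF fX T(3)] Wd(1)[OF T(3)]] Wd(2)[OF T(3)] Ed[OF T(3)] EXW[OF T(3)]
      unfolding d_def by simp
    moreover have "g X \<in> W i"
    proof -
      have "g Z \<in> N i" if "Z \<in> T'" for Z
        unfolding N_def by (rule span_base, rule UN_I, rule that, rule T'(3)[OF that])
      then have "sum g T' \<in> N i" unfolding N_def by (rule span_sum)
      moreover have "sum h L \<in> Space E2 i"
        by (rule subspace_sum[OF subrepD(3)[OF sE2 T(3)]]) (use L(3) LE2[OF _ T(3)] in blast)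
      ultimately have "sum g T' \<in> W i" "sum h L \<in> W i" using NW[of i] by blast+
      moreover have "subspace (W i)" unfolding W_def by simp
      moreover have "g X = sum h L - sum g T'" using sumT L(4) by (simp add: algebra_simps)
      ultimately show ?thesis using subspace_diff by simp
    qed
    ultimately show False using gX T(4)[OF XT] by blast
  qed
qed

text \<open>
  Independence makes the sum of a maximal independent set direct and disjoint from \<open>F\<^sub><\<^sub>\<beta>\<close>; by
  maximality every other member depends on it and is absorbed.
\<close>

lemma filtration_step_splits:
  "\<exists>G. subrep s Q (F_le s Q V \<beta>) G \<and> (\<exists>S. (\<forall>X\<in>S. in_class s Q X \<beta>) \<and> direct_sum_of s Q G S) \<and>
       direct_sum_two s Q (F_le s Q V \<beta>) (F_less s Q V \<beta>) G"
proof -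
  let ?F = "F_le s Q V \<beta>" and ?U = "F_less s Q V \<beta>"
  obtain S where S: "independent_members S" and max: "\<And>X. X \<notin> S \<Longrightarrow> \<not> independent_members (insert X S)"
    by (rule maximal_independent_members) blast
  have SC: "subrep s Q V X" "in_class s Q X \<beta>" "X \<in> members" if "X \<in> S" for X
    using S that unfolding independent_members_def members_def by auto
  define G where "G = rep_sum s V S"
  have GV: "subrep s Q V G" unfolding G_def by (rule subrep_rep_sum[OF V SC(1)])
  have GF: "Space G i \<subseteq> Space ?F i" for i
    unfolding G_def F_le_Space rep_sum_Space using SC(3) by (intro span_mono) blast
  have UF: "Space ?U i \<subseteq> Space ?F i" for i
    unfolding F_less_Space F_le_Space by (intro span_mono) blast
  have sS: "subspace (Space X i)" if "X \<in> S" "i \<in> verts Q" for X i using subrepD(3)[OF SC(1)] that by blast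
  have 0: "0 \<in> Space ?U i" if "i \<in> verts Q" for i using subspace_0[OF subrepD(3)[OF F_less_subrep that]] .
  have "direct_sum_of s Q G S"
    unfolding direct_sum_of_def
  proof (intro conjI ballI)
    show "subrep s Q G X" if "X \<in> S" for X
      unfolding G_def by (rule subrep_rep_sum_member[OF V SC(1) that])
    fix i assume i: "i \<in> verts Q"
    show "Space G i = span (\<Union>X\<in>S. Space X i)" unfolding G_def by simp
    fix X assume X: "X \<in> S"
    have "z = 0" if z: "z \<in> Space X i" "z \<in> span (\<Union>Y\<in>S - {X}. Space Y i)" for z
    proof -
      obtain T g where T: "finite T" "T \<subseteq> S - {X}" "\<And>Y. Y \<in> T \<Longrightarrow> g Y \<in> Space Y i" "z = sum g T"
        using span_family_sum[of "S - {X}" "\<lambda>Y. Space Y i" z] sS i z(2) by (metis DiffD1)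
      let ?g = "g(X := - z)"
      have XT: "X \<notin> T" using T(2) by blast
      have "sum ?g T = sum g T" using XT by (intro sum.cong) auto
      then have "sum ?g (insert X T) = 0" using T(1,4) XT by simp
      moreover have "?g Y \<in> Space Y i" if "Y \<in> insert X T" for Y
        using that T(3) z(1) subspace_neg[OF sS[OF X i]] by auto
      moreover have "insert X T \<subseteq> S" "finite (insert X T)" using T(1,2) X by auto
      ultimately have "?g X = 0"
        using independent_membersD[OF S, of "insert X T" i ?g X] i 0[OF i] by auto
      then show ?thesis by simp
    qed
    then show "Space X i \<inter> span (\<Union>Y\<in>S - {X}. Space Y i) = {0}"
      using subspace_0[OF sS[OF X i]] span_zero by blast
  qed
  moreover have "direct_sum_two s Q ?F ?U G"
    unfolding direct_sum_two_def
  proof (intro conjI ballI)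
    show "subrep s Q ?F ?U" "subrep s Q ?F G"
      using subrep_between[OF F_less_subrep F_le_subrep UF] subrep_between[OF GV F_le_subrep GF] .
    fix i assume i: "i \<in> verts Q"
    let ?N = "span (\<Union>Z\<in>lower \<union> S. Space Z i)"
    have N: "?N = {x + y |x y. x \<in> Space ?U i \<and> y \<in> Space G i}"
      unfolding F_less_Space G_def rep_sum_Space UN_Un span_Un ..
    have "Space X i \<subseteq> ?N" if "X \<in> lower \<union> members" for X
    proof (cases "X \<in> lower \<union> S")
      case True
      then show ?thesis by (meson UN_upper order_trans span_superset)
    next
      case False
      then show ?thesis using dependent_member_absorbed[OF S _ _ max i] that by blast
    qed
    then have "(\<Union>X\<in>lower \<union> members. Space X i) \<subseteq> ?N" by blast
    then have "Space ?F i \<subseteq> ?N" unfolding F_le_Space by (rule span_minimal) simp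
    moreover have "?N \<subseteq> Space ?F i" unfolding F_le_Space using SC(3) by (intro span_mono) blast
    ultimately show "Space ?F i = {x + y |x y. x \<in> Space ?U i \<and> y \<in> Space G i}" using N by simp
    have "z = 0" if z: "z \<in> Space ?U i" "z \<in> Space G i" for z
    proof -
      obtain T g where T: "finite T" "T \<subseteq> S" "\<And>Y. Y \<in> T \<Longrightarrow> g Y \<in> Space Y i" "z = sum g T"
        using span_family_sum[of S "\<lambda>Y. Space Y i" z] sS i z(2) unfolding G_def rep_sum_Space by metis
      have "g Y = 0" if "Y \<in> T" for Y
        using independent_membersD[OF S T(1,2) i T(3) _ that] z(1) T(4) by simp
      then show ?thesis using T(4) by simp
    qed
    moreover have "0 \<in> Space G i" unfolding G_def using span_zero by simp
    ultimately show "Space ?U i \<inter> Space G i = {0}" using 0[OF i] by blast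
  qed
  ultimately show ?thesis using subrep_between[OF GV F_le_subrep GF] SC(2) by blast
qed

end

end

theorem proposition6p2:
  fixes Q :: "('i, 'a) pre_digraph"
    and s :: "'k::field \<Rightarrow> 'v::ab_group_add \<Rightarrow> 'v"
    and V :: "('i, 'a, 'v) qrep"
  assumes "wf_digraph Q" and "tree_quiver Q"
    and "partial_order_on (indec_flei Q :: ('i, 'a, 'k) rep_class set) (indec_order Q)"
    and "wf ((indec_order Q :: (('i, 'a, 'k) rep_class \<times> ('i, 'a, 'k) rep_class) set) - Id)"
    and "vector_space s" and "quiver_rep s Q V"
  shows "\<forall>\<beta> \<in> (indec_flei Q :: ('i, 'a, 'k) rep_class set).
           \<exists>G. subrep s Q (F_le s Q V \<beta>) G \<and>
               (\<exists>S. (\<forall>X\<in>S. in_class s Q X \<beta>) \<and> direct_sum_of s Q G S) \<and>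
               direct_sum_two s Q (F_le s Q V \<beta>) (F_less s Q V \<beta>) G"
proof
  fix \<beta> :: "('i, 'a, 'k) rep_class" assume \<beta>: "\<beta> \<in> indec_flei Q"
  have "verts Q \<noteq> {}"
    using assms(2) unfolding tree_quiver_def connected_def strongly_connected_def by simp
  then obtain r where r: "r \<in> verts Q" by blast
  interpret ordered_tree s Q r
    by (intro ordered_tree.intro quiver_ambient.intro rooted_tree.intro rooted_tree_axioms.intro
        ordered_tree_axioms.intro assms(1-5) r)
  show "\<exists>G. subrep s Q (F_le s Q V \<beta>) G \<and> (\<exists>S. (\<forall>X\<in>S. in_class s Q X \<beta>) \<and> direct_sum_of s Q G S) \<and>
      direct_sum_two s Q (F_le s Q V \<beta>) (F_less s Q V \<beta>) G"
    using filtration_step_splits[OF assms(6) \<beta>] .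
qed

end
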